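(* Among all admissible horoball packings $\mathcal{B}=(B_1,\dots,B_{24})$ related to the regular ideal hyperbolic 24-cell $P_{24}$ (the tile of the honeycomb with Schläfli symbol $\{3,4,3,4\}$ in $\mathbb{H}^4$), where horoballs of different types are allowed at the various ideal vertices, the generalized polyhedral density $\delta(\mathcal{B})$ attains its maximum at the arrangement $\mathcal{B}_1$, and this maximal density is $\delta_{opt}(\mathcal{B})=\delta(\mathcal{B}_1)\approx 0.71645$.
   Context: Hyperbolic 4-space $\mathbb{H}^4$ (sectional curvature $-1$) is given by the Beltrami–Cayley–Klein model in the open unit ball of $\mathbb{R}^4$ centred at $O$; the unit sphere is the ideal boundary. $P_{24}$ is the ideal regular 24-cell, the convex hull of the 24 ideal points $A_1,\dots,A_{24}$, namely all points obtained by permuting coordinates in $\frac{1}{\sqrt2}(\pm1,\pm1,0,0)$. In particular $A_1=\frac1{\sqrt2}(1,1,0,0)$, $A_{13}=-A_1$, $A_2=\frac1{\sqrt2}(1,-1,0,0)$, $A_{14}=-A_2$, $A_{11}=\frac1{\sqrt2}(0,0,1,1)$, $A_{23}=-A_{11}$, $A_{12}=\frac1{\sqrt2}(0,0,-1,1)$, $A_{24}=-A_{12}$. $P_{24}$ has 24 octahedral facets, is a tile of the regular honeycomb $\{3,4,3,4\}$, and has volume $\frac43\pi^2$. Admissible packing: a family of horoballs $B_i$ ($i=1,\dots,24$), $B_i$ with ideal centre $A_i$, whose interiors are pairwise disjoint and such that for each $i$ the horoball $B_i$ does not cross any of the 18 facet hyperplanes of $P_{24}$ that do not contain $A_i$ (i.e.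 the interior of $B_i$ is disjoint from these hyperplanes; tangency is allowed). Two horoballs are of the same type if $\mathrm{Vol}(B_i\cap P_{24})=\mathrm{Vol}(B_j\cap P_{24})$; different types are allowed. Generalized polyhedral density: $\delta(\mathcal{B})=\dfrac{\sum_{i=1}^{24}\mathrm{Vol}(B_i\cap P_{24})}{\mathrm{Vol}(P_{24})}$. The arrangement $\mathcal{B}_1$: the eight "large" horoballs $B_i$, $i\in\{1,2,11,12,13,14,23,24\}$, are all of the same type, and any two of them whose centres are the endpoints of a diagonal of an octahedral facet of $P_{24}$ touch each other at the centre of that facet (e.g. $B_1$ and $B_{11}$ touch at the facet centre $\frac{1}{2\sqrt2}(1,1,1,1)$). The other sixteen "smaller" horoballs are all of the same type and each is tangent to the large horoballs whose centres are joined to its centre by an edge of $P_{24}$. *)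

theory Defs
  imports "HOL-Analysis.Analysis"
begin

text \<open>
  Hyperbolic 4-space is the open unit ball \<^term>\<open>ball 0 1 :: (real^4) set\<close> in the
  Beltrami--Cayley--Klein model; the ideal points are the unit vectors.  Hyperbolic hyperplanes
  and polytopes are the traces of the affine ones.
\<close>

definition hyp_dist :: "real^4 \<Rightarrow> real^4 \<Rightarrow> real" where
  "hyp_dist x y = arcosh ((1 - x \<bullet> y) / sqrt ((1 - x \<bullet> x) * (1 - y \<bullet> y)))"

text \<open>
  The Riemannian volume element of curvature \<open>-1\<close> in the Klein model of dimension \<open>n\<close> is
  \<open>(1 - |x|^2)\<close> to the power \<open>-(n + 1) / 2\<close> times Lebesgue measure.  The model is the open ball,
  so ideal points of the argument of \<open>hyp_vol\<close> do not contribute.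
\<close>

definition hyp_measure :: "(real^4) measure" where
  "hyp_measure =
     density lborel (\<lambda>x. ennreal (indicator (ball 0 1) x * (1 - x \<bullet> x) powr (- (5 / 2))))"

definition hyp_vol :: "(real^4) set \<Rightarrow> real" where
  "hyp_vol S = measure hyp_measure S"

text \<open>
  In the hyperboloid model a horosphere is the section by an affine hyperplane with a light-like
  normal \<open>(1, A)\<close>.  The point \<open>x\<close> of the Klein ball lifts to \<open>(1, x) / sqrt (1 - |x|^2)\<close>, and
  minus its Lorentz product with \<open>(1, A)\<close> is the quantity below.  Its logarithm is the Busemann
  function of the ideal point \<open>A\<close> normalised at the origin, see \<open>busemann_limit\<close>.
\<close>

definition exp_busemann :: "real^4 \<Rightarrow> real^4 \<Rightarrow> real" where
  "exp_busemann A x = (1 - x \<bullet> A) / sqrt (1 - x \<bullet> x)"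

definition horoball :: "real^4 \<Rightarrow> real \<Rightarrow> (real^4) set" where
  "horoball A c = {x \<in> ball 0 1. exp_busemann A x \<le> c}"

definition is_horoball :: "real^4 \<Rightarrow> (real^4) set \<Rightarrow> bool" where
  "is_horoball A B \<longleftrightarrow> norm A = 1 \<and> (\<exists>c>0. B = horoball A c)"

lemma busemann_limit:
  assumes A: "norm A = 1" and x: "norm x < 1"
  shows "((\<lambda>t. hyp_dist x (t *\<^sub>R A) - hyp_dist 0 (t *\<^sub>R A)) \<longlongrightarrow> ln (exp_busemann A x)) (at_left 1)"
proof -
  define q where "q = sqrt (1 - x \<bullet> x)"
  define a where "a t = (1 - t * (x \<bullet> A)) / q" for t
  define s where "s t = sqrt (1 - t\<^sup>2)" for t :: real
  have xx: "x \<bullet> x < 1"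
    using x by (simp add: dot_square_norm power_less_one_iff abs_square_less_1)
  have AA: "A \<bullet> A = 1"
    using A by (simp add: dot_square_norm)
  have q0: "q > 0"
    using xx by (simp add: q_def)
  have "x \<bullet> A \<le> norm x"
    using norm_cauchy_schwarz[of x A] A by simp
  then have a0: "a 1 > 0"
    using x q0 by (simp add: a_def)
  have a_lim: "(a \<longlongrightarrow> a 1) (at_left 1)"
    unfolding a_def using q0 by (auto intro!: tendsto_eq_intros)
  have s_lim: "(s \<longlongrightarrow> 0) (at_left 1)"
    unfolding s_def by (auto intro!: tendsto_eq_intros)
  have "((\<lambda>t. a t - s t) \<longlongrightarrow> a 1 - 0) (at_left 1)"
    by (intro tendsto_diff a_lim s_lim)
  then have ev1: "eventually (\<lambda>t. a t - s t > 0) (at_left 1)"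
    using a0 by (intro order_tendstoD) auto
  have ev2: "eventually (\<lambda>t::real. t \<in> {0<..<1}) (at_left 1)"
    by (rule eventually_at_leftI[of 0]) auto
  have ev: "eventually (\<lambda>t. ln ((a t + sqrt ((a t)\<^sup>2 - (s t)\<^sup>2)) / (1 + sqrt (1 - (s t)\<^sup>2)))
      = hyp_dist x (t *\<^sub>R A) - hyp_dist 0 (t *\<^sub>R A)) (at_left 1)"
    using ev1 ev2
  proof eventually_elim
    case (elim t)
    have t: "t\<^sup>2 < 1"
      using elim by (simp add: abs_square_less_1)
    have s0: "s t > 0" and s1: "s t \<le> 1"
      using t by (auto simp: s_def)
    have key: "arcosh (b / s t) = ln ((b + sqrt (b\<^sup>2 - (s t)\<^sup>2)) / s t)" if "b \<ge> s t" for b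
    proof -
      have "sqrt ((b / s t)\<^sup>2 - 1) = sqrt ((b\<^sup>2 - (s t)\<^sup>2) / (s t)\<^sup>2)"
        using s0 by (simp add: power_divide diff_divide_distrib)
      also have "\<dots> = sqrt (b\<^sup>2 - (s t)\<^sup>2) / s t"
        using s0 by (simp add: real_sqrt_divide)
      finally show ?thesis
        using that s0 by (simp add: arcosh_real_def add_divide_distrib)
    qed
    have tt: "(t *\<^sub>R A) \<bullet> (t *\<^sub>R A) = t\<^sup>2"
      by (simp add: AA power2_eq_square)
    have d1: "hyp_dist x (t *\<^sub>R A) = arcosh (a t / s t)"
      unfolding hyp_dist_def tt a_def s_def q_def by (simp add: real_sqrt_mult)
    have d2: "hyp_dist 0 (t *\<^sub>R A) = arcosh (1 / s t)"
      unfolding hyp_dist_def tt s_def by simp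
    have p1: "a t + sqrt ((a t)\<^sup>2 - (s t)\<^sup>2) > 0"
      using elim s0 by (intro add_pos_nonneg) (auto intro!: power_mono)
    have p2: "1 + sqrt (1 - (s t)\<^sup>2) > 0"
      using s0 s1 by (intro add_pos_nonneg) (auto simp: power_le_one)
    show ?case
      unfolding d1 d2
      using key[of "a t"] key[of 1] elim s0 s1 p1 p2 by (simp add: ln_div)
  qed
  have "((\<lambda>t. ln ((a t + sqrt ((a t)\<^sup>2 - (s t)\<^sup>2)) / (1 + sqrt (1 - (s t)\<^sup>2))))
      \<longlongrightarrow> ln ((a 1 + sqrt ((a 1)\<^sup>2 - 0\<^sup>2)) / (1 + sqrt (1 - 0\<^sup>2)))) (at_left 1)"
    using a0 by (intro tendsto_intros a_lim s_lim) auto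
  also have "ln ((a 1 + sqrt ((a 1)\<^sup>2 - 0\<^sup>2)) / (1 + sqrt (1 - 0\<^sup>2))) = ln (exp_busemann A x)"
  proof -
    have "(a 1 + sqrt ((a 1)\<^sup>2 - 0\<^sup>2)) / (1 + sqrt (1 - 0\<^sup>2)) = a 1"
      using a0 by simp
    moreover have "a 1 = exp_busemann A x"
      by (simp add: a_def q_def exp_busemann_def)
    ultimately show ?thesis
      by (simp only:)
  qed
  finally show ?thesis
    by (rule Lim_transform_eventually) (rule ev)
qed

definition vertices24 :: "(real^4) set" where
  "vertices24 = {(1 / sqrt 2) *\<^sub>R (s *\<^sub>R axis i 1 + t *\<^sub>R axis j 1) | i j s t.
     i \<noteq> j \<and> s \<in> {-1, 1} \<and> t \<in> {-1, 1}}"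

text \<open>The closed Euclidean polytope, that is, the hyperbolic one together with its ideal vertices.\<close>

definition P24 :: "(real^4) set" where
  "P24 = convex hull vertices24"

text \<open>
  A family of horoballs is indexed by the ideal centres instead of \<open>1, \<dots>, 24\<close>: \<open>B v\<close> is the
  horoball centred at the vertex \<open>v\<close>.  Values outside \<open>vertices24\<close> are irrelevant.
\<close>

type_synonym horoball_family = "real^4 \<Rightarrow> (real^4) set"

definition admissible_packing :: "horoball_family \<Rightarrow> bool" where
  "admissible_packing B \<longleftrightarrow>
     (\<forall>v\<in>vertices24. is_horoball v (B v)) \<and>
     (\<forall>v\<in>vertices24. \<forall>w\<in>vertices24. v \<noteq> w \<longrightarrow> interior (B v) \<inter> interior (B w) = {}) \<and>
     (\<forall>v\<in>vertices24. \<forall>F. F facet_of P24 \<and> v \<notin> affine hull F \<longrightarrow>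
        interior (B v) \<inter> affine hull F = {})"

definition same_type :: "horoball_family \<Rightarrow> real^4 \<Rightarrow> real^4 \<Rightarrow> bool" where
  "same_type B v w \<longleftrightarrow> hyp_vol (B v \<inter> P24) = hyp_vol (B w \<inter> P24)"

definition packing_density :: "horoball_family \<Rightarrow> real" where
  "packing_density B = (\<Sum>v\<in>vertices24. hyp_vol (B v \<inter> P24)) / hyp_vol P24"

definition touch_at :: "(real^4) set \<Rightarrow> (real^4) set \<Rightarrow> real^4 \<Rightarrow> bool" where
  "touch_at B C p \<longleftrightarrow> p \<in> B \<inter> C \<and> interior B \<inter> interior C = {}"

definition joined_by_edge :: "real^4 \<Rightarrow> real^4 \<Rightarrow> bool" where
  "joined_by_edge v w \<longleftrightarrow> closed_segment v w edge_of P24"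

definition facet_diagonal :: "(real^4) set \<Rightarrow> real^4 \<Rightarrow> real^4 \<Rightarrow> bool" where
  "facet_diagonal F v w \<longleftrightarrow>
     v \<in> vertices24 \<inter> F \<and> w \<in> vertices24 \<inter> F \<and> v \<noteq> w \<and> \<not> joined_by_edge v w"

definition facet_centre :: "(real^4) set \<Rightarrow> real^4" where
  "facet_centre F = (1 / real (card (vertices24 \<inter> F))) *\<^sub>R (\<Sum>v\<in>vertices24 \<inter> F. v)"

definition A1 :: "real^4" where "A1 = (1 / sqrt 2) *\<^sub>R vector [1, 1, 0, 0]"
definition A2 :: "real^4" where "A2 = (1 / sqrt 2) *\<^sub>R vector [1, -1, 0, 0]"
definition A11 :: "real^4" where "A11 = (1 / sqrt 2) *\<^sub>R vector [0, 0, 1, 1]"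
definition A12 :: "real^4" where "A12 = (1 / sqrt 2) *\<^sub>R vector [0, 0, -1, 1]"

text \<open>With the antipodes \<open>A13 = -A1\<close>, \<open>A14 = -A2\<close>, \<open>A23 = -A11\<close>, \<open>A24 = -A12\<close>.\<close>

definition large_centres :: "(real^4) set" where
  "large_centres = {A1, A2, A11, A12, -A1, -A2, -A11, -A12}"

lemma vector_4_nth [simp]:
  "(vector [a, b, c, d] :: real^4) $ 1 = a" "(vector [a, b, c, d] :: real^4) $ 2 = b"
  "(vector [a, b, c, d] :: real^4) $ 3 = c" "(vector [a, b, c, d] :: real^4) $ 4 = d"
  by (simp_all add: vector_def)

lemma large_centres_subset: "large_centres \<subseteq> vertices24"
proof -
  have *: "(1 / sqrt 2) *\<^sub>R v \<in> vertices24"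
    if "v = s *\<^sub>R axis i 1 + t *\<^sub>R axis j 1" "i \<noteq> j" "s \<in> {-1, 1}" "t \<in> {-1, 1}"
    for v :: "real^4" and i j s t
    using that unfolding vertices24_def by blast
  have e: "vector [s, t, 0, 0] = s *\<^sub>R axis 1 1 + t *\<^sub>R (axis 2 1 :: real^4)"
    "vector [0, 0, s, t] = s *\<^sub>R axis 3 1 + t *\<^sub>R (axis 4 1 :: real^4)" for s t :: real
    by (simp_all add: vec_eq_iff forall_4 axis_def)
  have n: "- vector [a, b, c, d] = (vector [- a, - b, - c, - d] :: real^4)" for a b c d :: real
    by (simp add: vec_eq_iff forall_4)
  show ?thesis
    unfolding large_centres_def A1_def A2_def A11_def A12_def
      scaleR_minus_right[symmetric] n minus_zero minus_minus
    by (auto intro!: *[OF e(1)] *[OF e(2)])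
qed

definition arrangement_B1 :: "horoball_family \<Rightarrow> bool" where
  "arrangement_B1 B \<longleftrightarrow>
     (\<forall>v\<in>vertices24. is_horoball v (B v)) \<and>
     (\<forall>v\<in>large_centres. \<forall>w\<in>large_centres. same_type B v w) \<and>
     (\<forall>F. \<forall>v\<in>large_centres. \<forall>w\<in>large_centres. F facet_of P24 \<and> facet_diagonal F v w \<longrightarrow>
        touch_at (B v) (B w) (facet_centre F)) \<and>
     (\<forall>v\<in>vertices24 - large_centres. \<forall>w\<in>vertices24 - large_centres. same_type B v w) \<and>
     (\<forall>v\<in>vertices24 - large_centres. \<forall>w\<in>large_centres. joined_by_edge v w \<longrightarrow>
        (\<exists>p. touch_at (B v) (B w) p))"

end

theory Submission
  imports Defs
begin

text \<open>
  A horoball centred at an ideal vertex \<open>v\<close> is fixed by one number \<open>c\<close>, the bound on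
  \<^const>\<open>exp_busemann\<close>, and the geometric conditions are inequalities between these numbers.
  In the hyperboloid model \<open>exp_busemann v x\<close> is minus the Lorentz product of the lift of \<open>x\<close>
  with the light-like vector \<open>(1, v)\<close>; Cauchy--Schwarz then shows that horoballs with numbers
  \<open>c\<close> and \<open>d\<close> at \<open>v\<close> and \<open>w\<close> do not overlap iff \<open>c d \<le> (1 - v \<bullet> w) / 2\<close>
  (\<open>horoballs_disjoint_iff\<close>), and that the horoball at \<open>v\<close> stays off the hyperplanes of the
  facets that miss \<open>v\<close> iff \<open>c \<le> 1\<close> (\<open>facet_condition_iff\<close>).  For \<open>c \<le> 1\<close> the horoball
  cuts out of the 24-cell a cusp over a Euclidean cube, of volume \<open>8 c^3 / 3\<close>
  (\<open>hyp_vol_horoball_Int_P24\<close>), and the 24-cell itself has volume \<open>4 pi^2 / 3\<close>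
  (\<open>hyp_vol_P24\<close>).  With \<open>z = 8 c^3\<close> the density is therefore the sum of the \<open>z\<close> divided by
  \<open>4 pi^2\<close>.

  What remains is a finite optimisation problem (\<open>vertex_weights_bound\<close>): weights \<open>z \<le> 8\<close> on
  the vertices with \<open>z z' \<le> 1\<close>, \<open>8\<close>, \<open>27\<close> for vertices with inner product \<open>1/2\<close>, \<open>0\<close>,
  \<open>-1/2\<close> have sum at most \<open>20 sqrt 2\<close>.  If no weight exceeds \<open>2 sqrt 2\<close>, the weights on
  every octahedral facet add up to at most \<open>5 sqrt 2\<close> (\<open>octahedron_bound\<close>), and each
  vertex lies on six of the 24 facets.  This averaging breaks down near a vertex \<open>u\<close> of weight
  \<open>m > 2 sqrt 2\<close>; but then the eight neighbours of the heaviest vertex \<open>u\<close> weigh at most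
  \<open>1 / m\<close>, and the fifteen vertices other than \<open>u\<close> and its neighbours are covered by the six
  facets through \<open>-u\<close>, on which \<open>opposite_octahedron_bound\<close> controls a suitably weighted sum.

  The volume of the 24-cell is computed by cutting it into 24 congruent cells, the cell of \<open>v\<close>
  consisting of the points nearer to \<open>v\<close> than to the other vertices in the sense of Busemann
  functions.  Projective coordinates sending \<open>v\<close> to infinity turn a cell into the region
  \<open>k \<ge> 1 + 2 (|p1| + |p2| + |p3|)\<close> over a cube, and integrating out \<open>k\<close> leaves
  \<open>8/3\<close> times the integral of \<open>(4 - |p|^2)\<close> to the power \<open>-3/2\<close> over the unit cube.  Two
  elementary integrations bring this to Coxeter's integral of an arctangent, whose value
  \<open>pi^2 / 48\<close> comes from a double integral that is evaluated by interchanging its two variables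
  (\<open>ahmed_double_integral\<close>).

  In the arrangement of the theorem the tangencies force \<open>c = 1 / sqrt 2\<close> for the large and
  \<open>c = sqrt 2 / 4\<close> for the small horoballs (\<open>arrangement_B1_radii\<close>), which gives the sum
  \<open>8 * 2 sqrt 2 + 16 * sqrt 2 / 4 = 20 sqrt 2\<close> and the density \<open>5 sqrt 2 / pi^2\<close>.
\<close>

section \<open>Integrals behind the volume of the 24-cell\<close>

text \<open>
  Differentiability is required in the open interval only, because some antiderivatives below
  contain a square root that vanishes at an end point.
\<close>

lemma nn_integral_FTC_interior:
  fixes F f :: "real \<Rightarrow> real"
  assumes "a \<le> b" and cont: "continuous_on {a..b} F"
    and deriv: "\<And>x. a < x \<Longrightarrow> x < b \<Longrightarrow> (F has_real_derivative f x) (at x)"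
    and nonneg: "\<And>x. a \<le> x \<Longrightarrow> x \<le> b \<Longrightarrow> 0 \<le> f x"
    and [measurable]: "f \<in> borel_measurable borel"
  shows "(\<integral>\<^sup>+x\<in>{a..b}. ennreal (f x) \<partial>lborel) = ennreal (F b - F a)"
proof -
  have "(f has_integral (F b - F a)) {a..b}"
    using deriv by (intro fundamental_theorem_of_calculus_interior \<open>a \<le> b\<close> cont)
      (auto simp: has_real_derivative_iff_has_vector_derivative)
  then have "((\<lambda>x. if x \<in> {a..b} then f x else 0) has_integral (F b - F a)) UNIV"
    by (simp only: has_integral_restrict_UNIV)
  then have "(\<integral>\<^sup>+x. ennreal (if x \<in> {a..b} then f x else 0) \<partial>lborel) = ennreal (F b - F a)"
    using nonneg by (intro nn_integral_has_integral_lborel) (auto intro!: measurable_If_set)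
  moreover have "ennreal (if x \<in> {a..b} then f x else 0) = ennreal (f x) * indicator {a..b} x" for x
    by (simp split: split_indicator)
  ultimately show ?thesis by simp
qed

lemma nn_integral_inverse_sqrt_cubed:
  fixes A :: real
  assumes "A > 1"
  shows "(\<integral>\<^sup>+z\<in>{0..1}. ennreal (1 / sqrt (A - z\<^sup>2) ^ 3) \<partial>lborel) = ennreal (1 / (A * sqrt (A - 1)))"
proof -
  have pos: "A - z\<^sup>2 > 0" if "0 \<le> z" "z \<le> 1" for z
    using that assms power_le_one[of z 2] by simp
  have "(\<integral>\<^sup>+z\<in>{0..1}. ennreal (1 / sqrt (A - z\<^sup>2) ^ 3) \<partial>lborel)
    = ennreal (1 / (A * sqrt (A - 1\<^sup>2)) - 0 / (A * sqrt (A - 0\<^sup>2)))"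
  proof (rule nn_integral_FTC_interior)
    show "continuous_on {0..1} (\<lambda>z. z / (A * sqrt (A - z\<^sup>2)))"
      using pos assms by (intro continuous_intros) force
    fix z :: real assume z: "0 < z" "z < 1"
    define q where "q = sqrt (A - z\<^sup>2)"
    have q: "q > 0" "q\<^sup>2 = A - z\<^sup>2" using pos[of z] z by (auto simp: q_def)
    have "((\<lambda>z. z / (A * sqrt (A - z\<^sup>2))) has_real_derivative
       (1 * (A * q) - z * (A * ((0 - 2 * z) * (inverse q / 2)))) / (A * q * (A * q))) (at z)"
      unfolding q_def using pos[of z] z assms
      by (auto intro!: derivative_eq_intros simp: )
    moreover have "(1 * (A * q) - z * (A * ((0 - 2 * z) * (inverse q / 2)))) / (A * q * (A * q)) = 1 / q ^ 3"
    proof -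
      have "A = q\<^sup>2 + z\<^sup>2" using q by simp
      then show ?thesis using q(1) assms
        by (simp add: divide_simps) (simp add: algebra_simps power2_eq_square power3_eq_cube)
    qed
    ultimately show "((\<lambda>z. z / (A * sqrt (A - z\<^sup>2))) has_real_derivative 1 / sqrt (A - z\<^sup>2) ^ 3) (at z)"
      by (simp add: q_def)
  qed (use pos in \<open>auto simp: order.strict_implies_order\<close>)
  then show ?thesis by simp
qed

text \<open>
  The substitution \<open>y / sqrt (B - y^2)\<close> makes the integrand rational; its primitive is written
  out here so that only a derivative has to be checked.
\<close>

lemma nn_integral_arctan_form:
  fixes B :: real
  assumes "B > 1"
  shows "(\<integral>\<^sup>+y\<in>{0..1}. ennreal (1 / ((B + 1 - y\<^sup>2) * sqrt (B - y\<^sup>2))) \<partial>lborel)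
    = ennreal (arctan (1 / (sqrt (B + 1) * sqrt (B - 1))) / sqrt (B + 1))"
proof -
  have pos: "B - z\<^sup>2 > 0" if "0 \<le> z" "z \<le> 1" for z
    using that assms power_le_one[of z 2] by simp
  let ?c = "sqrt (B + 1)"
  let ?F = "\<lambda>y. arctan (y / (?c * sqrt (B - y\<^sup>2))) / ?c"
  have "(\<integral>\<^sup>+y\<in>{0..1}. ennreal (1 / ((B + 1 - y\<^sup>2) * sqrt (B - y\<^sup>2))) \<partial>lborel) = ennreal (?F 1 - ?F 0)"
  proof (rule nn_integral_FTC_interior)
    show "continuous_on {0..1} ?F"
      using pos assms by (intro continuous_intros) force+
    fix z :: real assume z: "0 < z" "z < 1"
    define q where "q = sqrt (B - z\<^sup>2)"
    define c where "c = sqrt (B + 1)"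
    have q: "q > 0" "q\<^sup>2 = B - z\<^sup>2" using pos[of z] z by (auto simp: q_def)
    have c: "c > 0" "c\<^sup>2 = B + 1" using assms by (auto simp: c_def)
    have "((\<lambda>y. arctan (y / (c * sqrt (B - y\<^sup>2))) / c) has_real_derivative
       inverse (1 + (z / (c * q))\<^sup>2) * ((1 * (c * q) - z * (c * ((0 - 2 * z) * (inverse q / 2)))) / (c * q * (c * q))) / c) (at z)"
      unfolding q_def using pos[of z] z c(1)
      by (auto intro!: derivative_eq_intros simp: mult_ac)
    moreover have "inverse (1 + (z / (c * q))\<^sup>2) * ((1 * (c * q) - z * (c * ((0 - 2 * z) * (inverse q / 2)))) / (c * q * (c * q))) / c
      = 1 / ((B + 1 - z\<^sup>2) * q)"
    proof -
      have 1: "(1 * (c * q) - z * (c * ((0 - 2 * z) * (inverse q / 2)))) / (c * q * (c * q)) = B / (c * q ^ 3)"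
      proof -
        have B: "B = q\<^sup>2 + z\<^sup>2" using q by simp
        show ?thesis unfolding B using q(1) c(1)
          by (simp add: divide_simps) (simp add: algebra_simps power2_eq_square power3_eq_cube)
      qed
      have "c\<^sup>2 * q\<^sup>2 + z\<^sup>2 = B * (B + 1 - z\<^sup>2)"
        unfolding c q by (simp add: algebra_simps power2_eq_square)
      then have 2: "1 + (z / (c * q))\<^sup>2 = B * (B + 1 - z\<^sup>2) / (c\<^sup>2 * q\<^sup>2)"
        using q(1) c(1) by (simp add: divide_simps power_mult_distrib)
      have "B + 1 - z\<^sup>2 > 0" using pos[of z] z by simp
      then show ?thesis unfolding 1 2 using q(1) c(1) assms
        by (simp add: divide_simps) (simp add: algebra_simps power2_eq_square power3_eq_cube)
    qed
    ultimately show "(?F has_real_derivative 1 / ((B + 1 - z\<^sup>2) * sqrt (B - z\<^sup>2))) (at z)"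
      by (simp add: q_def c_def)
  next
    fix z :: real assume z: "0 \<le> z" "z \<le> 1"
    show "0 \<le> 1 / ((B + 1 - z\<^sup>2) * sqrt (B - z\<^sup>2))" using pos[OF z] by simp
  qed auto
  then show ?thesis by simp
qed

text \<open>
  The partial fraction
  \<open>1 / ((1 + w^2) (2 + s^2 + w^2)) = (1 / (1 + w^2) - 1 / (2 + s^2 + w^2)) / (1 + s^2)\<close>,
  integrated.
\<close>

lemma partial_fraction_deriv:
  fixes s w :: real
  defines "c \<equiv> sqrt (2 + s\<^sup>2)"
  shows "((\<lambda>w. (arctan w - arctan (w / c) / c) / (1 + s\<^sup>2)) has_real_derivative
    1 / ((1 + w\<^sup>2) * (2 + s\<^sup>2 + w\<^sup>2))) (at w)"
proof -
  have c: "c > 0" "c\<^sup>2 = 2 + s\<^sup>2" by (auto simp: c_def add_pos_nonneg)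
  have pos: "1 + w\<^sup>2 > 0" "2 + s\<^sup>2 + w\<^sup>2 > 0" "1 + s\<^sup>2 > 0" by (auto simp: add_pos_nonneg)
  have "((\<lambda>w. (arctan w - arctan (w / c) / c) / (1 + s\<^sup>2)) has_real_derivative
    (inverse (1 + w\<^sup>2) - inverse (1 + (w / c)\<^sup>2) * (1 / c) / c) / (1 + s\<^sup>2)) (at w)"
    using c(1) pos(3) by (auto intro!: derivative_eq_intros)
  moreover have "inverse (1 + (w / c)\<^sup>2) * (1 / c) / c = 1 / (2 + s\<^sup>2 + w\<^sup>2)"
  proof -
    have "1 + (w / c)\<^sup>2 = (2 + s\<^sup>2 + w\<^sup>2) / c\<^sup>2"
      using c(1) by (simp add: power_divide add_divide_distrib flip: c(2))
    then show ?thesis using c(1) pos by (simp only:) (simp add: power2_eq_square)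
  qed
  moreover have "(inverse (1 + w\<^sup>2) - 1 / (2 + s\<^sup>2 + w\<^sup>2)) / (1 + s\<^sup>2) = 1 / ((1 + w\<^sup>2) * (2 + s\<^sup>2 + w\<^sup>2))"
    using pos by (simp add: divide_simps)
  ultimately show ?thesis by simp
qed

text \<open>
  The substitution \<open>w = x / sqrt (2 - x^2)\<close>, which maps \<open>{0..1}\<close> to itself.  It turns the
  integrand into one whose dependence on \<open>s\<close> and \<open>w\<close> is almost symmetric.
\<close>

lemma ahmed_slice:
  fixes s :: real
  shows "(\<integral>\<^sup>+x\<in>{0..1}. ennreal (sqrt (2 - x\<^sup>2) / ((4 - x\<^sup>2) + (2 - x\<^sup>2) * s\<^sup>2)) \<partial>lborel) =
    (\<integral>\<^sup>+w\<in>{0..1}. ennreal (1 / ((1 + w\<^sup>2) * (2 + s\<^sup>2 + w\<^sup>2))) \<partial>lborel)"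
proof -
  let ?H = "\<lambda>w. (arctan w - arctan (w / sqrt (2 + s\<^sup>2)) / sqrt (2 + s\<^sup>2)) / (1 + s\<^sup>2)"
  let ?w = "\<lambda>x::real. x / sqrt (2 - x\<^sup>2)"
  have c: "sqrt (2 + s\<^sup>2) \<noteq> 0" "1 + s\<^sup>2 \<noteq> 0" by (auto simp: add_nonneg_eq_0_iff)
  have pos: "2 - x\<^sup>2 > 0" if "0 \<le> x" "x \<le> 1" for x :: real
    using that power_le_one[of x 2] by simp
  have "(\<integral>\<^sup>+x\<in>{0..1}. ennreal (sqrt (2 - x\<^sup>2) / ((4 - x\<^sup>2) + (2 - x\<^sup>2) * s\<^sup>2)) \<partial>lborel)
    = ennreal (?H (?w 1) - ?H (?w 0))"
  proof (rule nn_integral_FTC_interior)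
    have "continuous_on {0..1} ?w" using pos by (intro continuous_intros) force
    have "continuous_on UNIV ?H"
      by (intro continuous_at_imp_continuous_on ballI DERIV_isCont[OF partial_fraction_deriv])
    from continuous_on_compose2[OF this \<open>continuous_on {0..1} ?w\<close> subset_UNIV]
    show "continuous_on {0..1} (\<lambda>x. ?H (?w x))" .
    fix x :: real assume x: "0 < x" "x < 1"
    define q where "q = sqrt (2 - x\<^sup>2)"
    have q: "q > 0" "q\<^sup>2 = 2 - x\<^sup>2" using pos[of x] x by (auto simp: q_def)
    have xx: "x\<^sup>2 = 2 - q\<^sup>2" using q by simp
    have "(?w has_real_derivative (1 * q - x * ((0 - 2 * x) * (inverse q / 2))) / (q * q)) (at x)"
      unfolding q_def using pos[of x] x by (auto intro!: derivative_eq_intros)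
    moreover have "(1 * q - x * ((0 - 2 * x) * (inverse q / 2))) / (q * q) = 2 / q ^ 3"
    proof -
      have "(1 * q - x * ((0 - 2 * x) * (inverse q / 2))) / (q * q) = (q\<^sup>2 + x\<^sup>2) / q ^ 3"
        using q(1) by (simp add: divide_simps power2_eq_square power3_eq_cube)
      then show ?thesis by (simp add: xx)
    qed
    ultimately have "(?w has_real_derivative 2 / q ^ 3) (at x)" by simp
    from DERIV_chain2[OF partial_fraction_deriv this]
    have "((\<lambda>x. ?H (?w x)) has_real_derivative
      1 / ((1 + (?w x)\<^sup>2) * (2 + s\<^sup>2 + (?w x)\<^sup>2)) * (2 / q ^ 3)) (at x)" .
    moreover have "1 / ((1 + (?w x)\<^sup>2) * (2 + s\<^sup>2 + (?w x)\<^sup>2)) * (2 / q ^ 3)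
      = q / ((4 - x\<^sup>2) + q\<^sup>2 * s\<^sup>2)"
    proof -
      have 1: "1 + (?w x)\<^sup>2 = 2 / q\<^sup>2" unfolding q_def[symmetric] power_divide xx
        using q(1) by (simp add: divide_simps)
      have 2: "2 + s\<^sup>2 + (?w x)\<^sup>2 = ((4 - x\<^sup>2) + q\<^sup>2 * s\<^sup>2) / q\<^sup>2"
        unfolding q_def[symmetric] power_divide xx
        using q(1) by (simp add: divide_simps algebra_simps)
      have "(4 - x\<^sup>2) + q\<^sup>2 * s\<^sup>2 > 0" using pos[of x] x by (simp add: add_pos_nonneg)
      then show ?thesis unfolding 1 2 using q(1)
        by (simp add: divide_simps power2_eq_square power3_eq_cube)
    qed
    ultimately show "((\<lambda>x. ?H (?w x)) has_real_derivative
      sqrt (2 - x\<^sup>2) / ((4 - x\<^sup>2) + (2 - x\<^sup>2) * s\<^sup>2)) (at x)"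
      by (simp add: q flip: q_def)
  next
    fix x :: real assume x: "0 \<le> x" "x \<le> 1"
    show "0 \<le> sqrt (2 - x\<^sup>2) / ((4 - x\<^sup>2) + (2 - x\<^sup>2) * s\<^sup>2)"
      using pos[OF x] by (auto intro!: divide_nonneg_nonneg add_nonneg_nonneg)
  qed auto
  moreover have "(\<integral>\<^sup>+w\<in>{0..1}. ennreal (1 / ((1 + w\<^sup>2) * (2 + s\<^sup>2 + w\<^sup>2))) \<partial>lborel) = ennreal (?H 1 - ?H 0)"
  proof (rule nn_integral_FTC_interior)
    show "continuous_on {0..1} ?H" using c by (intro continuous_intros) auto
  qed (auto intro!: partial_fraction_deriv)
  ultimately show ?thesis by simp
qed

text \<open>
  The trick of Ahmed's integral: with \<open>s\<close> and \<open>w\<close> interchanged the integrand changes, but the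
  two versions add up to \<open>1 / ((1 + s^2) (1 + w^2))\<close>, whose integral is \<open>(pi / 4)^2\<close>.
\<close>

lemma ahmed_double_integral:
  "(\<integral>\<^sup>+s\<in>{0..1}. (\<integral>\<^sup>+w\<in>{0..1}. ennreal (1 / ((1 + w\<^sup>2) * (2 + s\<^sup>2 + w\<^sup>2))) \<partial>lborel) \<partial>lborel)
    = ennreal (pi\<^sup>2 / 32)"
proof -
  let ?J = "{0..1::real}"
  let ?f = "\<lambda>s w :: real. ennreal (1 / ((1 + w\<^sup>2) * (2 + s\<^sup>2 + w\<^sup>2))) * indicator ?J w * indicator ?J s"
  define D where "D = (\<integral>\<^sup>+s. (\<integral>\<^sup>+w. ?f s w \<partial>lborel) \<partial>lborel)"
  have a: "(\<integral>\<^sup>+x\<in>?J. ennreal (1 / (1 + x\<^sup>2)) \<partial>lborel) = ennreal (pi / 4)"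
  proof -
    have "(\<integral>\<^sup>+x\<in>?J. ennreal (1 / (1 + x\<^sup>2)) \<partial>lborel) = ennreal (arctan 1 - arctan 0)"
    proof (rule nn_integral_FTC_interior)
      show "(arctan has_real_derivative 1 / (1 + x\<^sup>2)) (at x)" for x
        using DERIV_arctan[of x] by (simp add: divide_inverse)
    qed (auto intro!: continuous_intros)
    then show ?thesis by (simp add: arctan_one)
  qed
  have "D = (\<integral>\<^sup>+s. (\<integral>\<^sup>+w. ?f w s \<partial>lborel) \<partial>lborel)"
    unfolding D_def by (subst lborel_pair.Fubini') auto
  then have "D + D = (\<integral>\<^sup>+s. (\<integral>\<^sup>+w. ?f s w \<partial>lborel) + (\<integral>\<^sup>+w. ?f w s \<partial>lborel) \<partial>lborel)"
    by (subst nn_integral_add) (auto simp: D_def)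
  also have "\<dots> = (\<integral>\<^sup>+s. (\<integral>\<^sup>+w. ?f s w + ?f w s \<partial>lborel) \<partial>lborel)"
    by (intro nn_integral_cong nn_integral_add[symmetric]) auto
  also have "\<dots> = (\<integral>\<^sup>+s. (\<integral>\<^sup>+w. (ennreal (1 / (1 + s\<^sup>2)) * indicator ?J s) * (ennreal (1 / (1 + w\<^sup>2)) * indicator ?J w) \<partial>lborel) \<partial>lborel)"
  proof (intro nn_integral_cong)
    fix s w :: real
    have pos: "1 + w\<^sup>2 > 0" "2 + s\<^sup>2 + w\<^sup>2 > 0" "2 + w\<^sup>2 + s\<^sup>2 > 0" "1 + s\<^sup>2 > 0" by (auto simp: add_pos_nonneg)
    have "1 / ((1 + w\<^sup>2) * (2 + s\<^sup>2 + w\<^sup>2)) + 1 / ((1 + s\<^sup>2) * (2 + w\<^sup>2 + s\<^sup>2)) = (1 / (1 + s\<^sup>2)) * (1 / (1 + w\<^sup>2))"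
      using pos by (simp add: divide_simps) (simp add: algebra_simps)
    then have "ennreal (1 / ((1 + w\<^sup>2) * (2 + s\<^sup>2 + w\<^sup>2))) + ennreal (1 / ((1 + s\<^sup>2) * (2 + w\<^sup>2 + s\<^sup>2)))
      = ennreal (1 / (1 + s\<^sup>2)) * ennreal (1 / (1 + w\<^sup>2))"
      using pos by (simp add: ennreal_plus[symmetric] ennreal_mult[symmetric] del: ennreal_plus)
    then show "?f s w + ?f w s = (ennreal (1 / (1 + s\<^sup>2)) * indicator ?J s) * (ennreal (1 / (1 + w\<^sup>2)) * indicator ?J w)"
      by (auto split: split_indicator)
  qed
  also have "\<dots> = ennreal (pi / 4) * ennreal (pi / 4)"
    by (simp add: nn_integral_cmult nn_integral_multc a)
  also have "\<dots> = ennreal (pi\<^sup>2 / 16)"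
    by (simp add: ennreal_mult[symmetric] power2_eq_square)
  finally have DD: "D + D = ennreal (pi\<^sup>2 / 16)" .
  then have "D \<noteq> top" by auto
  then obtain d where d: "D = ennreal d" "d \<ge> 0" by (cases D) auto
  with DD have "d = pi\<^sup>2 / 32" by (simp flip: ennreal_plus)
  moreover have "(\<integral>\<^sup>+s\<in>?J. (\<integral>\<^sup>+w\<in>?J. ennreal (1 / ((1 + w\<^sup>2) * (2 + s\<^sup>2 + w\<^sup>2))) \<partial>lborel) \<partial>lborel) = D"
    unfolding D_def by (intro nn_integral_cong) (simp add: nn_integral_multc)
  ultimately show ?thesis using d by simp
qed

text \<open>
  The arctangent is itself an integral over a parameter \<open>s\<close>; after exchanging the order of
  integration the integral over \<open>x\<close> is the one of \<open>ahmed_slice\<close>.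
\<close>

lemma complementary_arctan_integral:
  "(\<integral>\<^sup>+x\<in>{0..1}. ennreal (arctan (sqrt (2 - x\<^sup>2) / sqrt (4 - x\<^sup>2)) / sqrt (4 - x\<^sup>2)) \<partial>lborel)
    = ennreal (pi\<^sup>2 / 32)"
proof -
  let ?J = "{0..1::real}"
  let ?g = "\<lambda>x s :: real. ennreal (sqrt (2 - x\<^sup>2) / ((4 - x\<^sup>2) + (2 - x\<^sup>2) * s\<^sup>2))"
  have "(\<integral>\<^sup>+x\<in>?J. ennreal (arctan (sqrt (2 - x\<^sup>2) / sqrt (4 - x\<^sup>2)) / sqrt (4 - x\<^sup>2)) \<partial>lborel)
    = (\<integral>\<^sup>+x\<in>?J. (\<integral>\<^sup>+s\<in>?J. ?g x s \<partial>lborel) \<partial>lborel)"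
  proof (rule nn_integral_cong)
    fix x :: real
    have "ennreal (arctan (sqrt (2 - x\<^sup>2) / sqrt (4 - x\<^sup>2)) / sqrt (4 - x\<^sup>2)) = (\<integral>\<^sup>+s\<in>?J. ?g x s \<partial>lborel)"
      if x: "x \<in> ?J"
    proof -
      define S where "S = sqrt (2 - x\<^sup>2)"
      define R where "R = sqrt (4 - x\<^sup>2)"
      have "x\<^sup>2 \<le> 1" using x power_le_one[of x 2] by simp
      then have S: "S > 0" "2 - x\<^sup>2 = S\<^sup>2" and R: "R > 0" "4 - x\<^sup>2 = R\<^sup>2"
        by (auto simp: S_def R_def)
      have "(\<integral>\<^sup>+s\<in>?J. ennreal (S / (R\<^sup>2 + S\<^sup>2 * s\<^sup>2)) \<partial>lborel)
        = ennreal (arctan (S * 1 / R) / R - arctan (S * 0 / R) / R)"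
      proof (rule nn_integral_FTC_interior)
        fix s :: real
        have "((\<lambda>s. arctan (S * s / R) / R) has_real_derivative inverse (1 + (S * s / R)\<^sup>2) * (S / R) / R) (at s)"
          using R by (auto intro!: derivative_eq_intros)
        moreover have "1 + (S * s / R)\<^sup>2 = (R\<^sup>2 + S\<^sup>2 * s\<^sup>2) / R\<^sup>2"
          using R(1) by (simp add: divide_simps power_mult_distrib)
        then have "inverse (1 + (S * s / R)\<^sup>2) * (S / R) / R = S / (R\<^sup>2 + S\<^sup>2 * s\<^sup>2)"
          using R(1) by (simp only:) (simp add: power2_eq_square)
        ultimately show "((\<lambda>s. arctan (S * s / R) / R) has_real_derivative S / (R\<^sup>2 + S\<^sup>2 * s\<^sup>2)) (at s)"
          by simp
      qed (use S R in \<open>auto intro!: continuous_intros\<close>)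
      then show ?thesis unfolding S_def[symmetric] R_def[symmetric] unfolding S(2) R(2) by simp
    qed
    then show "ennreal (arctan (sqrt (2 - x\<^sup>2) / sqrt (4 - x\<^sup>2)) / sqrt (4 - x\<^sup>2)) * indicator ?J x
      = (\<integral>\<^sup>+s\<in>?J. ?g x s \<partial>lborel) * indicator ?J x"
      by (auto split: split_indicator)
  qed
  also have "\<dots> = (\<integral>\<^sup>+x. (\<integral>\<^sup>+s. ?g x s * indicator ?J s * indicator ?J x \<partial>lborel) \<partial>lborel)"
    by (intro nn_integral_cong nn_integral_multc[symmetric]) auto
  also have "\<dots> = (\<integral>\<^sup>+s. (\<integral>\<^sup>+x. ?g x s * indicator ?J s * indicator ?J x \<partial>lborel) \<partial>lborel)"
    by (subst lborel_pair.Fubini') auto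
  also have "\<dots> = (\<integral>\<^sup>+s. (\<integral>\<^sup>+x. (?g x s * indicator ?J x) * indicator ?J s \<partial>lborel) \<partial>lborel)"
    by (simp add: mult_ac)
  also have "\<dots> = (\<integral>\<^sup>+s\<in>?J. (\<integral>\<^sup>+x\<in>?J. ?g x s \<partial>lborel) \<partial>lborel)"
    by (intro nn_integral_cong nn_integral_multc) auto
  also have "\<dots> = ennreal (pi\<^sup>2 / 32)"
    unfolding ahmed_slice by (rule ahmed_double_integral)
  finally show ?thesis .
qed

text \<open>
  With \<open>R = sqrt (4 - x^2)\<close> and \<open>S = sqrt (2 - x^2)\<close> the relation \<open>R^2 - S^2 = 2\<close> and the
  double angle formula give \<open>arctan (1 / (R S)) = pi / 2 - 2 arctan (S / R)\<close>, so this integral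
  is the difference of an elementary one and twice the previous one.
\<close>

lemma coxeter_integral:
  "(\<integral>\<^sup>+x\<in>{0..1}. ennreal (arctan (1 / (sqrt (4 - x\<^sup>2) * sqrt (2 - x\<^sup>2))) / sqrt (4 - x\<^sup>2)) \<partial>lborel)
    = ennreal (pi\<^sup>2 / 48)"
proof -
  let ?J = "{0..1::real}"
  let ?a = "\<lambda>x::real. arctan (1 / (sqrt (4 - x\<^sup>2) * sqrt (2 - x\<^sup>2))) / sqrt (4 - x\<^sup>2)"
  let ?b = "\<lambda>x::real. arctan (sqrt (2 - x\<^sup>2) / sqrt (4 - x\<^sup>2)) / sqrt (4 - x\<^sup>2)"
  define I where "I = (\<integral>\<^sup>+x\<in>?J. ennreal (?a x) \<partial>lborel)"
  have "I + 2 * (\<integral>\<^sup>+x\<in>?J. ennreal (?b x) \<partial>lborel)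
    = (\<integral>\<^sup>+x. ennreal (?a x) * indicator ?J x + 2 * (ennreal (?b x) * indicator ?J x) \<partial>lborel)"
    unfolding I_def by (simp add: nn_integral_add nn_integral_cmult)
  also have "\<dots> = (\<integral>\<^sup>+x\<in>?J. ennreal (pi / 2 / sqrt (4 - x\<^sup>2)) \<partial>lborel)"
  proof (rule nn_integral_cong)
    fix x :: real
    have "ennreal (?a x) + 2 * ennreal (?b x) = ennreal (pi / 2 / sqrt (4 - x\<^sup>2))" if x: "x \<in> ?J"
    proof -
      define S where "S = sqrt (2 - x\<^sup>2)"
      define R where "R = sqrt (4 - x\<^sup>2)"
      have "x\<^sup>2 \<le> 1" using x power_le_one[of x 2] by simp
      then have S: "S > 0" "S\<^sup>2 = 2 - x\<^sup>2" and R: "R > 0" "R\<^sup>2 = 4 - x\<^sup>2"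
        by (auto simp: S_def R_def)
      have SR: "S < R" by (simp add: S_def R_def)
      have "2 * arctan (S / R) = arctan (2 * (S / R) / (1 - (S / R)\<^sup>2))"
        using S R SR by (intro arctan_double) simp
      also have "2 * (S / R) / (1 - (S / R)\<^sup>2) = R * S"
      proof -
        have "S\<^sup>2 = R\<^sup>2 - 2" using S R by simp
        then have "1 - (S / R)\<^sup>2 = 2 / R\<^sup>2"
          unfolding power_divide using R(1) by (simp add: divide_simps)
        then show ?thesis using R(1) by (simp add: power2_eq_square)
      qed
      also have "arctan (R * S) = pi / 2 - arctan (1 / (R * S))"
      proof -
        have "R * S > 0" using S(1) R(1) by simp
        from arctan_inverse[OF this] show ?thesis unfolding inverse_eq_divide by linarith
      qed
      finally have "arctan (1 / (R * S)) + 2 * arctan (S / R) = pi / 2" by simp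
      then have "arctan (1 / (R * S)) / R + 2 * (arctan (S / R) / R) = pi / 2 / R"
        using R by (simp add: divide_simps)
      moreover have "arctan (1 / (R * S)) / R \<ge> 0" "arctan (S / R) / R \<ge> 0"
        using S R by auto
      ultimately have "ennreal (arctan (1 / (R * S)) / R) + 2 * ennreal (arctan (S / R) / R) = ennreal (pi / 2 / R)"
        by (metis ennreal_plus ennreal_mult' ennreal_numeral mult_nonneg_nonneg zero_le_numeral)
      then show ?thesis by (simp add: S_def R_def)
    qed
    then show "ennreal (?a x) * indicator ?J x + 2 * (ennreal (?b x) * indicator ?J x)
      = ennreal (pi / 2 / sqrt (4 - x\<^sup>2)) * indicator ?J x"
      by (auto split: split_indicator)
  qed
  also have "\<dots> = ennreal (pi / 2 * arcsin (1 / 2) - pi / 2 * arcsin (0 / 2))"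
  proof (rule nn_integral_FTC_interior)
    show "continuous_on ?J (\<lambda>x. pi / 2 * arcsin (x / 2))"
      by (intro continuous_intros) auto
    fix x :: real assume x: "0 < x" "x < 1"
    have "((\<lambda>x. pi / 2 * arcsin (x / 2)) has_real_derivative pi / 2 * (inverse (sqrt (1 - (x / 2)\<^sup>2)) * (1 / 2))) (at x)"
      using x by (auto intro!: derivative_eq_intros)
    moreover have "sqrt (4 - x\<^sup>2) = sqrt (4 * (1 - (x / 2)\<^sup>2))" by (simp add: power_divide)
    then have "sqrt (4 - x\<^sup>2) = 2 * sqrt (1 - (x / 2)\<^sup>2)" by (simp only: real_sqrt_mult real_sqrt_four)
    ultimately show "((\<lambda>x. pi / 2 * arcsin (x / 2)) has_real_derivative pi / 2 / sqrt (4 - x\<^sup>2)) (at x)"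
      by (simp add: divide_simps)
  next
    fix x :: real assume "0 \<le> x" "x \<le> 1"
    then have "x\<^sup>2 \<le> 1" using power_le_one[of x 2] by simp
    then show "0 \<le> pi / 2 / sqrt (4 - x\<^sup>2)" by simp
  qed auto
  also have "\<dots> = ennreal (pi\<^sup>2 / 12)"
  proof -
    have "arcsin (1 / 2) = pi / 6" using arcsin_sin[of "pi / 6"] by (simp add: sin_30)
    then show ?thesis by (simp add: power2_eq_square)
  qed
  finally have "I + ennreal (pi\<^sup>2 / 16) = ennreal (pi\<^sup>2 / 12)"
    unfolding complementary_arctan_integral by (simp add: ennreal_mult'[symmetric] flip: ennreal_numeral)
  also have "ennreal (pi\<^sup>2 / 12) = ennreal (pi\<^sup>2 / 48) + ennreal (pi\<^sup>2 / 16)"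
    by (simp flip: ennreal_plus)
  finally show ?thesis unfolding I_def by simp
qed

lemma cube_integral:
  "(\<integral>\<^sup>+x\<in>{0..1}. (\<integral>\<^sup>+y\<in>{0..1}. (\<integral>\<^sup>+z\<in>{0..1}. ennreal (1 / sqrt (4 - x\<^sup>2 - y\<^sup>2 - z\<^sup>2) ^ 3) \<partial>lborel) \<partial>lborel) \<partial>lborel)
    = ennreal (pi\<^sup>2 / 48)"
proof -
  let ?J = "{0..1::real}"
  have sq: "x\<^sup>2 \<le> 1" if "x \<in> ?J" for x :: real
    using that power_le_one[of x 2] by simp
  have "(\<integral>\<^sup>+y\<in>?J. (\<integral>\<^sup>+z\<in>?J. ennreal (1 / sqrt (4 - x\<^sup>2 - y\<^sup>2 - z\<^sup>2) ^ 3) \<partial>lborel) \<partial>lborel)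
     = ennreal (arctan (1 / (sqrt (4 - x\<^sup>2) * sqrt (2 - x\<^sup>2))) / sqrt (4 - x\<^sup>2))" if x: "x \<in> ?J" for x :: real
  proof -
    have "(\<integral>\<^sup>+z\<in>?J. ennreal (1 / sqrt (4 - x\<^sup>2 - y\<^sup>2 - z\<^sup>2) ^ 3) \<partial>lborel)
      = ennreal (1 / (((3 - x\<^sup>2) + 1 - y\<^sup>2) * sqrt ((3 - x\<^sup>2) - y\<^sup>2)))" if y: "y \<in> ?J" for y :: real
    proof -
      have "4 - x\<^sup>2 - y\<^sup>2 > 1" using sq[OF x] sq[OF y] by linarith
      moreover have "4 - x\<^sup>2 - y\<^sup>2 = (3 - x\<^sup>2) + 1 - y\<^sup>2" "4 - x\<^sup>2 - y\<^sup>2 - 1 = (3 - x\<^sup>2) - y\<^sup>2" by simp_all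
      ultimately show ?thesis using nn_integral_inverse_sqrt_cubed[of "4 - x\<^sup>2 - y\<^sup>2"] by metis
    qed
    then have "(\<integral>\<^sup>+y\<in>?J. (\<integral>\<^sup>+z\<in>?J. ennreal (1 / sqrt (4 - x\<^sup>2 - y\<^sup>2 - z\<^sup>2) ^ 3) \<partial>lborel) \<partial>lborel)
      = (\<integral>\<^sup>+y\<in>?J. ennreal (1 / (((3 - x\<^sup>2) + 1 - y\<^sup>2) * sqrt ((3 - x\<^sup>2) - y\<^sup>2))) \<partial>lborel)"
      by (intro nn_integral_cong) (auto split: split_indicator)
    also have "\<dots> = ennreal (arctan (1 / (sqrt (4 - x\<^sup>2) * sqrt (2 - x\<^sup>2))) / sqrt (4 - x\<^sup>2))"
    proof -
      have "3 - x\<^sup>2 > 1" using sq[OF x] by linarith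
      moreover have "3 - x\<^sup>2 + 1 = 4 - x\<^sup>2" "3 - x\<^sup>2 - 1 = 2 - x\<^sup>2" by simp_all
      ultimately show ?thesis using nn_integral_arctan_form[of "3 - x\<^sup>2"] by metis
    qed
    finally show ?thesis .
  qed
  then show ?thesis unfolding coxeter_integral[symmetric]
    by (intro nn_integral_cong) (simp split: split_indicator)
qed

section \<open>Lebesgue measure in an orthonormal frame\<close>

lemma distr_lborel_orthogonal_transformation:
  fixes f :: "real^'n::{finite,wellorder} \<Rightarrow> real^'n::_"
  assumes f: "orthogonal_transformation f"
  shows "distr lborel borel f = lborel"
proof (rule lborel_eqI[symmetric])
  fix l u :: "real^'n::_" assume lu: "\<And>b. b \<in> Basis \<Longrightarrow> l \<bullet> b \<le> u \<bullet> b"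
  have lin: "linear f" and bij: "bij f"
    using f by (auto simp: orthogonal_transformation_linear orthogonal_transformation_bij)
  have [measurable]: "f \<in> borel_measurable borel"
    using lin by (intro borel_measurable_continuous_onI linear_continuous_on linear_conv_bounded_linear[THEN iffD1])
  have g: "orthogonal_transformation (inv f)"
    by (rule orthogonal_transformation_inv[OF f])
  have vim: "f -` box l u = inv f ` box l u" using bij by (simp add: bij_vimage_eq_inv_image)
  have meas: "inv f ` box l u \<in> lmeasurable" "measure lebesgue (inv f ` box l u) = measure lebesgue (box l u)"
    by (rule measurable_orthogonal_image[OF g], simp) (rule measure_orthogonal_image[OF g], simp)
  have "emeasure (distr lborel borel f) (box l u) = emeasure lborel (inv f ` box l u)"
    by (simp add: emeasure_distr vim)
  also have "\<dots> = emeasure lebesgue (inv f ` box l u)"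
  proof -
    have "f -` box l u \<in> sets borel" using measurable_sets_borel[of f borel "box l u"] by simp
    then show ?thesis by (simp add: vim)
  qed
  also have "\<dots> = ennreal (measure lebesgue (box l u))"
    using meas by (simp add: emeasure_eq_measure2)
  also have "\<dots> = (\<Prod>b\<in>Basis. (u - l) \<bullet> b)"
    using lu by (simp add: measure_lborel_box_eq)
  finally show "emeasure (distr lborel borel f) (box l u) = ennreal (\<Prod>b\<in>Basis. (u - l) \<bullet> b)" .
qed simp

definition tuple_to_vec4 :: "real \<times> real \<times> real \<times> real \<Rightarrow> real^4" where
  "tuple_to_vec4 = (\<lambda>(a, b, c, d). vector [a, b, c, d])"

lemma borel_measurable_tuple_to_vec4[measurable]: "tuple_to_vec4 \<in> borel_measurable borel"
proof -
  have "tuple_to_vec4 = (\<lambda>x. fst x *\<^sub>R axis 1 1 + fst (snd x) *\<^sub>R axis 2 1 + fst (snd (snd x)) *\<^sub>R axis 3 1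
     + snd (snd (snd x)) *\<^sub>R axis 4 1)"
    by (auto simp: tuple_to_vec4_def vec_eq_iff forall_4 axis_def)
  then show ?thesis by (rule ssubst) (intro borel_measurable_continuous_onI continuous_intros)
qed

lemma emeasure_lborel_Times:
  fixes A :: "'a::euclidean_space set" and B :: "'b::euclidean_space set"
  assumes "open A" "open B"
  shows "emeasure lborel (A \<times> B) = emeasure lborel A * emeasure lborel B"
  unfolding lborel_prod[symmetric] using assms by (intro lborel.emeasure_pair_measure_Times) auto

text \<open>
  Iterated integrals live on nested products, whereas the model lives in \<^typ>\<open>real^4\<close>; this
  identifies the two Lebesgue measures.
\<close>

lemma distr_tuple_to_vec4: "distr lborel borel tuple_to_vec4 = lborel"
proof (rule lborel_eqI[symmetric])
  fix l u :: "real^4" assume lu: "\<And>b. b \<in> Basis \<Longrightarrow> l \<bullet> b \<le> u \<bullet> b"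
  have le: "l $ i \<le> u $ i" for i using lu[of "axis i 1"] by (simp add: inner_axis)
  have "tuple_to_vec4 -` box l u = box (l$1) (u$1) \<times> box (l$2) (u$2) \<times> box (l$3) (u$3) \<times> box (l$4) (u$4)"
    by (auto simp: tuple_to_vec4_def mem_box_cart forall_4)
  then have "emeasure (distr lborel borel tuple_to_vec4) (box l u) =
    emeasure lborel (box (l$1) (u$1) \<times> box (l$2) (u$2) \<times> box (l$3) (u$3) \<times> box (l$4) (u$4))"
    by (simp add: emeasure_distr)
  also have "\<dots> = ennreal (u$1 - l$1) * (ennreal (u$2 - l$2) * (ennreal (u$3 - l$3) * ennreal (u$4 - l$4)))"
    using le by (simp add: emeasure_lborel_Times open_Times)
  also have "\<dots> = ennreal (\<Prod>i\<in>UNIV. (u - l) $ i)"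
  proof -
    have "(\<Prod>i\<in>UNIV. (u - l) $ i) = (u$1 - l$1) * ((u$2 - l$2) * ((u$3 - l$3) * (u$4 - l$4)))"
      unfolding UNIV_4 by simp
    moreover have "0 \<le> u$i - l$i" for i using le[of i] by simp
    ultimately show ?thesis by (simp only: ennreal_mult mult_nonneg_nonneg)
  qed
  also have "(\<Prod>i\<in>UNIV. (u - l) $ i) = (\<Prod>b\<in>Basis. (u - l) \<bullet> b)"
  proof -
    have B: "(Basis :: (real^4) set) = range (\<lambda>i. axis i 1)" by (auto simp: Basis_vec_def)
    have inj: "inj (\<lambda>i::4. axis i (1::real))" by (auto simp: inj_on_def axis_eq_axis)
    show ?thesis unfolding B by (simp add: prod.reindex[OF inj] inner_axis)
  qed
  finally show "emeasure (distr lborel borel tuple_to_vec4) (box l u) = ennreal (\<Prod>b\<in>Basis. (u - l) \<bullet> b)" .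
qed simp

definition orthonormal_frame :: "(4 \<Rightarrow> real^4) \<Rightarrow> bool" where
  "orthonormal_frame a \<longleftrightarrow> (\<forall>i j. a i \<bullet> a j = (if i = j then 1 else 0))"

lemma orthonormal_frame_inner: "orthonormal_frame a \<Longrightarrow> a i \<bullet> a j = (if i = j then 1 else 0)"
  by (simp add: orthonormal_frame_def)

lemma orthogonal_transformation_frame:
  assumes "orthonormal_frame a"
  shows "orthogonal_transformation (\<lambda>y. \<Sum>i\<in>UNIV. y $ i *\<^sub>R a i)"
proof -
  have "linear (\<lambda>y. \<Sum>i\<in>UNIV. y $ i *\<^sub>R a i)"
    by (intro linear_compose_sum ballI linear_scaleR_left) (auto intro!: linearI simp: algebra_simps)
  moreover have "(\<Sum>i\<in>UNIV. v $ i *\<^sub>R a i) \<bullet> (\<Sum>i\<in>UNIV. w $ i *\<^sub>R a i) = v \<bullet> w" for v w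
    unfolding inner_vec_def[of v w]
    using assms by (simp add: inner_sum_left inner_sum_right orthonormal_frame_inner if_distrib mult.commute cong: if_cong)
  ultimately show ?thesis unfolding orthogonal_transformation_def by blast
qed

text \<open>
  The last three coordinates form one triple, over which a single integral is taken.
\<close>

definition frame_point :: "(4 \<Rightarrow> real^4) \<Rightarrow> real \<Rightarrow> real \<times> real \<times> real \<Rightarrow> real^4" where
  "frame_point a t q = t *\<^sub>R a 1 + fst q *\<^sub>R a 2 + fst (snd q) *\<^sub>R a 3 + snd (snd q) *\<^sub>R a 4"

text \<open>
  Fubini in the coordinates of an arbitrary orthonormal frame, with the coordinate along \<open>a 1\<close>,
  the direction of the ideal point in the applications, split off.
\<close>

lemma nn_integral_frame_point:
  assumes a: "orthonormal_frame a" and [measurable]: "F \<in> borel_measurable borel"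
  shows "(\<integral>\<^sup>+x. F x \<partial>lborel) = (\<integral>\<^sup>+t. (\<integral>\<^sup>+q. F (frame_point a t q) \<partial>lborel) \<partial>lborel)"
proof -
  define Q where "Q = (\<lambda>y. \<Sum>i\<in>UNIV. y $ i *\<^sub>R a i)"
  have Q: "orthogonal_transformation Q" unfolding Q_def by (rule orthogonal_transformation_frame[OF a])
  have [measurable]: "Q \<in> borel_measurable borel"
    using orthogonal_transformation_linear[OF Q]
    by (intro borel_measurable_continuous_onI linear_continuous_on linear_conv_bounded_linear[THEN iffD1])
  have [measurable]: "(\<lambda>(t, q). F (frame_point a t q)) \<in> borel_measurable (lborel \<Otimes>\<^sub>M lborel)"
  proof -
    have "(\<lambda>x. frame_point a (fst x) (snd x)) \<in> borel_measurable borel"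
      unfolding frame_point_def by (intro borel_measurable_continuous_onI continuous_intros)
    then have "(\<lambda>x. F (frame_point a (fst x) (snd x))) \<in> borel_measurable borel" by measurable
    then show ?thesis by (simp add: lborel_prod case_prod_beta)
  qed
  have "(\<integral>\<^sup>+x. F x \<partial>lborel) = (\<integral>\<^sup>+x. F (Q (tuple_to_vec4 x)) \<partial>lborel)"
  proof -
    have "(\<integral>\<^sup>+x. F x \<partial>lborel) = (\<integral>\<^sup>+x. F x \<partial>distr lborel borel Q)"
      by (simp only: distr_lborel_orthogonal_transformation[OF Q])
    also have "\<dots> = (\<integral>\<^sup>+x. F (Q x) \<partial>lborel)"
      by (rule nn_integral_distr) measurable
    also have "\<dots> = (\<integral>\<^sup>+x. F (Q x) \<partial>distr lborel borel tuple_to_vec4)"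
      by (simp only: distr_tuple_to_vec4)
    also have "\<dots> = (\<integral>\<^sup>+x. F (Q (tuple_to_vec4 x)) \<partial>lborel)"
      by (rule nn_integral_distr) measurable
    finally show ?thesis .
  qed
  also have "\<dots> = (\<integral>\<^sup>+x. (case x of (t, q) \<Rightarrow> F (frame_point a t q)) \<partial>lborel)"
  proof (rule nn_integral_cong)
    fix x :: "real \<times> real \<times> real \<times> real"
    obtain t u v w where x: "x = (t, u, v, w)" by (cases x) auto
    have "Q (tuple_to_vec4 x) = frame_point a t (u, v, w)"
      by (simp add: x Q_def tuple_to_vec4_def frame_point_def sum_4)
    then show "F (Q (tuple_to_vec4 x)) = (case x of (t, q) \<Rightarrow> F (frame_point a t q))"
      by (simp add: x)
  qed
  also have "\<dots> = (\<integral>\<^sup>+t. (\<integral>\<^sup>+q. F (frame_point a t q) \<partial>lborel) \<partial>lborel)"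
  proof -
    have "(\<integral>\<^sup>+t. (\<integral>\<^sup>+q. (\<lambda>(t, q). F (frame_point a t q)) (t, q) \<partial>lborel) \<partial>lborel)
      = (\<integral>\<^sup>+x. (\<lambda>(t, q). F (frame_point a t q)) x \<partial>(lborel \<Otimes>\<^sub>M lborel))"
      by (rule lborel.nn_integral_fst) measurable
    then show ?thesis by (simp add: lborel_prod)
  qed
  finally show ?thesis .
qed

lemma nn_integral_scale3:
  fixes f :: "real \<times> real \<times> real \<Rightarrow> ennreal"
  assumes [measurable]: "f \<in> borel_measurable borel" and c: "c > 0"
  shows "(\<integral>\<^sup>+x. f x \<partial>lborel) = ennreal (c ^ 3) * (\<integral>\<^sup>+x. f (c *\<^sub>R x) \<partial>lborel)"
proof -
  have D: "\<bar>c\<bar> ^ DIM(real \<times> real \<times> real) = c ^ 3"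
    using c by (simp add: numeral_3_eq_3)
  have "(lborel :: (real \<times> real \<times> real) measure) = density (distr lborel borel (\<lambda>x. 0 + c *\<^sub>R x)) (\<lambda>_. ennreal (c ^ 3))"
    unfolding D[symmetric] using c by (intro lborel_affine) simp
  then have "(\<integral>\<^sup>+x. f x \<partial>lborel) = (\<integral>\<^sup>+x. f x \<partial>density (distr lborel borel (\<lambda>x. 0 + c *\<^sub>R x)) (\<lambda>_. ennreal (c ^ 3)))"
    by (rule arg_cong)
  also have "\<dots> = ennreal (c ^ 3) * (\<integral>\<^sup>+x. f (c *\<^sub>R x) \<partial>lborel)"
    by (simp add: nn_integral_density nn_integral_distr nn_integral_cmult)
  finally show ?thesis .
qed

text \<open>
  The volume above a point of the cube, with \<open>r = |p|^2\<close>.  In the coordinate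
  \<open>(1 + t) / (1 - t)\<close> the integrand would be half the power \<open>-5/2\<close> of \<open>(1 + t) / (1 - t) - r\<close>,
  which explains the antiderivative; staying with \<open>t\<close> makes the interval compact, the ideal
  point being at \<open>t = 1\<close>.
\<close>

lemma cusp_radial_integral:
  fixes r k :: real
  assumes r: "0 \<le> r" "r < k"
  shows "(\<integral>\<^sup>+t\<in>{(k - 1) / (k + 1)..1}. ennreal (sqrt (1 - t) / sqrt (1 + t - (1 - t) * r) ^ 5) \<partial>lborel)
    = ennreal (1 / (3 * sqrt (k - r) ^ 3))"
proof -
  define s where "s = (k - 1) / (k + 1)"
  let ?q = "\<lambda>t. 1 + t - (1 - t) * r"
  let ?F = "\<lambda>t. - (sqrt ((1 - t) / ?q t) ^ 3) / 3"
  have k: "k > 0" using r by simp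
  have s1: "s < 1" using k by (simp add: s_def)
  have q: "?q t > 0" if "s \<le> t" "t \<le> 1" for t
  proof (cases "t = 1")
    case False
    then have "(1 - t) * r < (1 - t) * k" using that r by simp
    also have "\<dots> \<le> 1 + t" using that k by (simp add: s_def field_simps)
    finally show ?thesis by simp
  qed simp
  have "(\<integral>\<^sup>+t\<in>{s..1}. ennreal (sqrt (1 - t) / sqrt (?q t) ^ 5) \<partial>lborel) = ennreal (?F 1 - ?F s)"
  proof (rule nn_integral_FTC_interior)
    show "continuous_on {s..1} ?F"
    proof -
      have "\<forall>t\<in>{s..1}. ?q t \<noteq> 0" using q by force
      then show ?thesis by (intro continuous_intros) auto
    qed
    fix t assume t: "s < t" "t < 1"
    define Q where "Q = ?q t"
    have Q: "Q > 0" using q[of t] t by (simp add: Q_def)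
    define v where "v = sqrt ((1 - t) / Q)"
    have v: "v > 0" using t Q by (simp add: v_def)
    have "((\<lambda>t. (1 - t) / ?q t) has_real_derivative ((0 - 1) * Q - (1 - t) * (1 + r)) / (Q * Q)) (at t)"
      using Q unfolding Q_def by (auto intro!: derivative_eq_intros)
    moreover have "(0 - 1) * Q - (1 - t) * (1 + r) = - 2"
      by (simp add: Q_def algebra_simps)
    ultimately have g: "((\<lambda>t. (1 - t) / ?q t) has_real_derivative - 2 / (Q * Q)) (at t)"
      by (simp only:)
    have g0: "(1 - t) / ?q t = v\<^sup>2" "v = sqrt ((1 - t) / ?q t)"
      using t Q by (simp_all add: v_def Q_def)
    have "((\<lambda>t. sqrt ((1 - t) / ?q t)) has_real_derivative (inverse v / 2) * (- 2 / (Q * Q))) (at t)"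
      unfolding g0(2) by (rule DERIV_chain2[OF DERIV_real_sqrt g]) (use g0 v in simp)
    from DERIV_cdivide[OF DERIV_minus[OF DERIV_power[OF this, of 3]], of 3]
    have "(?F has_real_derivative - (of_nat 3 * ((inverse v / 2) * (- 2 / (Q * Q)) * v ^ (3 - Suc 0))) / 3) (at t)"
      by (simp only: g0(2))
    moreover have "- (of_nat 3 * ((inverse v / 2) * (- 2 / (Q * Q)) * v ^ (3 - Suc 0))) / 3 = v / Q\<^sup>2"
    proof -
      have "inverse v * v ^ (3 - Suc 0) = v" using v by (simp add: power2_eq_square numeral_2_eq_2)
      then have "- (of_nat 3 * ((inverse v / 2) * (- 2 / (Q * Q)) * v ^ (3 - Suc 0))) / 3 = v / (Q * Q)"
        by simp
      then show ?thesis by (simp only: power2_eq_square)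
    qed
    moreover have "v / Q\<^sup>2 = sqrt (1 - t) / sqrt Q ^ 5"
    proof -
      have "sqrt Q ^ 4 = (sqrt Q ^ 2)\<^sup>2" by (simp flip: power_mult)
      then have Q2: "Q\<^sup>2 = sqrt Q ^ 4" using Q by simp
      have "v = sqrt (1 - t) / sqrt Q" by (simp add: v_def real_sqrt_divide)
      then have "v / Q\<^sup>2 = sqrt (1 - t) / sqrt Q / sqrt Q ^ 4" by (simp only: Q2)
      also have "\<dots> = sqrt (1 - t) / sqrt Q ^ 5" by (simp add: numeral_eq_Suc)
      finally show ?thesis .
    qed
    ultimately show "(?F has_real_derivative sqrt (1 - t) / sqrt (?q t) ^ 5) (at t)"
      by (simp add: Q_def)
  next
    fix t assume "s \<le> t" "t \<le> 1"
    then show "0 \<le> sqrt (1 - t) / sqrt (?q t) ^ 5" using q[of t] by simp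
  next show "s \<le> 1" using s1 by simp next show "(\<lambda>t. sqrt (1 - t) / sqrt (?q t) ^ 5) \<in> borel_measurable borel" by measurable qed
  also have "?F 1 - ?F s = 1 / (3 * sqrt (k - r) ^ 3)"
  proof -
    have "(1 - s) / ?q s = 1 / (k - r)"
    proof -
      have s2: "1 - s = 2 / (k + 1)" "1 + s = 2 * k / (k + 1)"
        using k by (simp_all add: s_def divide_simps)
      have "?q s = 2 * (k - r) / (k + 1)"
        unfolding s2 by (simp add: diff_divide_distrib algebra_simps)
      then show ?thesis unfolding s2 using k r by (simp add: divide_simps) (simp add: algebra_simps)
    qed
    then have "?F s = - ((1 / sqrt (k - r)) ^ 3) / 3" by (simp only: real_sqrt_divide real_sqrt_one)
    then show ?thesis by (simp add: power_divide)
  qed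
  finally show ?thesis by (simp only: s_def)
qed

section \<open>Hyperbolic volume of regions over a cube\<close>

lemma inner_frame_point:
  assumes "orthonormal_frame a"
  shows "frame_point a t q \<bullet> a 1 = t" "frame_point a t q \<bullet> a 2 = fst q"
    "frame_point a t q \<bullet> a 3 = fst (snd q)" "frame_point a t q \<bullet> a 4 = snd (snd q)"
    "frame_point a t q \<bullet> frame_point a t q = t\<^sup>2 + q \<bullet> q"
  using assms by (simp_all add: frame_point_def inner_add_left inner_add_right orthonormal_frame_inner
    inner_prod_def power2_eq_square)

text \<open>
  For a frame at the ideal point \<open>a 1\<close>, with \<open>t = x \<bullet> a 1\<close>, the numbers
  \<open>p = (x \<bullet> a 2, x \<bullet> a 3, x \<bullet> a 4) / (1 - t)\<close> and \<open>(1 + t) / (1 - t)\<close> are projective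
  coordinates that send \<open>a 1\<close> to infinity: in the upper half-space model \<open>p\<close> is the horizontal
  position, and the second one is \<open>|p|^2\<close> plus the square of the height.  The region is the part
  above the graph of \<open>k\<close> over the cube \<open>|p i| \<le> 1\<close>.
\<close>

definition cusp_region :: "(4 \<Rightarrow> real^4) \<Rightarrow> (real \<times> real \<times> real \<Rightarrow> real) \<Rightarrow> (real^4) set" where
  "cusp_region a k = {x \<in> ball 0 1. (\<forall>i. i \<noteq> 1 \<longrightarrow> \<bar>x \<bullet> a i\<bar> \<le> 1 - x \<bullet> a 1) \<and>
     (1 - x \<bullet> a 1) * k ((1 / (1 - x \<bullet> a 1)) *\<^sub>R (x \<bullet> a 2, x \<bullet> a 3, x \<bullet> a 4)) \<le> 1 + x \<bullet> a 1}"

definition cube3 :: "(real \<times> real \<times> real) set" where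
  "cube3 = {-1..1} \<times> {-1..1} \<times> {-1..1}"

lemma sets_ball_borel [measurable]: "ball (c :: 'a::metric_space) r \<in> sets borel"
  by (intro borel_open open_ball)

lemma sets_cusp_region:
  assumes [measurable]: "k \<in> borel_measurable borel"
  shows "cusp_region a k \<in> sets borel"
proof -
  have [measurable]: "(\<lambda>x::real^4. (1 / (1 - x \<bullet> a 1)) *\<^sub>R (x \<bullet> a 2, x \<bullet> a 3, x \<bullet> a 4)) \<in> borel_measurable borel"
    by (intro borel_measurable_scaleR; measurable)
  have [measurable]: "(\<lambda>x::real^4. k ((1 / (1 - x \<bullet> a 1)) *\<^sub>R (x \<bullet> a 2, x \<bullet> a 3, x \<bullet> a 4))) \<in> borel_measurable borel"
    by (rule measurable_compose[OF _ assms]) measurable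
  have "cusp_region a k = {x \<in> space borel. x \<in> ball 0 1 \<and> (\<forall>i\<in>-{1}. \<bar>x \<bullet> a i\<bar> \<le> 1 - x \<bullet> a 1) \<and>
     (1 - x \<bullet> a 1) * k ((1 / (1 - x \<bullet> a 1)) *\<^sub>R (x \<bullet> a 2, x \<bullet> a 3, x \<bullet> a 4)) \<le> 1 + x \<bullet> a 1}"
    by (auto simp: cusp_region_def)
  also have "\<dots> \<in> sets borel"
    by measurable
  finally show ?thesis .
qed

text \<open>
  For fixed \<open>t\<close> the slice of the region is contained in a cube of half side \<open>1 - t\<close>.  Scaling it
  to \<^const>\<open>cube3\<close> turns the volume density into \<open>sqrt (1 - t) / sqrt q ^ 5\<close> with
  \<open>q = 1 + t - (1 - t) |p|^2\<close>; after an exchange of the integrals the inner one is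
  \<open>cusp_radial_integral\<close>.
\<close>

lemma emeasure_cusp_region:
  assumes a: "orthonormal_frame a" and k[measurable]: "k \<in> borel_measurable borel"
    and k_gt: "\<And>p. p \<in> cube3 \<Longrightarrow> p \<bullet> p < k p"
  shows "emeasure hyp_measure (cusp_region a k) =
    (\<integral>\<^sup>+p\<in>cube3. ennreal (1 / (3 * sqrt (k p - p \<bullet> p) ^ 3)) \<partial>lborel)"
proof -
  have reg_meas[measurable]: "cusp_region a k \<in> sets borel" by (rule sets_cusp_region[OF k])
  have [measurable]: "(\<lambda>x::real^4. ennreal (indicator (ball 0 1) x * (1 - x \<bullet> x) powr (- (5 / 2)))) \<in> borel_measurable borel"
    by measurable
  define F where "F x = ennreal (indicator (ball 0 1) x * (1 - x \<bullet> x) powr (- (5 / 2))) * indicator (cusp_region a k) x" for x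
  have [measurable]: "F \<in> borel_measurable borel" unfolding F_def by measurable
  define s where "s p = (k p - 1) / (k p + 1)" for p
  define f where "f p t = sqrt (1 - t) / sqrt (1 + t - (1 - t) * (p \<bullet> p)) ^ 5" for p :: "real \<times> real \<times> real" and t
  have inner: "(\<integral>\<^sup>+q. F (frame_point a t q) \<partial>lborel)
    = (\<integral>\<^sup>+p. ennreal (f p t) * indicator {s p..1} t * indicator cube3 p \<partial>lborel)" for t
  proof (cases "t < 1")
    case False
    have "F (frame_point a t q) = 0" for q
    proof -
      have "frame_point a t q \<notin> ball 0 1"
      proof
        assume "frame_point a t q \<in> ball 0 1"
        then have "frame_point a t q \<bullet> frame_point a t q < 1"
          by (simp add: dot_square_norm power_less_one_iff)
        then have "t\<^sup>2 + q \<bullet> q < 1" by (simp only: inner_frame_point[OF a])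
        then have "t\<^sup>2 < 1" using inner_ge_zero[of q] by linarith
        with False show False by (simp add: abs_square_less_1)
      qed
      then show ?thesis by (simp add: F_def)
    qed
    moreover have "ennreal (f p t) * indicator {s p..1} t = 0" for p
      using False by (cases "t = 1") (auto simp: f_def)
    ultimately show ?thesis by (simp only: mult_zero_left)
  next
    case True
    have meas: "(\<lambda>q. F (frame_point a t q)) \<in> borel_measurable borel"
    proof -
      have "(\<lambda>q. frame_point a t q) \<in> borel_measurable borel"
        unfolding frame_point_def by (intro borel_measurable_continuous_onI continuous_intros)
      then show ?thesis by measurable
    qed
    have "(\<integral>\<^sup>+q. F (frame_point a t q) \<partial>lborel) = ennreal ((1 - t) ^ 3) * (\<integral>\<^sup>+p. F (frame_point a t ((1 - t) *\<^sub>R p)) \<partial>lborel)"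
      using True by (intro nn_integral_scale3 meas) simp
    also have "\<dots> = (\<integral>\<^sup>+p. ennreal ((1 - t) ^ 3) * F (frame_point a t ((1 - t) *\<^sub>R p)) \<partial>lborel)"
    proof (rule nn_integral_cmult[symmetric])
      have "(\<lambda>p :: real \<times> real \<times> real. (1 - t) *\<^sub>R p) \<in> borel_measurable borel" by measurable
      from measurable_compose[OF this meas]
      show "(\<lambda>p. F (frame_point a t ((1 - t) *\<^sub>R p))) \<in> borel_measurable lborel" by simp
    qed
    also have "\<dots> = (\<integral>\<^sup>+p. ennreal (f p t) * indicator {s p..1} t * indicator cube3 p \<partial>lborel)"
    proof (rule nn_integral_cong)
      fix p :: "real \<times> real \<times> real"
      let ?x = "frame_point a t ((1 - t) *\<^sub>R p)"
      define Q where "Q = 1 + t - (1 - t) * (p \<bullet> p)"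
      have xx: "1 - ?x \<bullet> ?x = (1 - t) * Q"
        by (simp add: inner_frame_point[OF a] Q_def algebra_simps power2_eq_square)
      have cube: "(\<forall>i. i \<noteq> 1 \<longrightarrow> \<bar>?x \<bullet> a i\<bar> \<le> 1 - ?x \<bullet> a 1) \<longleftrightarrow> p \<in> cube3"
      proof -
        have ab: "\<bar>(1 - t) * u\<bar> \<le> 1 - t \<longleftrightarrow> u \<in> {-1..1}" for u
          using True mult_le_cancel_left_pos[of "1 - t" "\<bar>u\<bar>" 1] by (auto simp: abs_mult)
        show ?thesis
          by (cases p) (simp add: forall_4 inner_frame_point[OF a] cube3_def ab del: atLeastAtMost_iff)
      qed
      have "(1 / (1 - ?x \<bullet> a 1)) *\<^sub>R (?x \<bullet> a 2, ?x \<bullet> a 3, ?x \<bullet> a 4) = p"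
        using True by (cases p) (simp add: inner_frame_point[OF a])
      then have reg: "?x \<in> cusp_region a k \<longleftrightarrow> ?x \<in> ball 0 1 \<and> p \<in> cube3 \<and> (1 - t) * k p \<le> 1 + t"
        unfolding cusp_region_def using cube by (simp add: inner_frame_point[OF a])
      show "ennreal ((1 - t) ^ 3) * F ?x = ennreal (f p t) * indicator {s p..1} t * indicator cube3 p"
      proof (cases "p \<in> cube3")
        case False
        then show ?thesis using reg by (simp add: F_def)
      next
        case p: True
        have kp: "k p > 0" using k_gt[OF p] inner_ge_zero[of p] by linarith
        have s: "(1 - t) * k p \<le> 1 + t \<longleftrightarrow> t \<in> {s p..1}"
          using kp True by (auto simp: s_def field_simps)
        show ?thesis
        proof (cases "t \<in> {s p..1}")
          case False
          then show ?thesis using reg s by (simp add: F_def)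
        next
          case ts: True
          have "(1 - t) * (p \<bullet> p) < (1 - t) * k p" using k_gt[OF p] True by simp
          also have "\<dots> \<le> 1 + t" using ts s by simp
          finally have Q: "Q > 0" by (simp add: Q_def)
          then have "1 - ?x \<bullet> ?x > 0" unfolding xx using True by simp
          then have ball: "?x \<in> ball 0 1" by (simp add: dot_square_norm power_less_one_iff abs_square_less_1)
          have "(1 - t) ^ 3 * ((1 - t) * Q) powr (- (5 / 2)) = f p t"
          proof -
            have pw: "y powr (- (5 / 2)) = 1 / sqrt y ^ 5" if "y > 0" for y :: real
            proof -
              have "sqrt y ^ 5 = (y powr (1 / 2)) powr 5"
                using that by (simp add: powr_half_sqrt powr_realpow[of "sqrt y" 5, simplified])
              also have "\<dots> = y powr (5 / 2)" using that by (simp add: powr_powr)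
              finally show ?thesis using that by (simp add: powr_minus_divide)
            qed
            have "(1 - t) ^ 3 = sqrt (1 - t) ^ 5 * sqrt (1 - t)"
            proof -
              have "sqrt (1 - t) ^ 5 * sqrt (1 - t) = (sqrt (1 - t) ^ 2) ^ 3"
                unfolding power_mult[symmetric] by (simp add: eval_nat_numeral)
              then show ?thesis using True by simp
            qed
            then show ?thesis using True Q
              by (simp add: pw f_def Q_def[symmetric] real_sqrt_mult power_mult_distrib)
          qed
          then have "ennreal ((1 - t) ^ 3) * F ?x = ennreal (f p t)"
            using ball reg p ts s True by (simp add: F_def xx ennreal_mult'[symmetric])
          then show ?thesis using p ts by simp
        qed
      qed
    qed
    finally show ?thesis .
  qed
  have [measurable]: "cube3 \<in> sets borel" unfolding cube3_def by (intro borel_closed closed_Times) auto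
  have [measurable]: "s \<in> borel_measurable borel" unfolding s_def by measurable
  have [measurable]: "(\<lambda>x. f (snd x) (fst x)) \<in> borel_measurable (lborel \<Otimes>\<^sub>M lborel)"
    unfolding f_def by measurable
  have "emeasure hyp_measure (cusp_region a k) = (\<integral>\<^sup>+x. F x \<partial>lborel)"
    unfolding hyp_measure_def F_def by (rule emeasure_density) auto
  also have "\<dots> = (\<integral>\<^sup>+t. (\<integral>\<^sup>+p. ennreal (f p t) * indicator {s p..1} t * indicator cube3 p \<partial>lborel) \<partial>lborel)"
    by (subst nn_integral_frame_point[OF a]) (simp_all add: inner)
  also have "\<dots> = (\<integral>\<^sup>+p. (\<integral>\<^sup>+t. ennreal (f p t) * indicator {s p..1} t * indicator cube3 p \<partial>lborel) \<partial>lborel)"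
  proof (rule lborel_pair.Fubini'[symmetric])
    have "(\<lambda>x. ennreal (f (snd x) (fst x)) * (if s (snd x) \<le> fst x \<and> fst x \<le> 1 then 1 else 0) * indicator cube3 (snd x))
       \<in> borel_measurable (lborel \<Otimes>\<^sub>M lborel)" by measurable
    also have "(\<lambda>x. ennreal (f (snd x) (fst x)) * (if s (snd x) \<le> fst x \<and> fst x \<le> 1 then 1 else 0) * indicator cube3 (snd x))
      = (\<lambda>(t, p). ennreal (f p t) * indicator {s p..1} t * indicator cube3 p)"
      by (auto simp: fun_eq_iff indicator_def)
    finally show "(\<lambda>(t, p). ennreal (f p t) * indicator {s p..1} t * indicator cube3 p) \<in> borel_measurable (lborel \<Otimes>\<^sub>M lborel)" .
  qed
  also have "\<dots> = (\<integral>\<^sup>+p\<in>cube3. ennreal (1 / (3 * sqrt (k p - p \<bullet> p) ^ 3)) \<partial>lborel)"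
  proof (rule nn_integral_cong)
    fix p
    show "(\<integral>\<^sup>+t. ennreal (f p t) * indicator {s p..1} t * indicator cube3 p \<partial>lborel)
      = ennreal (1 / (3 * sqrt (k p - p \<bullet> p) ^ 3)) * indicator cube3 p"
    proof (cases "p \<in> cube3")
      case True
      then show ?thesis
        using cusp_radial_integral[OF inner_ge_zero k_gt[OF True]] by (simp add: f_def s_def)
    qed simp
  qed
  finally show ?thesis .
qed

section \<open>The 24-cell in frames adapted to a vertex\<close>

text \<open>
  The coordinates used below for the 24-cell are not the standard ones: in a frame that contains
  a vertex, the vertices are those of a cross-polytope and of a cube.
\<close>

definition frame_vertices :: "(4 \<Rightarrow> real^4) \<Rightarrow> (real^4) set" where
  "frame_vertices a = {s *\<^sub>R a i | i s. s \<in> {-1, 1}} \<union>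
     {(1 / 2) *\<^sub>R (\<Sum>i\<in>UNIV. s i *\<^sub>R a i) | s. \<forall>i. s i \<in> {-1, 1}}"

definition frame_polytope :: "(4 \<Rightarrow> real^4) \<Rightarrow> (real^4) set" where
  "frame_polytope a = {x. \<forall>i j. i \<noteq> j \<longrightarrow> \<bar>x \<bullet> a i\<bar> + \<bar>x \<bullet> a j\<bar> \<le> 1}"

definition vertex_frame :: "(4 \<Rightarrow> real^4) \<Rightarrow> bool" where
  "vertex_frame a \<longleftrightarrow> orthonormal_frame a \<and> vertices24 = frame_vertices a \<and> P24 = frame_polytope a"

lemma finite_max_arg:
  fixes f :: "'a \<Rightarrow> 'b::linorder"
  assumes "finite A" "A \<noteq> {}"
  obtains m where "m \<in> A" "\<And>k. k \<in> A \<Longrightarrow> f k \<le> f m"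
proof -
  have "Max (f ` A) \<in> f ` A" using assms by (intro Max_in) auto
  then obtain m where "m \<in> A" "Max (f ` A) = f m" by blast
  then show ?thesis using that[of m] assms Max_ge[of "f ` A"] by simp
qed

lemma vertices24I:
  "i \<noteq> j \<Longrightarrow> s \<in> {-1, 1} \<Longrightarrow> t \<in> {-1, 1} \<Longrightarrow>
    (1 / sqrt 2) *\<^sub>R (s *\<^sub>R axis i 1 + t *\<^sub>R axis j 1) \<in> vertices24"
  unfolding vertices24_def by blast

lemma finite_vertices24: "finite vertices24"
proof -
  have "vertices24 \<subseteq> (\<lambda>(i, j, s, t). (1 / sqrt 2) *\<^sub>R (s *\<^sub>R axis i 1 + t *\<^sub>R axis j 1)) ` (UNIV \<times> UNIV \<times> {-1,1} \<times> {-1,1})"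
  proof
    fix x assume "x \<in> vertices24"
    then obtain i j s t where x: "x = (1 / sqrt 2) *\<^sub>R (s *\<^sub>R axis i 1 + t *\<^sub>R axis j 1)"
      and st: "s \<in> {-1, 1}" "t \<in> {-1, 1}" unfolding vertices24_def by blast
    show "x \<in> (\<lambda>(i, j, s, t). (1 / sqrt 2) *\<^sub>R (s *\<^sub>R axis i 1 + t *\<^sub>R axis j 1)) ` (UNIV \<times> UNIV \<times> {-1,1} \<times> {-1,1})"
      by (rule image_eqI[where x = "(i, j, s, t)"]) (use x st in auto)
  qed
  then show ?thesis by (rule finite_subset) auto
qed

text \<open>
  A point outside the convex hull is separated from it by a linear functional \<open>y\<close>.  Among the
  vertices \<open>y\<close> attains \<open>(|y i| + |y j|) / sqrt 2\<close>, where \<open>i\<close> and \<open>j\<close> are the coordinates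
  in which \<open>|y|\<close> is largest, and the assumed inequalities bound \<open>y \<bullet> z\<close> by the same
  number.
\<close>

lemma P24_supporting_inequalities:
  fixes z :: "real^4"
  assumes z1: "\<And>i. \<bar>z $ i\<bar> \<le> 1 / sqrt 2" and z2: "(\<Sum>i\<in>UNIV. \<bar>z $ i\<bar>) \<le> sqrt 2"
  shows "z \<in> P24"
proof (rule ccontr)
  assume "z \<notin> P24"
  moreover have "convex P24" "closed P24"
    unfolding P24_def using finite_vertices24 by (auto intro!: compact_imp_closed finite_imp_compact_convex_hull)
  ultimately obtain c b where cb: "c \<bullet> z < b" "\<forall>x\<in>P24. b < c \<bullet> x"
    using separating_hyperplane_closed_point[of P24 z] by blast
  define y where "y = - c"
  have sep: "y \<bullet> v < y \<bullet> z" if "v \<in> vertices24" for v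
  proof -
    have "v \<in> P24" using that hull_inc[of v vertices24] by (simp add: P24_def)
    with cb show ?thesis by (force simp: y_def)
  qed
  obtain i where i: "\<And>k. \<bar>y $ k\<bar> \<le> \<bar>y $ i\<bar>"
    using finite_max_arg[of UNIV "\<lambda>k. \<bar>y $ k\<bar>"] by auto
  have "UNIV - {i} \<noteq> {}" using card_num1 by (metis Diff_eq_empty_iff UNIV_I one_neq_zero subset_singleton_iff top.extremum_uniqueI empty_iff singletonD zero_neq_numeral)
  then obtain j where j: "j \<noteq> i" "\<And>k. k \<noteq> i \<Longrightarrow> \<bar>y $ k\<bar> \<le> \<bar>y $ j\<bar>"
    using finite_max_arg[of "UNIV - {i}" "\<lambda>k. \<bar>y $ k\<bar>"] by auto
  define v where "v = (1 / sqrt 2) *\<^sub>R ((if y $ i \<ge> 0 then 1 else - 1) *\<^sub>R axis i 1 + (if y $ j \<ge> 0 then 1 else - 1) *\<^sub>R axis j (1::real))"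
  have "v \<in> vertices24" unfolding v_def using j(1) by (intro vertices24I) auto
  then have "y \<bullet> v < y \<bullet> z" by (rule sep)
  moreover have "y \<bullet> v = (\<bar>y $ i\<bar> + \<bar>y $ j\<bar>) / sqrt 2"
    unfolding v_def by (auto simp: inner_add_right inner_axis divide_simps)
  moreover have "y \<bullet> z \<le> (\<bar>y $ i\<bar> + \<bar>y $ j\<bar>) / sqrt 2"
  proof -
    have "y \<bullet> z = y $ i * z $ i + (\<Sum>k\<in>UNIV - {i}. y $ k * z $ k)"
      unfolding inner_vec_def by (simp add: sum.remove[of UNIV i])
    also have "\<dots> \<le> \<bar>y $ i\<bar> * \<bar>z $ i\<bar> + (\<Sum>k\<in>UNIV - {i}. \<bar>y $ j\<bar> * \<bar>z $ k\<bar>)"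
    proof (intro add_mono sum_mono)
      show "y $ i * z $ i \<le> \<bar>y $ i\<bar> * \<bar>z $ i\<bar>" by (metis abs_ge_self abs_mult)
      fix k assume "k \<in> UNIV - {i}"
      then have "\<bar>y $ k\<bar> \<le> \<bar>y $ j\<bar>" using j(2) by simp
      then have "\<bar>y $ k\<bar> * \<bar>z $ k\<bar> \<le> \<bar>y $ j\<bar> * \<bar>z $ k\<bar>" by (intro mult_right_mono) auto
      then show "y $ k * z $ k \<le> \<bar>y $ j\<bar> * \<bar>z $ k\<bar>" by (metis abs_ge_self abs_mult order_trans)
    qed
    also have "\<dots> = (\<bar>y $ i\<bar> - \<bar>y $ j\<bar>) * \<bar>z $ i\<bar> + \<bar>y $ j\<bar> * (\<Sum>k\<in>UNIV. \<bar>z $ k\<bar>)"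
      by (simp add: sum.remove[of UNIV i] sum_distrib_left algebra_simps)
    also have "\<dots> \<le> (\<bar>y $ i\<bar> - \<bar>y $ j\<bar>) * (1 / sqrt 2) + \<bar>y $ j\<bar> * sqrt 2"
      using i[of j] by (intro add_mono mult_left_mono z1 z2) auto
    also have "\<dots> = (\<bar>y $ i\<bar> + \<bar>y $ j\<bar>) / sqrt 2"
      by (simp add: field_simps)
    finally show ?thesis .
  qed
  ultimately show False by simp
qed

lemma convex_frame_polytope: "convex (frame_polytope a)"
proof (rule convexI)
  fix x y :: "real^4" and u v :: real
  assume x: "x \<in> frame_polytope a" and y: "y \<in> frame_polytope a" and uv: "0 \<le> u" "0 \<le> v" "u + v = 1"
  have *: "\<bar>(u *\<^sub>R x + v *\<^sub>R y) \<bullet> b\<bar> \<le> u * \<bar>x \<bullet> b\<bar> + v * \<bar>y \<bullet> b\<bar>" for b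
    using uv abs_triangle_ineq[of "u * (x \<bullet> b)" "v * (y \<bullet> b)"]
    by (simp add: inner_add_left abs_mult)
  show "u *\<^sub>R x + v *\<^sub>R y \<in> frame_polytope a"
    unfolding frame_polytope_def
  proof (clarify)
    fix i j :: 4 assume "i \<noteq> j"
    then have "\<bar>x \<bullet> a i\<bar> + \<bar>x \<bullet> a j\<bar> \<le> 1" "\<bar>y \<bullet> a i\<bar> + \<bar>y \<bullet> a j\<bar> \<le> 1"
      using x y by (auto simp: frame_polytope_def)
    then have "u * (\<bar>x \<bullet> a i\<bar> + \<bar>x \<bullet> a j\<bar>) + v * (\<bar>y \<bullet> a i\<bar> + \<bar>y \<bullet> a j\<bar>) \<le> u * 1 + v * 1"
      using uv by (intro add_mono mult_left_mono) auto
    then show "\<bar>(u *\<^sub>R x + v *\<^sub>R y) \<bullet> a i\<bar> + \<bar>(u *\<^sub>R x + v *\<^sub>R y) \<bullet> a j\<bar> \<le> 1"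
      using *[of "a i"] *[of "a j"] uv by (simp add: algebra_simps)
  qed
qed

lemma inner_sign_sum:
  assumes "orthonormal_frame a"
  shows "(\<Sum>i\<in>UNIV. s i *\<^sub>R a i) \<bullet> a j = s j"
  using assms by (simp add: inner_sum_left orthonormal_frame_inner if_distrib cong: if_cong)

lemma frame_vertices_subset_polytope:
  assumes "orthonormal_frame a"
  shows "frame_vertices a \<subseteq> frame_polytope a"
proof
  fix x assume "x \<in> frame_vertices a"
  then consider k s where "s \<in> {-1, 1}" "x = s *\<^sub>R a k"
    | s where "\<forall>i. s i \<in> {-1, 1::real}" "x = (1 / 2) *\<^sub>R (\<Sum>i\<in>UNIV. s i *\<^sub>R a i)"
    unfolding frame_vertices_def by blast
  then show "x \<in> frame_polytope a"
  proof cases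
    case 1
    then show ?thesis
      using assms by (auto simp: frame_polytope_def orthonormal_frame_inner)
  next
    case 2
    have "\<bar>s i\<bar> = 1" for i using 2(1) by (metis abs_1 abs_minus_cancel insertE singletonD)
    then show ?thesis
      unfolding frame_polytope_def 2(2) using inner_sign_sum[OF assms, of s] by simp
  qed
qed

text \<open>
  A rotation by 45 degrees in two orthogonal planes, which exchanges the two descriptions of the
  24-cell.
\<close>

definition rotated_frame :: "(4 \<Rightarrow> real^4) \<Rightarrow> 4 \<Rightarrow> real^4" where
  "rotated_frame e m = (1 / sqrt 2) *\<^sub>R
     (if m = 1 then e 1 + e 2 else if m = 2 then e 1 - e 2 else if m = 3 then e 3 + e 4 else e 4 - e 3)"

lemma rotated_frame_simps:
  "rotated_frame e 1 = (1 / sqrt 2) *\<^sub>R (e 1 + e 2)" "rotated_frame e 2 = (1 / sqrt 2) *\<^sub>R (e 1 - e 2)"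
  "rotated_frame e 3 = (1 / sqrt 2) *\<^sub>R (e 3 + e 4)" "rotated_frame e 4 = (1 / sqrt 2) *\<^sub>R (e 4 - e 3)"
  by (simp_all add: rotated_frame_def)

lemma orthonormal_rotated_frame:
  assumes "orthonormal_frame e"
  shows "orthonormal_frame (rotated_frame e)"
  unfolding orthonormal_frame_def forall_4 rotated_frame_simps
  by (simp add: inner_add_left inner_add_right inner_diff_left inner_diff_right orthonormal_frame_inner[OF assms])

text \<open>
  The 24 roots of type \<open>D4\<close>, normalised to unit length, in a frame \<open>e\<close> are the vertices \<open>\<plusminus> a i\<close> and
  \<open>(\<plusminus> 1/2, \<plusminus> 1/2, \<plusminus> 1/2, \<plusminus> 1/2)\<close> in the rotated frame \<open>a\<close>.
\<close>

lemma frame_vertices_rotated: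
  fixes e :: "4 \<Rightarrow> real^4"
  shows "frame_vertices (rotated_frame e)
    = {(1 / sqrt 2) *\<^sub>R (s *\<^sub>R e i + t *\<^sub>R e j) | i j s t. i \<noteq> j \<and> s \<in> {-1, 1} \<and> t \<in> {-1, 1}}" (is "_ = ?V")
proof
  let ?a = "rotated_frame e"
  have intro: "x \<in> ?V" if "x = (1 / sqrt 2) *\<^sub>R (s *\<^sub>R e i + t *\<^sub>R e j)" "i \<noteq> j" "s \<in> {-1, 1}" "t \<in> {-1, 1}" for x i j s t
    using that by blast
  have half: "(1 / 2) *\<^sub>R (\<Sum>i\<in>UNIV. s i *\<^sub>R ?a i) = (1 / sqrt 2) *\<^sub>R
    (((s 1 + s 2) / 2) *\<^sub>R e 1 + ((s 1 - s 2) / 2) *\<^sub>R e 2 + ((s 3 - s 4) / 2) *\<^sub>R e 3 + ((s 3 + s 4) / 2) *\<^sub>R e 4)" for s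
    by (simp add: sum_4 rotated_frame_simps vec_eq_iff algebra_simps add_divide_distrib diff_divide_distrib)
  show "frame_vertices ?a \<subseteq> ?V"
  proof
    fix x assume "x \<in> frame_vertices ?a"
    then consider k s where "s \<in> {-1, 1}" "x = s *\<^sub>R ?a k"
      | s where "\<forall>i. s i \<in> {-1, 1::real}" "x = (1 / 2) *\<^sub>R (\<Sum>i\<in>UNIV. s i *\<^sub>R ?a i)"
      unfolding frame_vertices_def by blast
    then show "x \<in> ?V"
    proof cases
      case 1
      have "x = (1 / sqrt 2) *\<^sub>R (s *\<^sub>R e 1 + s *\<^sub>R e 2) \<or> x = (1 / sqrt 2) *\<^sub>R (s *\<^sub>R e 1 + (- s) *\<^sub>R e 2)
        \<or> x = (1 / sqrt 2) *\<^sub>R (s *\<^sub>R e 3 + s *\<^sub>R e 4) \<or> x = (1 / sqrt 2) *\<^sub>R (s *\<^sub>R e 4 + (- s) *\<^sub>R e 3)"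
        using exhaust_4[of k] 1(2) by (elim disjE) (simp_all add: rotated_frame_simps algebra_simps)
      then show ?thesis by (elim disjE; elim intro; use 1(1) in auto)
    next
      case 2
      have s: "s 1 \<in> {-1, 1}" "s 2 \<in> {-1, 1}" "s 3 \<in> {-1, 1}" "s 4 \<in> {-1, 1}" using 2(1) by blast+
      have "s 2 = s 1 \<or> s 2 = - s 1" "s 4 = s 3 \<or> s 4 = - s 3" using s by auto
      then have "x = (1 / sqrt 2) *\<^sub>R (s 1 *\<^sub>R e 1 + s 3 *\<^sub>R e 4) \<or> x = (1 / sqrt 2) *\<^sub>R (s 1 *\<^sub>R e 2 + s 3 *\<^sub>R e 4)
        \<or> x = (1 / sqrt 2) *\<^sub>R (s 1 *\<^sub>R e 1 + s 3 *\<^sub>R e 3) \<or> x = (1 / sqrt 2) *\<^sub>R (s 1 *\<^sub>R e 2 + s 3 *\<^sub>R e 3)"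
        unfolding 2(2) half by (elim disjE) simp_all
      then show ?thesis by (elim disjE; elim intro; use s in auto)
    qed
  qed
  show "?V \<subseteq> frame_vertices ?a"
  proof
    fix x assume "x \<in> ?V"
    then obtain i j s t where x: "x = (1 / sqrt 2) *\<^sub>R (s *\<^sub>R e i + t *\<^sub>R e j)" and ij: "i \<noteq> j"
      and st: "s \<in> {-1, 1}" "t \<in> {-1, 1}" by blast
    have sing: "x \<in> frame_vertices ?a" if "x = u *\<^sub>R ?a k" "u \<in> {-1, 1}" for u k
      using that unfolding frame_vertices_def by blast
    have halfI: "x \<in> frame_vertices ?a"
      if "x = (1 / 2) *\<^sub>R (u1 *\<^sub>R ?a 1 + u2 *\<^sub>R ?a 2 + u3 *\<^sub>R ?a 3 + u4 *\<^sub>R ?a 4)"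
        "u1 \<in> {-1, 1}" "u2 \<in> {-1, 1}" "u3 \<in> {-1, 1}" "u4 \<in> {-1, 1}" for u1 u2 u3 u4
    proof -
      let ?s = "\<lambda>i::4. if i = 1 then u1 else if i = 2 then u2 else if i = 3 then u3 else u4"
      have "x = (1 / 2) *\<^sub>R (\<Sum>i\<in>UNIV. ?s i *\<^sub>R ?a i)" using that(1) by (simp add: sum_4)
      moreover have "\<forall>i. ?s i \<in> {-1, 1}" using that(2-) by simp
      ultimately show ?thesis unfolding frame_vertices_def by (intro UnI2 CollectI exI[of _ ?s] conjI)
    qed
    have st2: "t = s \<or> t = - s" using st by auto
    have mixed: "x \<in> frame_vertices ?a"
      if "x = (1 / sqrt 2) *\<^sub>R (u *\<^sub>R e p + v *\<^sub>R e q)" "u \<in> {-1, 1}" "v \<in> {-1, 1}" "p = 1 \<or> p = 2" "q = 3 \<or> q = 4"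
      for u v p q
    proof -
      define d where "d = (if p = 1 then 1 else - 1 :: real)"
      define g where "g = (if q = 4 then 1 else - 1 :: real)"
      have "x = (1 / 2) *\<^sub>R (u *\<^sub>R ?a 1 + (d * u) *\<^sub>R ?a 2 + v *\<^sub>R ?a 3 + (g * v) *\<^sub>R ?a 4)"
        unfolding that(1) d_def g_def using that(4,5)
        by (auto simp: rotated_frame_simps vec_eq_iff algebra_simps)
      then show ?thesis using that(2,3) by (intro halfI[of u "d * u" v "g * v"]) (auto simp: d_def g_def)
    qed
    have ex: "i = 1 \<or> i = 2 \<or> i = 3 \<or> i = 4" "j = 1 \<or> j = 2 \<or> j = 3 \<or> j = 4" using exhaust_4 by auto
    consider "i \<in> {1,2}" "j \<in> {3,4}" | "i \<in> {3,4}" "j \<in> {1,2}" | "{i, j} = {1, 2}" | "{i, j} = {3, 4}"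
      using ex ij by auto
    then show "x \<in> frame_vertices ?a"
    proof cases
      case 1
      then show ?thesis using x st by (intro mixed[of s i t j]) auto
    next
      case 2
      then show ?thesis using x st by (intro mixed[of t j s i]) (auto simp: add.commute)
    next
      case 3
      then have "x = s *\<^sub>R ?a 1 \<or> x = s *\<^sub>R ?a 2 \<or> x = (- s) *\<^sub>R ?a 2"
        using st2 unfolding x doubleton_eq_iff by (auto simp: rotated_frame_simps algebra_simps)
      then show ?thesis by (elim disjE; elim sing; use st in auto)
    next
      case 4
      then have "x = s *\<^sub>R ?a 3 \<or> x = s *\<^sub>R ?a 4 \<or> x = (- s) *\<^sub>R ?a 4"
        using st2 unfolding x doubleton_eq_iff by (auto simp: rotated_frame_simps algebra_simps)
      then show ?thesis by (elim disjE; elim sing; use st in auto)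
    qed
  qed
qed

lemma vertex_frame_rotated:
  fixes p :: "4 \<Rightarrow> 4"
  assumes p: "bij p" and d: "\<And>i. d i \<in> {-1, 1::real}"
  defines "e \<equiv> \<lambda>i. d i *\<^sub>R axis (p i) (1::real)"
  shows "vertex_frame (rotated_frame e)"
proof -
  let ?a = "rotated_frame e"
  have dd: "d i * d i = 1" "\<bar>d i\<bar> = 1" for i using d[of i] by auto
  have oe: "orthonormal_frame e"
    using bij_is_inj[OF p] dd by (auto simp: orthonormal_frame_def e_def inner_axis_axis inj_eq)
  have oa: "orthonormal_frame ?a" by (rule orthonormal_rotated_frame[OF oe])
  have V: "vertices24 = frame_vertices ?a"
    unfolding frame_vertices_rotated
  proof (intro equalityI subsetI)
    fix x assume "x \<in> vertices24"
    then obtain i j s t where x: "x = (1 / sqrt 2) *\<^sub>R (s *\<^sub>R axis i 1 + t *\<^sub>R axis j 1)" and ij: "i \<noteq> j"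
      and st: "s \<in> {-1, 1}" "t \<in> {-1, 1}" unfolding vertices24_def by blast
    obtain i' j' where ij': "i = p i'" "j = p j'" using bij_is_surj[OF p] by (metis surjD)
    have "x = (1 / sqrt 2) *\<^sub>R ((s * d i') *\<^sub>R e i' + (t * d j') *\<^sub>R e j')"
      unfolding x e_def ij' by (simp add: mult.assoc dd)
    moreover have "i' \<noteq> j'" using ij ij' by auto
    moreover have "s * d i' \<in> {-1, 1}" "t * d j' \<in> {-1, 1}" using st d[of i'] d[of j'] by auto
    ultimately show "x \<in> {(1 / sqrt 2) *\<^sub>R (s *\<^sub>R e i + t *\<^sub>R e j) | i j s t. i \<noteq> j \<and> s \<in> {-1, 1} \<and> t \<in> {-1, 1}}"
      by blast
  next
    fix x assume "x \<in> {(1 / sqrt 2) *\<^sub>R (s *\<^sub>R e i + t *\<^sub>R e j) | i j s t. i \<noteq> j \<and> s \<in> {-1, 1} \<and> t \<in> {-1, 1}}"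
    then obtain i j s t where x: "x = (1 / sqrt 2) *\<^sub>R (s *\<^sub>R e i + t *\<^sub>R e j)" and ij: "i \<noteq> j"
      and st: "s \<in> {-1, 1}" "t \<in> {-1, 1}" by blast
    have "x = (1 / sqrt 2) *\<^sub>R ((s * d i) *\<^sub>R axis (p i) 1 + (t * d j) *\<^sub>R axis (p j) 1)"
      unfolding x e_def by simp
    moreover have "p i \<noteq> p j" using ij bij_is_inj[OF p] by (simp add: inj_eq)
    moreover have "s * d i \<in> {-1, 1}" "t * d j \<in> {-1, 1}" using st d[of i] d[of j] by auto
    ultimately show "x \<in> vertices24" unfolding vertices24_def by blast
  qed
  have P1: "P24 \<subseteq> frame_polytope ?a"
    unfolding P24_def V by (intro hull_minimal frame_vertices_subset_polytope[OF oa] convex_frame_polytope)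
  have P2: "frame_polytope ?a \<subseteq> P24"
  proof
    fix x assume x: "x \<in> frame_polytope ?a"
    have ineq: "\<bar>x \<bullet> ?a i\<bar> + \<bar>x \<bullet> ?a j\<bar> \<le> 1" if "i \<noteq> j" for i j
      using x that by (auto simp: frame_polytope_def)
    define b where "b i = x \<bullet> ?a i" for i
    have b: "\<bar>b 1\<bar> + \<bar>b 2\<bar> \<le> 1" "\<bar>b 1\<bar> + \<bar>b 3\<bar> \<le> 1" "\<bar>b 1\<bar> + \<bar>b 4\<bar> \<le> 1"
      "\<bar>b 2\<bar> + \<bar>b 3\<bar> \<le> 1" "\<bar>b 2\<bar> + \<bar>b 4\<bar> \<le> 1" "\<bar>b 3\<bar> + \<bar>b 4\<bar> \<le> 1"
      unfolding b_def by (auto intro!: ineq)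
    have e: "x \<bullet> e 1 = (b 1 + b 2) / sqrt 2" "x \<bullet> e 2 = (b 1 - b 2) / sqrt 2"
      "x \<bullet> e 3 = (b 3 - b 4) / sqrt 2" "x \<bullet> e 4 = (b 3 + b 4) / sqrt 2"
      unfolding b_def rotated_frame_simps by (simp_all add: inner_add_right inner_diff_right field_simps)
    have xe: "\<bar>x \<bullet> e i\<bar> = \<bar>x $ p i\<bar>" for i
      by (simp add: e_def inner_axis abs_mult dd)
    show "x \<in> P24"
    proof (rule P24_supporting_inequalities)
      have bound: "\<bar>u / sqrt 2\<bar> \<le> 1 / sqrt 2" if "\<bar>u\<bar> \<le> 1" for u :: real
        using that by (simp add: abs_divide divide_right_mono)
      have "\<bar>b 1 + b 2\<bar> \<le> 1" "\<bar>b 1 - b 2\<bar> \<le> 1" "\<bar>b 3 - b 4\<bar> \<le> 1" "\<bar>b 3 + b 4\<bar> \<le> 1"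
        using b by linarith+
      then have xe_le: "\<bar>x \<bullet> e i\<bar> \<le> 1 / sqrt 2" for i
        using exhaust_4[of i] by (elim disjE) (simp_all only: e bound)
      fix j
      from surjD[OF bij_is_surj[OF p], of j] obtain i where "j = p i" by blast
      with xe_le[of i] show "\<bar>x $ j\<bar> \<le> 1 / sqrt 2" unfolding xe by simp
    next
      have "(\<Sum>i\<in>UNIV. \<bar>x $ i\<bar>) = (\<Sum>i\<in>UNIV. \<bar>x \<bullet> e i\<bar>)"
        unfolding xe using sum.reindex_bij_betw[OF p, of "\<lambda>i. \<bar>x $ i\<bar>"] by simp
      also have "\<dots> = (\<bar>b 1 + b 2\<bar> + \<bar>b 1 - b 2\<bar> + \<bar>b 3 - b 4\<bar> + \<bar>b 3 + b 4\<bar>) / sqrt 2"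
        by (simp add: sum_4 e abs_divide flip: add_divide_distrib)
      also have "\<dots> \<le> 2 / sqrt 2"
      proof (intro divide_right_mono)
        have m: "\<bar>u + v\<bar> + \<bar>u - v\<bar> = 2 * max \<bar>u\<bar> \<bar>v\<bar>" for u v :: real
          by (simp add: max_def abs_if)
        have "max \<bar>b 1\<bar> \<bar>b 2\<bar> + max \<bar>b 3\<bar> \<bar>b 4\<bar> \<le> 1" using b by (simp add: max_def)
        then show "\<bar>b 1 + b 2\<bar> + \<bar>b 1 - b 2\<bar> + \<bar>b 3 - b 4\<bar> + \<bar>b 3 + b 4\<bar> \<le> 2"
          using m[of "b 1" "b 2"] m[of "b 3" "b 4"] by linarith
      qed simp
      also have "\<dots> = sqrt 2" by (simp add: real_div_sqrt)
      finally show "(\<Sum>i\<in>UNIV. \<bar>x $ i\<bar>) \<le> sqrt 2" .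
    qed
  qed
  show ?thesis unfolding vertex_frame_def using oa V P1 P2 by blast
qed

text \<open>
  The 24-cell looks the same from each of its vertices: signs and a permutation of the standard
  axes move the given vertex to the first vector of the rotated frame.
\<close>

lemma vertex_frame_exists:
  assumes "v \<in> vertices24"
  obtains a where "vertex_frame a" "a 1 = v"
proof -
  obtain i j s t where v: "v = (1 / sqrt 2) *\<^sub>R (s *\<^sub>R axis i 1 + t *\<^sub>R axis j 1)" and ij: "i \<noteq> j"
    and st: "s \<in> {-1, 1}" "t \<in> {-1, 1}" using assms unfolding vertices24_def by blast
  define p where "p = Transposition.transpose i 1 \<circ> Transposition.transpose (Transposition.transpose i 1 j) (2::4)"
  have "bij p" unfolding p_def by (intro bij_comp) auto
  moreover have "p 1 = i" "p 2 = j"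
    using ij by (auto simp: p_def Transposition.transpose_def)
  moreover define d where "d k = (if k = 1 then s else if k = 2 then t else 1)" for k :: 4
  moreover have "d k \<in> {-1, 1}" for k using st by (auto simp: d_def)
  ultimately have "vertex_frame (rotated_frame (\<lambda>k. d k *\<^sub>R axis (p k) 1))" "rotated_frame (\<lambda>k. d k *\<^sub>R axis (p k) 1) 1 = v"
    using vertex_frame_rotated[of p d] by (auto simp: rotated_frame_simps v)
  then show ?thesis by (rule that)
qed

definition large_frame :: "4 \<Rightarrow> real^4" where
  "large_frame k = (if k = 1 then A1 else if k = 2 then A2 else if k = 3 then A11 else A12)"

lemma large_frame_simps:
  "large_frame 1 = A1" "large_frame 2 = A2" "large_frame 3 = A11" "large_frame 4 = A12"
  by (simp_all add: large_frame_def)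

lemma vertex_frame_large: "vertex_frame large_frame"
proof -
  have "large_frame = rotated_frame (\<lambda>i. 1 *\<^sub>R axis (id i) 1)"
  proof
    fix k
    show "large_frame k = rotated_frame (\<lambda>i. 1 *\<^sub>R axis (id i) 1) k"
      using exhaust_4[of k]
      by (elim disjE) (simp_all add: large_frame_simps rotated_frame_simps A1_def A2_def A11_def A12_def
          vec_eq_iff forall_4 axis_def)
  qed
  then show ?thesis using vertex_frame_rotated[of id "\<lambda>_. 1"] by simp
qed

lemma large_centres_eq: "large_centres = {s *\<^sub>R large_frame i | i s. s \<in> {-1, 1}}"
proof -
  have "x \<in> {s *\<^sub>R large_frame i | i s. s \<in> {-1, 1}} \<longleftrightarrow> (\<exists>i. x = large_frame i \<or> x = - large_frame i)" for x
    by (auto; metis scaleR_one scaleR_minus1_left)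
  moreover have "(\<exists>i. P i) \<longleftrightarrow> P 1 \<or> P 2 \<or> P 3 \<or> P 4" for P :: "4 \<Rightarrow> bool"
    by (metis exhaust_4)
  ultimately show ?thesis
    unfolding large_centres_def set_eq_iff by (simp add: large_frame_simps) blast
qed

section \<open>Horoballs in the Klein model\<close>

lemma klein_ball_iff: "(x :: real^4) \<in> ball 0 1 \<longleftrightarrow> x \<bullet> x < 1"
  by (simp add: dot_square_norm power_less_one_iff abs_square_less_1)

lemma horoball_iff:
  assumes v: "norm v = 1" and c: "c > 0"
  shows "x \<in> horoball v c \<longleftrightarrow> x \<bullet> x < 1 \<and> (1 - x \<bullet> v)\<^sup>2 \<le> c\<^sup>2 * (1 - x \<bullet> x)"
proof (cases "x \<bullet> x < 1")
  case True
  define q where "q = sqrt (1 - x \<bullet> x)"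
  have q: "q > 0" "q\<^sup>2 = 1 - x \<bullet> x" using True by (auto simp: q_def)
  have "norm x < 1" using True by (simp add: norm_lt_square)
  then have "1 - x \<bullet> v \<ge> 0" using norm_cauchy_schwarz[of x v] v by simp
  moreover have "c * q \<ge> 0" using c q by simp
  ultimately have "1 - x \<bullet> v \<le> c * q \<longleftrightarrow> (1 - x \<bullet> v)\<^sup>2 \<le> (c * q)\<^sup>2"
    by (metis power2_le_iff_abs_le abs_of_nonneg)
  then show ?thesis
    unfolding horoball_def mem_Collect_eq klein_ball_iff exp_busemann_def q_def[symmetric]
    using True q by (simp add: pos_divide_le_eq power_mult_distrib)
qed (simp add: horoball_def klein_ball_iff del: mem_ball mem_ball_0)

text \<open>
  The defining inequality is \<open>g \<le> 0\<close> for the strictly convex quadratic \<open>g\<close>, so on a segment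
  centred at a boundary point \<open>g\<close> takes a positive value at one of the ends.
\<close>

lemma interior_horoball:
  assumes v: "norm v = 1" and c: "c > 0"
  shows "interior (horoball v c) = {x. x \<bullet> x < 1 \<and> (1 - x \<bullet> v)\<^sup>2 < c\<^sup>2 * (1 - x \<bullet> x)}" (is "_ = ?I")
proof
  have "open ({x. x \<bullet> x < 1} \<inter> {x. (1 - x \<bullet> v)\<^sup>2 < c\<^sup>2 * (1 - x \<bullet> x)})"
    by (intro open_Int open_Collect_less continuous_intros)
  then have "open ?I" unfolding Collect_conj_eq .
  moreover have "?I \<subseteq> horoball v c"
  proof
    fix x assume "x \<in> ?I"
    then show "x \<in> horoball v c" unfolding horoball_iff[OF v c] by simp
  qed
  ultimately show "?I \<subseteq> interior (horoball v c)" by (rule interior_maximal[rotated])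
  show "interior (horoball v c) \<subseteq> ?I"
  proof
    fix x assume x: "x \<in> interior (horoball v c)"
    then obtain e where e: "e > 0" "ball x e \<subseteq> horoball v c" by (meson mem_interior)
    define g where "g y = (1 - y \<bullet> v)\<^sup>2 - c\<^sup>2 * (1 - y \<bullet> y)" for y :: "real^4"
    have g: "g y \<le> 0" if "y \<in> ball x e" for y
      using e(2) that horoball_iff[OF v c] by (auto simp: g_def)
    define d where "d = (e / 2) *\<^sub>R v"
    have "x + d \<in> ball x e" "x - d \<in> ball x e" using e(1) v by (auto simp: d_def dist_norm)
    then have "g (x + d) + g (x - d) \<le> 0" using g by (meson add_nonpos_nonpos)
    moreover define T where "T = (d \<bullet> v)\<^sup>2 + c\<^sup>2 * (d \<bullet> d)"
    have "g (x + d) + g (x - d) = 2 * g x + 2 * T"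
      by (simp add: T_def g_def inner_add_left inner_add_right inner_diff_left inner_diff_right inner_commute power2_eq_square algebra_simps)
    moreover have "v \<bullet> v = 1" using v by (simp add: dot_square_norm)
    then have "d \<bullet> d > 0" using e(1) by (simp add: d_def)
    then have "T > 0" unfolding T_def using c by (intro add_nonneg_pos) auto
    ultimately have "g x < 0" by linarith
    moreover have "x \<in> horoball v c" using x interior_subset by blast
    ultimately show "x \<in> ?I" using horoball_iff[OF v c] by (auto simp: g_def)
  qed
qed

text \<open>
  In the hyperboloid model: the product of the Lorentz products of a point with two light-like
  vectors is at least half the absolute value of the product of these vectors.  Here it is Cauchy--Schwarz for \<open>x\<close> and
  \<open>b v + a w\<close>, where \<open>a = 1 - x \<bullet> v\<close> and \<open>b = 1 - x \<bullet> w\<close>.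
\<close>

lemma horoball_product_bound:
  fixes v w x :: "real^4"
  assumes v: "norm v = 1" and w: "norm w = 1" and x: "x \<bullet> x < 1"
  shows "(1 - v \<bullet> w) * (1 - x \<bullet> x) \<le> 2 * (1 - x \<bullet> v) * (1 - x \<bullet> w)"
proof -
  define a b r e where "a = 1 - x \<bullet> v" and "b = 1 - x \<bullet> w" and "r = x \<bullet> x" and "e = 1 - v \<bullet> w"
  have vv: "v \<bullet> v = 1" "w \<bullet> w = 1" using v w by (simp_all add: dot_square_norm)
  have "norm x < 1" using x by (simp add: norm_lt_square)
  then have ab: "a > 0" "b > 0"
    using norm_cauchy_schwarz[of x v] norm_cauchy_schwarz[of x w] v w by (auto simp: a_def b_def)
  have r: "0 \<le> r" "r < 1" using x by (auto simp: r_def)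
  define P S where "P = 2 * a * b" and "S = a + b"
  have "((b *\<^sub>R v + a *\<^sub>R w) \<bullet> x)\<^sup>2 \<le> ((b *\<^sub>R v + a *\<^sub>R w) \<bullet> (b *\<^sub>R v + a *\<^sub>R w)) * r"
    unfolding r_def by (rule Cauchy_Schwarz_ineq)
  moreover have "(b *\<^sub>R v + a *\<^sub>R w) \<bullet> x = S - P"
    by (simp add: inner_add_left inner_commute[of _ x] S_def P_def a_def b_def algebra_simps)
  moreover have "(b *\<^sub>R v + a *\<^sub>R w) \<bullet> (b *\<^sub>R v + a *\<^sub>R w) = S\<^sup>2 - P * e"
    by (simp add: inner_add_left inner_add_right vv inner_commute[of w v] S_def P_def e_def power2_eq_square algebra_simps)
  ultimately have cs: "(S - P)\<^sup>2 \<le> (S\<^sup>2 - P * e) * r" by simp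
  have P: "P > 0" using ab by (simp add: P_def)
  have e2: "e \<le> 2" using norm_cauchy_schwarz[of "- v" w] v w by (simp add: e_def)
  have "e * (1 - r) \<le> P"
  proof (cases "r = 0")
    case True
    then have "x = 0" by (simp add: r_def)
    then show ?thesis using e2 True by (simp add: P_def a_def b_def)
  next
    case False
    have id: "(1 - r) * ((S\<^sup>2 - P * e) * r - (S - P)\<^sup>2) = r * P * (P - (1 - r) * e) - ((1 - r) * S - P)\<^sup>2"
      by (simp add: power2_eq_square algebra_simps)
    have "0 \<le> (1 - r) * ((S\<^sup>2 - P * e) * r - (S - P)\<^sup>2)" using cs r by simp
    then have "0 \<le> r * P * (P - (1 - r) * e)" unfolding id using zero_le_power2[of "(1 - r) * S - P"] by linarith
    moreover have "r * P > 0" using False r P by simp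
    ultimately show ?thesis by (simp add: zero_le_mult_iff mult.commute)
  qed
  then show ?thesis by (simp add: P_def a_def b_def r_def e_def)
qed

text \<open>
  The point \<open>p\<close> lies on the geodesic from \<open>v\<close> to \<open>w\<close>, where the product of the two functions
  \<^const>\<open>exp_busemann\<close> attains its minimum \<open>K\<close>; the weights make their ratio \<open>c / d\<close>.
\<close>

lemma touching_point:
  assumes v: "norm v = 1" and w: "norm w = 1" and vw: "v \<bullet> w < 1" and c: "c > 0" and d: "d > 0"
  defines "p \<equiv> (1 / (c + d)) *\<^sub>R (d *\<^sub>R v + c *\<^sub>R w)" and "K \<equiv> (1 - v \<bullet> w) / 2"
  shows "p \<bullet> p < 1" "(1 - p \<bullet> v)\<^sup>2 = c * K / d * (1 - p \<bullet> p)" "(1 - p \<bullet> w)\<^sup>2 = d * K / c * (1 - p \<bullet> p)"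
proof -
  have vv: "v \<bullet> v = 1" "w \<bullet> w = 1" using v w by (simp_all add: dot_square_norm)
  have K: "v \<bullet> w = 1 - 2 * K" "K > 0" using vw by (simp_all add: K_def field_simps)
  have s: "c + d > 0" using c d by simp
  have pv: "1 - p \<bullet> v = 2 * c * K / (c + d)"
    using s by (simp add: p_def inner_add_left vv inner_commute[of w v] K(1) divide_simps) (simp add: algebra_simps)
  have pw: "1 - p \<bullet> w = 2 * d * K / (c + d)"
    using s by (simp add: p_def inner_add_left vv K(1) divide_simps) (simp add: algebra_simps)
  have "(d *\<^sub>R v + c *\<^sub>R w) \<bullet> (d *\<^sub>R v + c *\<^sub>R w) = (c + d)\<^sup>2 - 4 * c * d * K"
    by (simp add: inner_add_left inner_add_right vv inner_commute[of w v] K(1) power2_eq_square algebra_simps)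
  then have "p \<bullet> p = ((c + d)\<^sup>2 - 4 * c * d * K) / (c + d)\<^sup>2"
    unfolding p_def by (simp add: power2_eq_square)
  then have pp: "1 - p \<bullet> p = 4 * c * d * K / (c + d)\<^sup>2"
    using s by (simp add: diff_divide_distrib)
  have "1 - p \<bullet> p > 0" unfolding pp using c d K s by simp
  then show "p \<bullet> p < 1" by simp
  show "(1 - p \<bullet> v)\<^sup>2 = c * K / d * (1 - p \<bullet> p)" "(1 - p \<bullet> w)\<^sup>2 = d * K / c * (1 - p \<bullet> p)"
    unfolding pv pw pp using c d by (simp_all add: power_divide power_mult_distrib power2_eq_square)
qed

lemma horoballs_disjoint_iff:
  assumes v: "norm v = 1" and w: "norm w = 1" and vw: "v \<bullet> w < 1" and c: "c > 0" and d: "d > 0"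
  shows "interior (horoball v c) \<inter> interior (horoball w d) = {} \<longleftrightarrow> c * d \<le> (1 - v \<bullet> w) / 2"
proof
  assume le: "c * d \<le> (1 - v \<bullet> w) / 2"
  show "interior (horoball v c) \<inter> interior (horoball w d) = {}"
  proof (rule ccontr)
    assume "interior (horoball v c) \<inter> interior (horoball w d) \<noteq> {}"
    then obtain x where x: "x \<bullet> x < 1" "(1 - x \<bullet> v)\<^sup>2 < c\<^sup>2 * (1 - x \<bullet> x)" "(1 - x \<bullet> w)\<^sup>2 < d\<^sup>2 * (1 - x \<bullet> x)"
      unfolding interior_horoball[OF v c] interior_horoball[OF w d] by auto
    define q where "q = 1 - x \<bullet> x"
    have q: "q > 0" using x by (simp add: q_def)
    have bound: "(1 - v \<bullet> w) * q \<le> 2 * ((1 - x \<bullet> v) * (1 - x \<bullet> w))"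
      using horoball_product_bound[OF v w x(1)] by (simp only: q_def mult.assoc)
    have "((1 - x \<bullet> v) * (1 - x \<bullet> w))\<^sup>2 < (c\<^sup>2 * q) * (d\<^sup>2 * q)"
      unfolding power_mult_distrib using x q c
      by (intro mult_strict_mono') (auto simp: q_def)
    also have "\<dots> = (c * d * q)\<^sup>2" by (simp add: power2_eq_square algebra_simps)
    finally have "(1 - x \<bullet> v) * (1 - x \<bullet> w) < c * d * q"
      by (rule power_less_imp_less_base) (use c d q in simp)
    also have "\<dots> \<le> (1 - v \<bullet> w) / 2 * q" using le q by (intro mult_right_mono) auto
    finally show False using bound by simp
  qed
next
  assume disj: "interior (horoball v c) \<inter> interior (horoball w d) = {}"
  show "c * d \<le> (1 - v \<bullet> w) / 2"
  proof (rule ccontr)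
    define K where "K = (1 - v \<bullet> w) / 2"
    assume "\<not> c * d \<le> (1 - v \<bullet> w) / 2"
    then have K: "K < c * d" by (simp add: K_def)
    define p where "p = (1 / (c + d)) *\<^sub>R (d *\<^sub>R v + c *\<^sub>R w)"
    note p = touching_point[OF v w vw c d, folded p_def K_def]
    have "c * K / d < c\<^sup>2" "d * K / c < d\<^sup>2"
      using K c d by (simp_all add: divide_simps power2_eq_square mult_ac)
    then have "(1 - p \<bullet> v)\<^sup>2 < c\<^sup>2 * (1 - p \<bullet> p)" "(1 - p \<bullet> w)\<^sup>2 < d\<^sup>2 * (1 - p \<bullet> p)"
      unfolding p(2,3) using p(1) mult_strict_right_mono[of _ _ "1 - p \<bullet> p"] by (metis diff_gt_0_iff_gt)+
    then have "p \<in> interior (horoball v c) \<inter> interior (horoball w d)"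
      using p(1) unfolding interior_horoball[OF v c] interior_horoball[OF w d] by auto
    with disj show False by blast
  qed
qed

lemma horoballs_touch:
  assumes v: "norm v = 1" and w: "norm w = 1" and vw: "v \<bullet> w < 1" and c: "c > 0" and d: "d > 0"
    and eq: "c * d = (1 - v \<bullet> w) / 2"
  shows "touch_at (horoball v c) (horoball w d) ((1 / (c + d)) *\<^sub>R (d *\<^sub>R v + c *\<^sub>R w))"
proof -
  have "c * ((1 - v \<bullet> w) / 2) / d = c\<^sup>2" "d * ((1 - v \<bullet> w) / 2) / c = d\<^sup>2"
    unfolding eq[symmetric] using c d by (simp_all add: power2_eq_square)
  then show ?thesis
    using touching_point[OF v w vw c d] horoballs_disjoint_iff[OF v w vw c d] eq
    unfolding touch_at_def by (simp add: horoball_iff[OF v c] horoball_iff[OF w d])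
qed

lemma touch_at_imp_eq:
  assumes v: "norm v = 1" and w: "norm w = 1" and vw: "v \<bullet> w < 1" and c: "c > 0" and d: "d > 0"
    and t: "touch_at (horoball v c) (horoball w d) p"
  shows "c * d = (1 - v \<bullet> w) / 2"
proof (rule antisym)
  show "c * d \<le> (1 - v \<bullet> w) / 2"
    using t horoballs_disjoint_iff[OF v w vw c d] by (simp add: touch_at_def)
  have p: "p \<bullet> p < 1" "(1 - p \<bullet> v)\<^sup>2 \<le> c\<^sup>2 * (1 - p \<bullet> p)" "(1 - p \<bullet> w)\<^sup>2 \<le> d\<^sup>2 * (1 - p \<bullet> p)"
    using t horoball_iff[OF v c] horoball_iff[OF w d] by (auto simp: touch_at_def)
  define q where "q = 1 - p \<bullet> p"
  have q: "q > 0" using p by (simp add: q_def)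
  have "((1 - p \<bullet> v) * (1 - p \<bullet> w))\<^sup>2 \<le> (c\<^sup>2 * q) * (d\<^sup>2 * q)"
    unfolding power_mult_distrib using p q c by (intro mult_mono) (auto simp: q_def)
  also have "\<dots> = (c * d * q)\<^sup>2" by (simp add: power2_eq_square algebra_simps)
  finally have "(1 - p \<bullet> v) * (1 - p \<bullet> w) \<le> c * d * q"
    by (rule power2_le_imp_le) (use c d q in simp)
  moreover have "(1 - v \<bullet> w) * q \<le> 2 * ((1 - p \<bullet> v) * (1 - p \<bullet> w))"
    using horoball_product_bound[OF v w p(1)] by (simp only: q_def mult.assoc)
  ultimately have "(1 - v \<bullet> w) / 2 * q \<le> c * d * q" by simp
  then show "(1 - v \<bullet> w) / 2 \<le> c * d" using q by simp
qed

text \<open>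
  The normal \<open>n\<close> has length \<open>sqrt 2\<close>, so the hyperplane \<open>n \<bullet> x = 1\<close> has the unit space-like
  Lorentz normal \<open>(1, n)\<close>, whose product with \<open>(1, v)\<close> is \<open>-s\<close>.  The minimum of
  \<^const>\<open>exp_busemann\<close> on the hyperplane is \<open>s\<close>; it is found by Cauchy--Schwarz for the
  projection \<open>(1 + s, v + s n)\<close> of \<open>(1, v)\<close> to the hyperplane.
\<close>

lemma horoball_hyperplane_disjoint:
  fixes v n :: "real^4"
  assumes v: "norm v = 1" and n: "n \<bullet> n = 2" and vn: "v \<bullet> n \<le> 0" and c: "0 < c" "c \<le> 1"
  shows "interior (horoball v c) \<inter> {x. n \<bullet> x = 1} = {}"
proof (rule ccontr)
  assume "interior (horoball v c) \<inter> {x. n \<bullet> x = 1} \<noteq> {}"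
  then obtain x where x: "x \<bullet> x < 1" "(1 - x \<bullet> v)\<^sup>2 < c\<^sup>2 * (1 - x \<bullet> x)" and nx: "n \<bullet> x = 1"
    unfolding interior_horoball[OF v c(1)] by auto
  define s where "s = 1 - v \<bullet> n"
  define r q where "r = norm x" and "q = x \<bullet> v + s"
  have s: "s \<ge> 1" using vn by (simp add: s_def)
  have vv: "v \<bullet> v = 1" using v by (simp add: dot_square_norm)
  have r: "0 \<le> r" "r < 1" "x \<bullet> x = r\<^sup>2" using x(1) by (auto simp: r_def norm_lt_square dot_square_norm)
  have "((v + s *\<^sub>R n) \<bullet> x)\<^sup>2 \<le> ((v + s *\<^sub>R n) \<bullet> (v + s *\<^sub>R n)) * (x \<bullet> x)"
    by (rule Cauchy_Schwarz_ineq)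
  moreover have "(v + s *\<^sub>R n) \<bullet> x = q" using nx by (simp add: inner_add_left q_def inner_commute[of v x])
  moreover have "(v + s *\<^sub>R n) \<bullet> (v + s *\<^sub>R n) = 1 + 2 * s"
    using n by (simp add: inner_add_left inner_add_right vv inner_commute[of n v] s_def algebra_simps power2_eq_square)
  ultimately have q: "q\<^sup>2 \<le> (1 + 2 * s) * r\<^sup>2" using r by simp
  define \<rho> where "\<rho> = sqrt (1 + 2 * s)"
  have \<rho>: "\<rho>\<^sup>2 = 1 + 2 * s" "\<rho> \<ge> 0" using s by (auto simp: \<rho>_def)
  have "q\<^sup>2 \<le> (\<rho> * r)\<^sup>2" using q \<rho> by (simp add: power_mult_distrib)
  then have "q \<le> \<rho> * r" by (rule power2_le_imp_le) (use \<rho> r in simp)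
  moreover have "\<rho> \<le> 1 + s" by (rule power2_le_imp_le) (use \<rho> s in \<open>auto simp: power2_eq_square algebra_simps\<close>)
  then have "\<rho> * r \<le> (1 + s) * 1" using r s by (intro mult_mono) auto
  ultimately have "1 - x \<bullet> v \<ge> 1 + s - \<rho> * r" "1 + s - \<rho> * r \<ge> 0" by (auto simp: q_def)
  then have "(1 - x \<bullet> v)\<^sup>2 \<ge> (1 + s - \<rho> * r)\<^sup>2" by (rule power_mono)
  moreover have "(1 + s - \<rho> * r)\<^sup>2 = s\<^sup>2 * (1 - r\<^sup>2) + ((1 + s) * r - \<rho>)\<^sup>2 + (\<rho>\<^sup>2 - (1 + 2 * s)) * (r\<^sup>2 - 1)"
    by (simp add: power2_eq_square algebra_simps)
  then have "(1 + s - \<rho> * r)\<^sup>2 = s\<^sup>2 * (1 - r\<^sup>2) + ((1 + s) * r - \<rho>)\<^sup>2"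
    using \<rho>(1) by simp
  ultimately have "s\<^sup>2 * (1 - r\<^sup>2) \<le> (1 - x \<bullet> v)\<^sup>2" by (smt (verit) zero_le_power2)
  moreover have "c\<^sup>2 * (1 - r\<^sup>2) \<le> s\<^sup>2 * (1 - r\<^sup>2)"
    using r c s by (intro mult_right_mono power_mono) (auto simp: power_le_one)
  ultimately show False using x(2) r(3) by simp
qed

text \<open>
  The foot of the perpendicular from the ideal point \<open>v\<close> to the hyperplane is \<open>(v + n) / 2\<close>,
  and \<^const>\<open>exp_busemann\<close> equals 1 there.
\<close>

lemma horoball_hyperplane_meet:
  fixes v n :: "real^4"
  assumes v: "norm v = 1" and n: "n \<bullet> n = 2" and vn: "v \<bullet> n = 0" and c: "c > 1"
  shows "interior (horoball v c) \<inter> {x. n \<bullet> x = 1} \<noteq> {}"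
proof -
  have vv: "v \<bullet> v = 1" using v by (simp add: dot_square_norm)
  define x where "x = (1 / 2) *\<^sub>R (v + n)"
  have xx: "x \<bullet> x = 3 / 4" and xv: "x \<bullet> v = 1 / 2" and nx: "n \<bullet> x = 1"
    using n vn by (auto simp: x_def inner_add_left inner_add_right vv inner_commute[of n v])
  have "c\<^sup>2 > 1" using c by simp
  then have "x \<bullet> x < 1" "(1 - x \<bullet> v)\<^sup>2 < c\<^sup>2 * (1 - x \<bullet> x)" "n \<bullet> x = 1"
    unfolding xx xv nx by (simp_all add: power2_eq_square)
  then have "x \<in> interior (horoball v c) \<inter> {x. n \<bullet> x = 1}"
    using c interior_horoball[OF v, of c] by simp
  then show ?thesis by blast
qed

section \<open>Facets of the 24-cell\<close>

text \<open>
  The facet normals, scaled so that the facets are at level 1; they have length \<open>sqrt 2\<close>.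
\<close>

definition frame_normals :: "(4 \<Rightarrow> real^4) \<Rightarrow> (real^4) set" where
  "frame_normals a = {s *\<^sub>R a i + t *\<^sub>R a j | i j s t. i \<noteq> j \<and> s \<in> {-1, 1} \<and> t \<in> {-1, 1}}"

lemma frame_normalsI:
  "i \<noteq> j \<Longrightarrow> s \<in> {-1, 1} \<Longrightarrow> t \<in> {-1, 1} \<Longrightarrow> s *\<^sub>R a i + t *\<^sub>R a j \<in> frame_normals a"
  unfolding frame_normals_def by blast

lemma frame_normalsE:
  assumes "n \<in> frame_normals a" "orthonormal_frame a"
  obtains i j s t where "n = s *\<^sub>R a i + t *\<^sub>R a j" "i \<noteq> j" "s \<in> {-1, 1}" "t \<in> {-1, 1}"
    "n \<bullet> n = 2" "\<And>k. n \<bullet> a k = (if k = i then s else if k = j then t else 0)"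
proof -
  obtain i j s t where n: "n = s *\<^sub>R a i + t *\<^sub>R a j" "i \<noteq> j" "s \<in> {-1, 1}" "t \<in> {-1, 1}"
    using assms(1) unfolding frame_normals_def by blast
  have "n \<bullet> n = 2" "\<And>k. n \<bullet> a k = (if k = i then s else if k = j then t else 0)"
    using n(2-4) unfolding n(1)
    by (auto simp: inner_add_left inner_add_right orthonormal_frame_inner[OF assms(2)])
  then show ?thesis using that[OF n] by blast
qed

lemma frame_normals_inner_self: "n \<in> frame_normals a \<Longrightarrow> orthonormal_frame a \<Longrightarrow> n \<bullet> n = 2"
  by (rule frame_normalsE) assumption+

lemma frame_normals_inner_le:
  assumes a: "orthonormal_frame a" and n: "n \<in> frame_normals a" and m: "m \<in> frame_normals a" and "n \<noteq> m"
  shows "n \<bullet> m \<le> 1"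
proof -
  obtain i j s t where n': "n = s *\<^sub>R a i + t *\<^sub>R a j" "i \<noteq> j" "s \<in> {-1, 1}" "t \<in> {-1, 1}"
    "n \<bullet> n = 2" "\<And>k. n \<bullet> a k = (if k = i then s else if k = j then t else 0)"
    by (rule frame_normalsE[OF n a], rule that)
  obtain p q u v where m': "m = u *\<^sub>R a p + v *\<^sub>R a q" "p \<noteq> q" "u \<in> {-1, 1}" "v \<in> {-1, 1}"
    "m \<bullet> m = 2" "\<And>k. m \<bullet> a k = (if k = p then u else if k = q then v else 0)"
    by (rule frame_normalsE[OF m a], rule that)
  have "m \<bullet> a k \<in> {-1, 0, 1}" for k using m'(3,4) unfolding m'(6) by auto
  then have "m \<bullet> a i \<in> {-1, 0, 1}" "m \<bullet> a j \<in> {-1, 0, 1}" by blast+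
  then have "s * (m \<bullet> a i) \<in> {-1, 0, 1}" "t * (m \<bullet> a j) \<in> {-1, 0, 1}" using n'(3,4) by auto
  moreover have "n \<bullet> m = s * (m \<bullet> a i) + t * (m \<bullet> a j)"
    unfolding n'(1) by (simp add: inner_add_left inner_commute[of m])
  moreover have "n \<bullet> m \<noteq> 2"
  proof
    assume "n \<bullet> m = 2"
    then have "(n - m) \<bullet> (n - m) = 0"
      using n'(5) m'(5) by (simp add: inner_diff_left inner_diff_right inner_commute[of m n])
    with \<open>n \<noteq> m\<close> show False by simp
  qed
  ultimately show ?thesis by auto
qed

lemma frame_polytope_eq_halfspaces:
  "frame_polytope a = {x. \<forall>n\<in>frame_normals a. n \<bullet> x \<le> 1}"
proof (intro equalityI subsetI)
  fix x assume x: "x \<in> frame_polytope a"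
  show "x \<in> {x. \<forall>n\<in>frame_normals a. n \<bullet> x \<le> 1}"
  proof (clarify)
    fix n assume "n \<in> frame_normals a"
    then obtain i j s t where n: "n = s *\<^sub>R a i + t *\<^sub>R a j" "i \<noteq> j" "s \<in> {-1, 1}" "t \<in> {-1, 1}"
      unfolding frame_normals_def by blast
    have "\<bar>x \<bullet> a i\<bar> + \<bar>x \<bullet> a j\<bar> \<le> 1" using x n(2) by (simp add: frame_polytope_def)
    moreover have "s * (x \<bullet> a i) \<le> \<bar>x \<bullet> a i\<bar>" "t * (x \<bullet> a j) \<le> \<bar>x \<bullet> a j\<bar>" using n(3,4) by auto
    ultimately show "n \<bullet> x \<le> 1" by (simp add: n(1) inner_add_left inner_commute[of x])
  qed
next
  fix x assume "x \<in> {x. \<forall>n\<in>frame_normals a. n \<bullet> x \<le> 1}"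
  then have x: "n \<bullet> x \<le> 1" if "n \<in> frame_normals a" for n using that by blast
  show "x \<in> frame_polytope a"
    unfolding frame_polytope_def
  proof (clarify)
    fix i j :: 4 assume ij: "i \<noteq> j"
    define s where "s = (if x \<bullet> a i \<ge> 0 then 1 else - 1 :: real)"
    define t where "t = (if x \<bullet> a j \<ge> 0 then 1 else - 1 :: real)"
    have "s *\<^sub>R a i + t *\<^sub>R a j \<in> frame_normals a"
      using ij by (intro frame_normalsI) (auto simp: s_def t_def)
    from x[OF this] have "s * (x \<bullet> a i) + t * (x \<bullet> a j) \<le> 1"
      by (simp add: inner_add_left inner_commute[of x])
    then show "\<bar>x \<bullet> a i\<bar> + \<bar>x \<bullet> a j\<bar> \<le> 1" by (simp add: s_def t_def split: if_splits)
  qed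
qed

lemma finite_frame_normals: "finite (frame_normals a)"
proof -
  have "frame_normals a \<subseteq> (\<lambda>(i, j, s, t). s *\<^sub>R a i + t *\<^sub>R a j) ` (UNIV \<times> UNIV \<times> {-1,1} \<times> {-1,1})"
  proof
    fix x assume "x \<in> frame_normals a"
    then obtain i j s t where x: "x = s *\<^sub>R a i + t *\<^sub>R a j"
      and st: "s \<in> {-1, 1}" "t \<in> {-1, 1}" unfolding frame_normals_def by blast
    show "x \<in> (\<lambda>(i, j, s, t). s *\<^sub>R a i + t *\<^sub>R a j) ` (UNIV \<times> UNIV \<times> {-1,1} \<times> {-1,1})"
      by (rule image_eqI[where x = "(i, j, s, t)"]) (use x st in auto)
  qed
  then show ?thesis by (rule finite_subset) auto
qed

lemma affine_hull_P24: "affine hull P24 = UNIV"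
proof -
  have fr: "vertex_frame large_frame" by (rule vertex_frame_large)
  then have a: "orthonormal_frame large_frame" and P: "P24 = frame_polytope large_frame"
    by (auto simp: vertex_frame_def)
  have "ball 0 (1 / 2) \<subseteq> P24"
  proof
    fix x :: "real^4" assume "x \<in> ball 0 (1 / 2)"
    then have x: "norm x < 1 / 2" by simp
    have "\<bar>x \<bullet> large_frame i\<bar> \<le> 1 / 2" for i
    proof -
      have "norm (large_frame i) = 1"
        using orthonormal_frame_inner[OF a, of i i] by (simp add: norm_eq_sqrt_inner)
      then show ?thesis using Cauchy_Schwarz_ineq2[of x "large_frame i"] x by simp
    qed
    then show "x \<in> P24" unfolding P frame_polytope_def by (smt (verit) mem_Collect_eq field_sum_of_halves)
  qed
  then have "0 \<in> interior P24" using mem_interior[of 0 P24] by (meson half_gt_zero_iff zero_less_one)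
  then show ?thesis by (intro affine_hull_nonempty_interior) auto
qed

text \<open>
  No half-space is redundant: \<open>3/4 n\<close> violates the inequality of \<open>n\<close> and satisfies all
  others, because distinct normals have inner product at most 1.
\<close>

lemma facet_of_P24_iff:
  assumes fr: "vertex_frame a"
  shows "F facet_of P24 \<longleftrightarrow> (\<exists>n\<in>frame_normals a. F = P24 \<inter> {x. n \<bullet> x = 1})"
proof -
  have a: "orthonormal_frame a" and P: "P24 = frame_polytope a" using fr by (auto simp: vertex_frame_def)
  define H where "H n = {x :: real^4. n \<bullet> x \<le> 1}" for n
  have nn: "n \<bullet> n = 2" if "n \<in> frame_normals a" for n by (rule frame_normals_inner_self[OF that a])
  have viol: "(3 / 4) *\<^sub>R n \<in> H m \<longleftrightarrow> n \<noteq> m" if "n \<in> frame_normals a" "m \<in> frame_normals a" for n m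
    using frame_normals_inner_le[OF a that] nn[OF that(1)] by (auto simp: H_def inner_commute[of m n])
  have inj: "inj_on H (frame_normals a)"
    by (rule inj_onI) (metis viol)
  define g where "g = the_inv_into (frame_normals a) H"
  have g: "g (H n) = n" if "n \<in> frame_normals a" for n
    unfolding g_def by (rule the_inv_into_f_f[OF inj that])
  have PH: "P24 = \<Inter>(H ` frame_normals a)"
    unfolding P frame_polytope_eq_halfspaces H_def by auto
  have "F facet_of P24 \<longleftrightarrow> (\<exists>h. h \<in> H ` frame_normals a \<and> F = P24 \<inter> {x. g h \<bullet> x = 1})"
  proof (rule facet_of_polyhedron_explicit)
    show "finite (H ` frame_normals a)" using finite_frame_normals by simp
    show "P24 = affine hull P24 \<inter> \<Inter>(H ` frame_normals a)" using affine_hull_P24 PH by simp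
    fix h assume "h \<in> H ` frame_normals a"
    then obtain n where n: "n \<in> frame_normals a" "h = H n" by blast
    then show "g h \<noteq> 0 \<and> h = {x. g h \<bullet> x \<le> 1}" using g[OF n(1)] nn[OF n(1)] by (auto simp: H_def)
  next
    fix F' assume F': "F' \<subset> H ` frame_normals a"
    then obtain n where n: "n \<in> frame_normals a" "H n \<notin> F'" by blast
    have "(3 / 4) *\<^sub>R n \<in> \<Inter>F'"
    proof
      fix h assume "h \<in> F'"
      then obtain m where m: "m \<in> frame_normals a" "h = H m" "n \<noteq> m" using F' n(2) by blast
      then show "(3 / 4) *\<^sub>R n \<in> h" using viol[OF n(1) m(1)] by blast
    qed
    moreover have "(3 / 4) *\<^sub>R n \<notin> P24" using viol[OF n(1) n(1)] n(1) PH by blast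
    moreover have "P24 \<subseteq> \<Inter>F'" unfolding PH using F' by (intro Inter_anti_mono) blast
    ultimately show "P24 \<subset> affine hull P24 \<inter> \<Inter>F'" using affine_hull_P24 by blast
  qed
  also have "\<dots> \<longleftrightarrow> (\<exists>n\<in>frame_normals a. F = P24 \<inter> {x. n \<bullet> x = 1})"
    using g by auto
  finally show ?thesis .
qed

lemma affine_hull_facet_of_P24:
  assumes F: "F facet_of P24" and n: "n \<bullet> n = 2" and sub: "F \<subseteq> {x. n \<bullet> x = 1}"
  shows "affine hull F = {x. n \<bullet> x = 1}"
proof (rule ccontr)
  let ?H = "{x. n \<bullet> x = 1}"
  have H: "affine ?H" by (rule affine_hyperplane)
  assume "affine hull F \<noteq> ?H"
  moreover have "affine hull F \<subseteq> ?H" using sub H by (rule hull_minimal)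
  ultimately have "affine hull F \<subset> affine hull ?H" using H by (metis affine_hull_eq psubsetI)
  then have "aff_dim F < aff_dim ?H" by (rule aff_dim_psubset)
  also have "n \<noteq> 0" using n by auto
  then have "aff_dim ?H = 3" by simp
  also have "aff_dim F = aff_dim P24 - 1" using F by (simp add: facet_of_def)
  also have "aff_dim P24 = 4" using affine_hull_P24 using aff_dim_affine_hull[of P24] by simp
  finally show False by simp
qed

section \<open>Inequalities for the weights on an octahedron\<close>

text \<open>
  The bound \<open>2 x + 4 / x\<close> is convex in \<open>x\<close>; it equals \<open>6 < 5 sqrt 2\<close> at the lower end and
  \<open>5 sqrt 2\<close> at the upper end.
\<close>

lemma octahedron_bound_aux:
  fixes x x' :: real
  assumes x: "1 \<le> x" "x \<le> 2 * sqrt 2" "x' \<le> x" and y: "y1 * x \<le> 1" "y2 * x \<le> 1" "y3 * x \<le> 1" "y4 * x \<le> 1"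
  shows "x + x' + y1 + y2 + y3 + y4 \<le> 5 * sqrt 2"
proof -
  have "y1 \<le> 1 / x" "y2 \<le> 1 / x" "y3 \<le> 1 / x" "y4 \<le> 1 / x"
    using y x(1) by (simp_all add: pos_le_divide_eq)
  then have "x + x' + y1 + y2 + y3 + y4 \<le> 2 * x + 4 * (1 / x)" using x(3) by linarith
  also have "\<dots> \<le> 5 * sqrt 2"
  proof -
    have s: "sqrt 2 * sqrt 2 = 2" "sqrt 2 \<ge> 1" by simp_all
    have "(2 * sqrt 2 - x) * (2 * x - sqrt 2) \<ge> 0"
    proof (intro mult_nonneg_nonneg)
      have "sqrt 2 \<le> 2" using sqrt2_less_2 by simp
      then show "0 \<le> 2 * x - sqrt 2" using x by simp
    qed (use x in simp)
    then have "2 * x * x + 4 \<le> 5 * sqrt 2 * x" using s(1) by (simp add: algebra_simps)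
    then show ?thesis using x(1) by (simp add: field_simps)
  qed
  finally show ?thesis .
qed

text \<open>
  The weights \<open>a, a'\<close>, \<open>b, b'\<close> and \<open>c, c'\<close> belong to opposite vertices of an octahedron.
  Unless all weights are at most 1, the largest one bounds its four neighbours by its
  reciprocal.
\<close>

lemma octahedron_bound:
  fixes a a' b b' c c' :: real
  assumes le: "a \<le> 2 * sqrt 2" "a' \<le> 2 * sqrt 2" "b \<le> 2 * sqrt 2" "b' \<le> 2 * sqrt 2" "c \<le> 2 * sqrt 2" "c' \<le> 2 * sqrt 2"
    and ab: "a * b \<le> 1" "a * b' \<le> 1" "a' * b \<le> 1" "a' * b' \<le> 1"
    and bc: "b * c \<le> 1" "b * c' \<le> 1" "b' * c \<le> 1" "b' * c' \<le> 1"
    and ca: "a * c \<le> 1" "a * c' \<le> 1" "a' * c \<le> 1" "a' * c' \<le> 1"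
  shows "a + a' + b + b' + c + c' \<le> 5 * sqrt 2"
proof -
  have s: "7 / 5 \<le> sqrt 2" by (rule real_le_rsqrt) (simp add: power2_eq_square)
  consider "a \<le> 1" "a' \<le> 1" "b \<le> 1" "b' \<le> 1" "c \<le> 1" "c' \<le> 1"
    | "1 \<le> a" "a' \<le> a" | "1 \<le> a'" "a \<le> a'" | "1 \<le> b" "b' \<le> b" | "1 \<le> b'" "b \<le> b'" | "1 \<le> c" "c' \<le> c" | "1 \<le> c'" "c \<le> c'"
    by linarith
  then show ?thesis
  proof cases
    case 1 then show ?thesis using s by linarith
  next
    case 2 then show ?thesis using octahedron_bound_aux[of a a' b b' c c'] le ab bc ca by (simp add: mult.commute)
  next
    case 3 then show ?thesis using octahedron_bound_aux[of a' a b b' c c'] le ab bc ca by (simp add: mult.commute)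
  next
    case 4 then show ?thesis using octahedron_bound_aux[of b b' a a' c c'] le ab bc ca by (simp add: mult.commute)
  next
    case 5 then show ?thesis using octahedron_bound_aux[of b' b a a' c c'] le ab bc ca by (simp add: mult.commute)
  next
    case 6 then show ?thesis using octahedron_bound_aux[of c c' a a' b b'] le ab bc ca by (simp add: mult.commute)
  next
    case 7 then show ?thesis using octahedron_bound_aux[of c' c a a' b b'] le ab bc ca by (simp add: mult.commute)
  qed
qed

text \<open>
  Bounds the weights on a facet through \<open>-u\<close>, where \<open>u\<close> has the largest weight \<open>m\<close>: \<open>n\<close> is
  the weight of \<open>-u\<close>, \<open>f\<close> that of the vertex of the facet opposite to \<open>-u\<close>, and the \<open>p\<close> go
  around the remaining square.  With the coefficients \<open>1\<close>, \<open>6\<close>, \<open>2\<close> the sum over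
  the six facets through \<open>-u\<close> counts every vertex six times, since \<open>-u\<close> lies on all of them, the
  vertex of \<open>f\<close> on one and each vertex of the square on three.  Equality holds for
  \<open>m = n = f = 2 sqrt 2\<close> and \<open>p = sqrt 2 / 4\<close>.  The condition \<open>p * p \<le> 27\<close> stems from \<open>p \<le> m\<close>
  and \<open>m p \<le> 27\<close>.
\<close>

lemma opposite_octahedron_bound:
  fixes m n f p1 p2 p3 p4 :: real
  assumes m: "2 * sqrt 2 \<le> m" "m \<le> 8" and n: "0 \<le> n" "n \<le> m" and f: "0 \<le> f" "m * f \<le> 8"
    and p0: "0 \<le> p1" "0 \<le> p2" "0 \<le> p3" "0 \<le> p4"
    and p27: "p1 * p1 \<le> 27" "p2 * p2 \<le> 27" "p3 * p3 \<le> 27" "p4 * p4 \<le> 27"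
    and opp: "p1 * p3 \<le> 8" "p2 * p4 \<le> 8"
    and adj: "p1 * p2 \<le> 1" "p2 * p3 \<le> 1" "p3 * p4 \<le> 1" "p4 * p1 \<le> 1"
    and pf: "f * p1 \<le> 1" "f * p2 \<le> 1" "f * p3 \<le> 1" "f * p4 \<le> 1"
    and pn: "n * p1 \<le> 1" "n * p2 \<le> 1" "n * p3 \<le> 1" "n * p4 \<le> 1"
  shows "n + 6 * f + 2 * (p1 + p2 + p3 + p4) \<le> 20 * sqrt 2 - m - 8 / m"
proof -
  have s: "sqrt 2 * sqrt 2 = 2" by simp
  have s14: "707 / 500 \<le> sqrt 2" by (rule real_le_rsqrt) (simp add: power2_eq_square)
  have s15: "sqrt 2 \<le> 283 / 200" by (rule real_le_lsqrt) (simp_all add: power2_eq_square)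
  have m0: "m > 2" using m s14 by linarith
  have large: "482 / 25 \<le> 20 * sqrt 2 - m - 8 / m"
  proof -
    have "(8 - m) * (m - 1) \<ge> 0" using m m0 by simp
    then have "m * m + 8 \<le> 9 * m" by (simp add: algebra_simps)
    then have "m + 8 / m \<le> 9" using m0 by (simp add: field_simps)
    then show ?thesis using s14 by linarith
  qed
  \<comment> \<open>\<open>2 sqrt 2\<close> and \<open>8 sqrt 2\<close> are the values of \<open>m\<close> for which equality holds\<close>
  have key: "m + 56 / m \<le> 20 * sqrt 2 - m - 8 / m"
  proof -
    have "(m - 2 * sqrt 2) * (8 * sqrt 2 - m) \<ge> 0"
      using m s14 by (intro mult_nonneg_nonneg) auto
    moreover have "(m - 2 * sqrt 2) * (8 * sqrt 2 - m) = 10 * sqrt 2 * m - m * m - 16 * (sqrt 2 * sqrt 2)"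
      by (simp add: algebra_simps)
    ultimately have "m * m + 32 \<le> 10 * sqrt 2 * m" using s by simp
    then have "2 * m + 64 / m \<le> 20 * sqrt 2" using m0 by (simp add: field_simps)
    then show ?thesis by (simp add: field_simps)
  qed
  \<comment> \<open>the largest weight on the facet is that of a vertex of the square\<close>
  have vertex: "n + 6 * f + 2 * (x + y + x' + y') \<le> 20 * sqrt 2 - m - 8 / m"
    if x: "1 \<le> x" "x * x \<le> 27" "x' \<le> x" "x * x' \<le> 8" "x * y \<le> 1" "x * y' \<le> 1" "f * x \<le> 1" "n * x \<le> 1" for x x' y y'
  proof -
    define u where "u = 1 / x"
    have "y \<le> u" "y' \<le> u" "f \<le> u" "n \<le> u"
      using x by (simp_all add: u_def pos_le_divide_eq mult.commute)
    then have bound: "n + 6 * f + 2 * (x + y + x' + y') \<le> 2 * (x + x') + 11 * u" by simp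
    have x52: "x \<le> 26 / 5"
    proof (rule ccontr)
      assume "\<not> x \<le> 26 / 5"
      then have "(26 / 5) * (26 / 5) < x * x" by (intro mult_strict_mono) auto
      with x(2) show False by simp
    qed
    have inv: "u \<le> 1 / k" if "k \<le> x" "k > 0" for k using that x by (simp add: u_def frac_le)
    have x'8: "x' \<le> 8 * u" using x by (simp add: u_def pos_le_divide_eq mult.commute)
    \<comment> \<open>the bound is far from sharp here, so a crude estimate of \<open>1 / x\<close> on each piece suffices\<close>
    consider "x \<le> 2" | "2 \<le> x" "x \<le> 283 / 100" | "283 / 100 \<le> x" "x \<le> 4" | "4 \<le> x" by linarith
    then show ?thesis
    proof cases
      case 1
      then show ?thesis using bound inv[of 1] x large by simp
    next
      case 2
      then show ?thesis using bound inv[of 2] x large by simp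
    next
      case 3
      have "u \<le> 177 / 500" using 3 by (simp add: u_def field_simps)
      then show ?thesis using 3 bound x'8 large by simp
    next
      case 4
      then show ?thesis using bound inv[of 4] x'8 x52 large by simp
    qed
  qed
  \<comment> \<open>a convex function of \<open>x\<close>, with the value 15 at \<open>x = 1\<close> and \<open>m + 56 / m\<close> at \<open>x = 8 / m\<close>\<close>
  have small: "7 * x + 8 / x \<le> 20 * sqrt 2 - m - 8 / m" if x: "1 \<le> x" "m * x \<le> 8" for x
  proof -
    have xD: "x \<le> 8 / m" using x m0 by (simp add: pos_le_divide_eq mult.commute)
    have "7 * x + 8 / x \<le> 15 \<or> 7 * x + 8 / x \<le> m + 56 / m"
    proof (cases "7 * x \<le> 8")
      case True
      have "(x - 1) * (8 - 7 * x) \<ge> 0" using True x by simp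
      then have "7 * (x * x) + 8 \<le> 15 * x" by (simp add: algebra_simps)
      then show ?thesis using x by (simp add: field_simps)
    next
      case False
      then have "(8 - m * x) * (7 * x - m) \<ge> 0" using x m by (intro mult_nonneg_nonneg) auto
      then have "m * (7 * (x * x) + 8) \<le> x * (m * m + 56)" by (simp add: algebra_simps)
      then have "7 * x + 8 / x \<le> m + 56 / m" using x m0 by (simp add: field_simps)
      then show ?thesis ..
    qed
    then show ?thesis using large key by linarith
  qed
  consider "p1 \<le> 1" "p2 \<le> 1" "p3 \<le> 1" "p4 \<le> 1" "n \<le> 1" "f \<le> 1"
    | "1 \<le> p1" "p3 \<le> p1" | "1 \<le> p3" "p1 \<le> p3" | "1 \<le> p2" "p4 \<le> p2" | "1 \<le> p4" "p2 \<le> p4"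
    | "1 \<le> f" "n \<le> f" | "1 \<le> n" "f \<le> n" by linarith
  then show ?thesis
  proof cases
    case 1 then show ?thesis using large by simp
  next
    case 2 then show ?thesis using vertex[of p1 p3 p2 p4] p27 opp adj pf pn by (simp add: mult.commute)
  next
    case 3 then show ?thesis using vertex[of p3 p1 p2 p4] p27 opp adj pf pn by (simp add: mult.commute)
  next
    case 4 then show ?thesis using vertex[of p2 p4 p1 p3] p27 opp adj pf pn by (simp add: mult.commute)
  next
    case 5 then show ?thesis using vertex[of p4 p2 p1 p3] p27 opp adj pf pn by (simp add: mult.commute)
  next
    case 6
    then have "p1 \<le> 1 / f" "p2 \<le> 1 / f" "p3 \<le> 1 / f" "p4 \<le> 1 / f"
      using pf by (simp_all add: pos_le_divide_eq mult.commute)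
    then have "n + 6 * f + 2 * (p1 + p2 + p3 + p4) \<le> 7 * f + 8 / f" using 6 by simp
    then show ?thesis using small[of f] 6 f by simp
  next
    case 7
    then have "p1 \<le> 1 / n" "p2 \<le> 1 / n" "p3 \<le> 1 / n" "p4 \<le> 1 / n"
      using pn by (simp_all add: pos_le_divide_eq mult.commute)
    then have b: "n + 6 * f + 2 * (p1 + p2 + p3 + p4) \<le> n + 6 * f + 8 / n" by simp
    show ?thesis
    proof (cases "m * n \<le> 8")
      case True
      then show ?thesis using small[of n] b 7 by simp
    next
      case False
      have "(m - n) * (m * n - 8) \<ge> 0" using n False by (intro mult_nonneg_nonneg) auto
      then have "m * (n * n + 8) \<le> n * (m * m + 8)" by (simp add: algebra_simps)
      then have "n + 8 / n \<le> m + 8 / m" using m0 7 by (simp add: field_simps)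
      moreover have "6 * f \<le> 48 / m" using f m0 by (simp add: field_simps)
      ultimately have "n + 6 * f + 8 / n \<le> m + 56 / m" by (simp add: add_divide_distrib[symmetric] field_simps)
      then show ?thesis using b key by linarith
    qed
  qed
qed

section \<open>The sum of the weights of all vertices\<close>

text \<open>
  Signs are indexed by Booleans, so that a sum over all choices of signs is a sum over a finite
  type.
\<close>

definition pm_one :: "bool \<Rightarrow> real" where "pm_one b = (if b then 1 else - 1)"

lemma pm_one_simps [simp]: "pm_one True = 1" "pm_one False = - 1" "pm_one b * pm_one b = 1" "pm_one (\<not> b) = - pm_one b"
  "pm_one b \<in> {-1, 1}" "pm_one b = pm_one c \<longleftrightarrow> b = c"
  by (auto simp: pm_one_def)

definition axis_vertex :: "(4 \<Rightarrow> real^4) \<Rightarrow> 4 \<Rightarrow> bool \<Rightarrow> real^4" where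
  "axis_vertex a i s = pm_one s *\<^sub>R a i"

definition cube_vertex :: "(4 \<Rightarrow> real^4) \<Rightarrow> bool \<Rightarrow> bool \<Rightarrow> bool \<Rightarrow> bool \<Rightarrow> real^4" where
  "cube_vertex a b c d e = (1 / 2) *\<^sub>R (pm_one b *\<^sub>R a 1 + pm_one c *\<^sub>R a 2 + pm_one d *\<^sub>R a 3 + pm_one e *\<^sub>R a 4)"

lemma frame_vertices_eq_range:
  "frame_vertices a = range (\<lambda>(i, s). axis_vertex a i s) \<union> range (\<lambda>(b, c, d, e). cube_vertex a b c d e)"
proof (intro equalityI subsetI)
  fix x assume "x \<in> frame_vertices a"
  then consider k s where "s \<in> {-1, 1}" "x = s *\<^sub>R a k"
    | s where "\<forall>i. s i \<in> {-1, 1::real}" "x = (1 / 2) *\<^sub>R (\<Sum>i\<in>UNIV. s i *\<^sub>R a i)"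
    unfolding frame_vertices_def by blast
  then show "x \<in> range (\<lambda>(i, s). axis_vertex a i s) \<union> range (\<lambda>(b, c, d, e). cube_vertex a b c d e)"
  proof cases
    case 1
    then have "pm_one (s = 1) = s" by (auto simp: pm_one_def)
    then have "x = axis_vertex a k (s = 1)" by (simp only: axis_vertex_def 1(2))
    then show ?thesis by (intro UnI1 range_eqI[of _ _ "(k, s = 1)"]) simp
  next
    case 2
    have s: "pm_one (s i = 1) = s i" for i using spec[OF 2(1), of i] by (auto simp: pm_one_def)
    have "x = cube_vertex a (s 1 = 1) (s 2 = 1) (s 3 = 1) (s 4 = 1)"
      by (simp only: cube_vertex_def s 2(2) sum_4)
    then show ?thesis by (intro UnI2 range_eqI[of _ _ "(s 1 = 1, s 2 = 1, s 3 = 1, s 4 = 1)"]) simp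
  qed
next
  fix x assume "x \<in> range (\<lambda>(i, s). axis_vertex a i s) \<union> range (\<lambda>(b, c, d, e). cube_vertex a b c d e)"
  then consider k s where "x = axis_vertex a k s" | b c d e where "x = cube_vertex a b c d e" by auto
  then show "x \<in> frame_vertices a"
  proof cases
    case 1
    have "pm_one s \<in> {-1, 1}" by (simp add: pm_one_def)
    then show ?thesis unfolding 1 axis_vertex_def frame_vertices_def by blast
  next
    case 2
    let ?s = "\<lambda>i::4. if i = 1 then pm_one b else if i = 2 then pm_one c else if i = 3 then pm_one d else pm_one e"
    have "x = (1 / 2) *\<^sub>R (\<Sum>i\<in>UNIV. ?s i *\<^sub>R a i)" by (simp add: 2 cube_vertex_def sum_4)
    moreover have "\<forall>i. ?s i \<in> {-1, 1}" by (simp add: pm_one_def)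
    ultimately show ?thesis unfolding frame_vertices_def by (intro UnI2 CollectI exI[of _ ?s] conjI)
  qed
qed

lemma vertex_inner:
  assumes "orthonormal_frame a"
  shows "axis_vertex a i s \<bullet> axis_vertex a j t = (if i = j then pm_one s * pm_one t else 0)"
    "axis_vertex a 1 s \<bullet> cube_vertex a b c d e = pm_one s * pm_one b / 2"
    "axis_vertex a 2 s \<bullet> cube_vertex a b c d e = pm_one s * pm_one c / 2"
    "axis_vertex a 3 s \<bullet> cube_vertex a b c d e = pm_one s * pm_one d / 2"
    "axis_vertex a 4 s \<bullet> cube_vertex a b c d e = pm_one s * pm_one e / 2"
    "cube_vertex a b c d e \<bullet> cube_vertex a b' c' d' e'
      = (pm_one b * pm_one b' + pm_one c * pm_one c' + pm_one d * pm_one d' + pm_one e * pm_one e') / 4"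
  by (simp_all add: axis_vertex_def cube_vertex_def inner_add_left inner_add_right orthonormal_frame_inner[OF assms])

lemma cube_vertex_inner_frame:
  assumes "orthonormal_frame a"
  shows "cube_vertex a b c d e \<bullet> a 1 = pm_one b / 2" "cube_vertex a b c d e \<bullet> a 2 = pm_one c / 2"
    "cube_vertex a b c d e \<bullet> a 3 = pm_one d / 2" "cube_vertex a b c d e \<bullet> a 4 = pm_one e / 2"
  by (simp_all add: cube_vertex_def inner_add_left orthonormal_frame_inner[OF assms])

lemma sum_frame_vertices:
  fixes z :: "real^4 \<Rightarrow> real"
  assumes a: "orthonormal_frame a"
  shows "(\<Sum>v\<in>frame_vertices a. z v) = (\<Sum>i\<in>UNIV. \<Sum>s\<in>UNIV. z (axis_vertex a i s))
    + (\<Sum>b\<in>UNIV. \<Sum>c\<in>UNIV. \<Sum>d\<in>UNIV. \<Sum>e\<in>UNIV. z (cube_vertex a b c d e))"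
proof -
  let ?G = "\<lambda>(i, s). axis_vertex a i s" and ?H = "\<lambda>(b, c, d, e). cube_vertex a b c d e"
  have G: "axis_vertex a i s \<bullet> a k = (if i = k then pm_one s else 0)" for i s k
    by (simp add: axis_vertex_def orthonormal_frame_inner[OF a])
  have injG: "inj ?G"
  proof (rule injI)
    fix p q assume eq: "?G p = ?G q"
    obtain i s j t where pq: "p = (i, s)" "q = (j, t)" by (cases p, cases q) auto
    have "axis_vertex a i s \<bullet> a i = axis_vertex a j t \<bullet> a i" using eq by (simp add: pq)
    then show "p = q" unfolding G pq by (auto simp: pm_one_def split: if_splits)
  qed
  have injH: "inj ?H"
  proof (rule injI)
    fix p q assume eq: "?H p = ?H q"
    obtain b c d e b' c' d' e' where pq: "p = (b, c, d, e)" "q = (b', c', d', e')" by (cases p, cases q) auto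
    have "cube_vertex a b c d e = cube_vertex a b' c' d' e'" using eq by (simp add: pq)
    then show "p = q"
      using cube_vertex_inner_frame[OF a, of b c d e] cube_vertex_inner_frame[OF a, of b' c' d' e'] by (simp add: pq)
  qed
  have disj: "range ?G \<inter> range ?H = {}"
  proof -
    have "axis_vertex a i s \<noteq> cube_vertex a b c d e" for i s b c d e
    proof
      assume eq: "axis_vertex a i s = cube_vertex a b c d e"
      have "axis_vertex a i s \<bullet> a 1 \<in> {-1, 0, 1}" by (simp add: G pm_one_def)
      moreover have "cube_vertex a b c d e \<bullet> a 1 \<in> {1 / 2, - 1 / 2}" by (simp add: cube_vertex_inner_frame[OF a] pm_one_def)
      ultimately show False unfolding eq by auto
    qed
    then show ?thesis by auto
  qed
  have "(\<Sum>v\<in>frame_vertices a. z v) = (\<Sum>v\<in>range ?G. z v) + (\<Sum>v\<in>range ?H. z v)"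
    unfolding frame_vertices_eq_range by (intro sum.union_disjoint disj) auto
  also have "(\<Sum>v\<in>range ?G. z v) = (\<Sum>i\<in>UNIV. \<Sum>s\<in>UNIV. z (axis_vertex a i s))"
    unfolding sum.reindex[OF injG] by (simp only: sum.cartesian_product UNIV_Times_UNIV) (auto intro!: sum.cong)
  also have "(\<Sum>v\<in>range ?H. z v) = (\<Sum>b\<in>UNIV. \<Sum>c\<in>UNIV. \<Sum>d\<in>UNIV. \<Sum>e\<in>UNIV. z (cube_vertex a b c d e))"
    unfolding sum.reindex[OF injH] by (simp only: sum.cartesian_product UNIV_Times_UNIV) (auto intro!: sum.cong)
  finally show ?thesis .
qed

text \<open>
  The frame is chosen so that \<open>a 1\<close> is a vertex of largest weight.  The facets are indexed by
  two frame vectors with signs \<open>s, t\<close>; their vertices are these two vectors and the four cube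
  vertices that have the signs \<open>s, t\<close> in these two places.
\<close>

lemma vertex_weights_bound:
  fixes z :: "real^4 \<Rightarrow> real"
  assumes z0: "\<And>v. v \<in> vertices24 \<Longrightarrow> 0 \<le> z v" and z8: "\<And>v. v \<in> vertices24 \<Longrightarrow> z v \<le> 8"
    and edge: "\<And>v w. v \<in> vertices24 \<Longrightarrow> w \<in> vertices24 \<Longrightarrow> v \<bullet> w = 1 / 2 \<Longrightarrow> z v * z w \<le> 1"
    and diag: "\<And>v w. v \<in> vertices24 \<Longrightarrow> w \<in> vertices24 \<Longrightarrow> v \<bullet> w = 0 \<Longrightarrow> z v * z w \<le> 8"
    and far: "\<And>v w. v \<in> vertices24 \<Longrightarrow> w \<in> vertices24 \<Longrightarrow> v \<bullet> w = - 1 / 2 \<Longrightarrow> z v * z w \<le> 27"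
  shows "(\<Sum>v\<in>vertices24. z v) \<le> 20 * sqrt 2"
proof -
  have ne: "vertices24 \<noteq> {}" using large_centres_subset by (auto simp: large_centres_def)
  obtain u where u: "u \<in> vertices24" "\<And>v. v \<in> vertices24 \<Longrightarrow> z v \<le> z u"
    by (rule finite_max_arg[OF finite_vertices24 ne, where f = z], rule that)
  obtain a where fr: "vertex_frame a" and a1: "a 1 = u" by (rule vertex_frame_exists[OF u(1)])
  have a: "orthonormal_frame a" and V: "vertices24 = frame_vertices a" using fr by (auto simp: vertex_frame_def)
  define g where "g i s = z (axis_vertex a i s)" for i s
  define h where "h b c d e = z (cube_vertex a b c d e)" for b c d e
  have GV: "axis_vertex a i s \<in> vertices24" for i s
    unfolding V frame_vertices_eq_range by (rule UnI1, rule range_eqI[of _ _ "(i, s)"]) simp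
  have HV: "cube_vertex a b c d e \<in> vertices24" for b c d e
    unfolding V frame_vertices_eq_range by (rule UnI2, rule range_eqI[of _ _ "(b, c, d, e)"]) simp
  have gh: "g 1 s * h s c d e \<le> 1" "g 2 s * h b s d e \<le> 1" "g 3 s * h b c s e \<le> 1" "g 4 s * h b c d s \<le> 1" for s b c d e
    unfolding g_def h_def by (intro edge GV HV; simp add: vertex_inner[OF a])+
  have hh: "h b c d e * h (\<not> b) c d e \<le> 1" "h b c d e * h b (\<not> c) d e \<le> 1"
    "h b c d e * h b c (\<not> d) e \<le> 1" "h b c d e * h b c d (\<not> e) \<le> 1" for b c d e
    unfolding h_def by (intro edge HV; simp add: vertex_inner[OF a])+
  have hh8: "h b c d e * h b (\<not> c) (\<not> d) e \<le> 8" "h b c d e * h b (\<not> c) d (\<not> e) \<le> 8" "h b c d e * h b c (\<not> d) (\<not> e) \<le> 8" for b c d e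
    unfolding h_def by (intro diag HV; simp add: vertex_inner[OF a])+
  have g8: "g 1 True * g i s \<le> 8" if "i \<noteq> 1" for i s
    unfolding g_def using that by (intro diag GV) (simp add: vertex_inner[OF a])
  have h27: "g 1 True * h False c d e \<le> 27" for c d e
    unfolding g_def h_def by (intro far GV HV) (simp add: vertex_inner[OF a])
  define m where "m = g 1 True"
  have m: "m = z u" by (simp add: m_def g_def axis_vertex_def a1)
  have gm: "0 \<le> g i s" "g i s \<le> m" for i s unfolding m unfolding g_def using u(2) z0 GV by auto
  have hm: "0 \<le> h b c d e" "h b c d e \<le> m" for b c d e unfolding m unfolding h_def using u(2) z0 HV by auto
  have m8: "m \<le> 8" unfolding m using z8 u(1) by simp
  have total: "(\<Sum>v\<in>vertices24. z v) = (\<Sum>i\<in>UNIV. \<Sum>s\<in>UNIV. g i s)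
    + (\<Sum>b\<in>UNIV. \<Sum>c\<in>UNIV. \<Sum>d\<in>UNIV. \<Sum>e\<in>UNIV. h b c d e)"
    unfolding V g_def h_def by (rule sum_frame_vertices[OF a])
  have total24: "(\<Sum>v\<in>vertices24. z v) = g 1 True + g 1 False + g 2 True + g 2 False + g 3 True + g 3 False + g 4 True + g 4 False
    + (h True True True True + h True True True False + h True True False True + h True True False False
      + h True False True True + h True False True False + h True False False True + h True False False False)
    + (h False True True True + h False True True False + h False True False True + h False True False False
      + h False False True True + h False False True False + h False False False True + h False False False False)"
    unfolding total sum_4 by (simp add: UNIV_bool)
  show ?thesis
  proof (cases "m \<le> 2 * sqrt 2")
    case True
    have gm: "g i s \<le> 2 * sqrt 2" for i s using gm(2)[of i s] True by linarith
    have hm: "h b c d e \<le> 2 * sqrt 2" for b c d e using hm(2)[of b c d e] True by linarith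
    note octa = octahedron_bound[OF gm gm hm hm hm hm]
    define F12 where "F12 s t = g 1 s + g 2 t + h s t True True + h s t False False + h s t True False + h s t False True" for s t
    have f12: "F12 s t \<le> 5 * sqrt 2" for s t
      unfolding F12_def by (rule octa; (rule gh | use hh[of s t True True] hh[of s t False False] in simp))
    define F13 where "F13 s t = g 1 s + g 3 t + h s True t True + h s False t False + h s True t False + h s False t True" for s t
    have f13: "F13 s t \<le> 5 * sqrt 2" for s t
      unfolding F13_def by (rule octa; (rule gh | use hh[of s True t True] hh[of s False t False] in simp))
    define F14 where "F14 s t = g 1 s + g 4 t + h s True True t + h s False False t + h s True False t + h s False True t" for s t
    have f14: "F14 s t \<le> 5 * sqrt 2" for s t
      unfolding F14_def by (rule octa; (rule gh | use hh[of s True True t] hh[of s False False t] in simp))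
    define F23 where "F23 s t = g 2 s + g 3 t + h True s t True + h False s t False + h True s t False + h False s t True" for s t
    have f23: "F23 s t \<le> 5 * sqrt 2" for s t
      unfolding F23_def by (rule octa; (rule gh | use hh[of True s t True] hh[of False s t False] in simp))
    define F24 where "F24 s t = g 2 s + g 4 t + h True s True t + h False s False t + h True s False t + h False s True t" for s t
    have f24: "F24 s t \<le> 5 * sqrt 2" for s t
      unfolding F24_def by (rule octa; (rule gh | use hh[of True s True t] hh[of False s False t] in simp))
    define F34 where "F34 s t = g 3 s + g 4 t + h True True s t + h False False s t + h True False s t + h False True s t" for s t
    have f34: "F34 s t \<le> 5 * sqrt 2" for s t
      unfolding F34_def by (rule octa; (rule gh | use hh[of True True s t] hh[of False False s t] in simp))
    have four: "F True True + F True False + F False True + F False False \<le> 20 * sqrt 2"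
      if "\<And>s t. F s t \<le> 5 * sqrt 2" for F :: "bool \<Rightarrow> bool \<Rightarrow> real"
      using that[of True True] that[of True False] that[of False True] that[of False False] by linarith
    \<comment> \<open>every vertex lies on six of the 24 facets\<close>
    define T where "T F = F True True + F True False + F False True + F False False" for F :: "bool \<Rightarrow> bool \<Rightarrow> real"
    have "6 * (\<Sum>v\<in>vertices24. z v) = T F12 + T F13 + T F14 + T F23 + T F24 + T F34"
      unfolding total24 T_def F12_def F13_def F14_def F23_def F24_def F34_def by (simp add: algebra_simps)
    moreover have "T F12 \<le> 20 * sqrt 2" "T F13 \<le> 20 * sqrt 2" "T F14 \<le> 20 * sqrt 2"
      "T F23 \<le> 20 * sqrt 2" "T F24 \<le> 20 * sqrt 2" "T F34 \<le> 20 * sqrt 2"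
      unfolding T_def by (rule four, rule f12 f13 f14 f23 f24 f34)+
    ultimately have "6 * (\<Sum>v\<in>vertices24. z v) \<le> 120 * sqrt 2" by linarith
    then show ?thesis by simp
  next
    case False
    then have mr: "2 * sqrt 2 \<le> m" by simp
    have m0: "m > 0" using False by (smt (verit) real_sqrt_ge_zero)
    \<comment> \<open>the neighbours of \<open>a 1\<close>; the weights of all vertices other than these and \<open>a 1\<close> occur in
      \<open>f2\<close>, \<open>f3\<close>, \<open>f4\<close> below\<close>
    have near: "h True c d e \<le> 1 / m" for c d e
      using gh(1)[of True c d e] m0 by (simp add: m_def pos_le_divide_eq mult.commute)
    have h2: "h False c d e * h False c d e \<le> 27" for c d e
    proof -
      have "h False c d e * h False c d e \<le> m * h False c d e"
        using hm[of False c d e] by (intro mult_right_mono)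
      then show ?thesis using h27[of c d e] by (simp add: m_def)
    qed
    let ?R = "20 * sqrt 2 - m - 8 / m"
    note opp = opposite_octahedron_bound[OF mr m8 gm(1) gm(2) gm(1) _ hm(1) hm(1) hm(1) hm(1) h2 h2 h2 h2]
    have f2: "g 1 False + 6 * g 2 t + 2 * (h False t True True + h False t True False + h False t False False + h False t False True) \<le> ?R" for t
      by (rule opp; (rule gh | use g8[of 2] hh[of False t True True] hh[of False t False False] hh8[of False t True True] hh8[of False t True False] in \<open>simp add: m_def mult.commute\<close>))
    have f3: "g 1 False + 6 * g 3 t + 2 * (h False True t True + h False True t False + h False False t False + h False False t True) \<le> ?R" for t
      by (rule opp; (rule gh | use g8[of 3] hh[of False True t True] hh[of False False t False] hh8[of False True t True] hh8[of False True t False] in \<open>simp add: m_def mult.commute\<close>))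
    have f4: "g 1 False + 6 * g 4 t + 2 * (h False True True t + h False True False t + h False False False t + h False False True t) \<le> ?R" for t
      by (rule opp; (rule gh | use g8[of 4] hh[of False True True t] hh[of False False False t] hh8[of False True True t] hh8[of False True False t] in \<open>simp add: m_def mult.commute\<close>))
    have far_part: "g 1 False + g 2 True + g 2 False + g 3 True + g 3 False + g 4 True + g 4 False
        + (h False True True True + h False True True False + h False True False True + h False True False False
        + h False False True True + h False False True False + h False False False True + h False False False False) \<le> ?R"
      using add_mono[OF add_mono[OF add_mono[OF add_mono[OF add_mono[OF f2[of True] f2[of False]] f3[of True]] f3[of False]] f4[of True]] f4[of False]]
      by simp
    have near_part: "h True True True True + h True True True False + h True True False True + h True True False False
        + h True False True True + h True False True False + h True False False True + h True False False False \<le> 8 * (1 / m)"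
      using near[of True True True] near[of True True False] near[of True False True] near[of True False False]
        near[of False True True] near[of False True False] near[of False False True] near[of False False False]
      by linarith
    have "(\<Sum>v\<in>vertices24. z v) \<le> m + 8 * (1 / m) + ?R"
      unfolding total24 using far_part near_part unfolding m_def by linarith
    then show ?thesis by simp
  qed
qed

section \<open>Horoballs and cells as regions over a cube\<close>

lemma frame_point_coords:
  assumes a: "orthonormal_frame a"
  shows "frame_point a (x \<bullet> a 1) (x \<bullet> a 2, x \<bullet> a 3, x \<bullet> a 4) = x"
proof -
  have "surj (\<lambda>y. \<Sum>i\<in>UNIV. y $ i *\<^sub>R a i)"
    using orthogonal_transformation_surj[OF orthogonal_transformation_frame[OF a]] .
  from surjD[OF this, of x] obtain y where y: "x = (\<Sum>i\<in>UNIV. y $ i *\<^sub>R a i)" by blast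
  have "x \<bullet> a i = y $ i" for i unfolding y by (rule inner_sign_sum[OF a])
  then show ?thesis by (simp add: frame_point_def y sum_4)
qed

lemma norm_in_frame:
  assumes a: "orthonormal_frame a"
  shows "x \<bullet> x = (x \<bullet> a 1)\<^sup>2 + (x \<bullet> a 2)\<^sup>2 + (x \<bullet> a 3)\<^sup>2 + (x \<bullet> a 4)\<^sup>2"
proof -
  have "x \<bullet> x = frame_point a (x \<bullet> a 1) (x \<bullet> a 2, x \<bullet> a 3, x \<bullet> a 4) \<bullet> frame_point a (x \<bullet> a 1) (x \<bullet> a 2, x \<bullet> a 3, x \<bullet> a 4)"
    by (simp add: frame_point_coords[OF a])
  also have "\<dots> = (x \<bullet> a 1)\<^sup>2 + (x \<bullet> a 2, x \<bullet> a 3, x \<bullet> a 4) \<bullet> (x \<bullet> a 2, x \<bullet> a 3, x \<bullet> a 4)"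
    by (rule inner_frame_point(5)[OF a])
  finally show ?thesis by (simp add: power2_eq_square)
qed

lemma frame_polytopeD: "x \<in> frame_polytope a \<Longrightarrow> i \<noteq> j \<Longrightarrow> \<bar>x \<bullet> a i\<bar> + \<bar>x \<bullet> a j\<bar> \<le> 1"
  by (simp add: frame_polytope_def)

text \<open>
  The horoball lies above height \<open>1 / c\<close> in the upper half-space model, that is,
  \<open>k - |p|^2 \<ge> 1 / c^2\<close> in projective coordinates.  For \<open>c \<le> 1\<close> this already implies the
  inequalities of the 24-cell that do not come from facets through \<open>a 1\<close>.
\<close>

lemma horoball_Int_P24_eq_cusp_region:
  assumes fr: "vertex_frame a" and c: "0 < c" "c \<le> 1"
  shows "horoball (a 1) c \<inter> P24 = cusp_region a (\<lambda>p. p \<bullet> p + 1 / c\<^sup>2)"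
proof -
  have a: "orthonormal_frame a" and P: "P24 = frame_polytope a" using fr by (auto simp: vertex_frame_def)
  have n1: "norm (a 1) = 1" using orthonormal_frame_inner[OF a, of 1 1] by (simp add: norm_eq_sqrt_inner)
  have "x \<in> horoball (a 1) c \<inter> P24 \<longleftrightarrow> x \<in> cusp_region a (\<lambda>p. p \<bullet> p + 1 / c\<^sup>2)" for x
  proof (cases "x \<bullet> x < 1")
    case False
    then show ?thesis by (simp add: horoball_iff[OF n1 c(1)] cusp_region_def klein_ball_iff del: mem_ball mem_ball_0)
  next
    case True
    define t y2 y3 y4 where y: "t = x \<bullet> a 1" "y2 = x \<bullet> a 2" "y3 = x \<bullet> a 3" "y4 = x \<bullet> a 4"
    define r where "r = y2\<^sup>2 + y3\<^sup>2 + y4\<^sup>2"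
    have xx: "x \<bullet> x = t\<^sup>2 + r" using norm_in_frame[OF a, of x] by (simp add: y r_def)
    have "t\<^sup>2 < 1" using True xx by (simp add: r_def) (smt (verit) zero_le_power2)
    then have t1: "\<bar>t\<bar> < 1" by (simp add: abs_square_less_1)
    have cond: "(1 - t) * ((1 / (1 - t)) *\<^sub>R (y2, y3, y4) \<bullet> (1 / (1 - t)) *\<^sub>R (y2, y3, y4) + 1 / c\<^sup>2) \<le> 1 + t
      \<longleftrightarrow> (1 - t)\<^sup>2 \<le> c\<^sup>2 * (1 - x \<bullet> x)"
    proof -
      have "(1 / (1 - t)) *\<^sub>R (y2, y3, y4) \<bullet> (1 / (1 - t)) *\<^sub>R (y2, y3, y4) = r / (1 - t)\<^sup>2"
        by (simp add: r_def power2_eq_square add_divide_distrib)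
      then have "(1 - t) * ((1 / (1 - t)) *\<^sub>R (y2, y3, y4) \<bullet> (1 / (1 - t)) *\<^sub>R (y2, y3, y4) + 1 / c\<^sup>2) = r / (1 - t) + (1 - t) / c\<^sup>2" (is "?E = _")
        using t1 by (simp add: distrib_left power2_eq_square)
      then have "(1 - t) * ?E = r + (1 - t)\<^sup>2 / c\<^sup>2"
        using t1 by (simp add: distrib_left power2_eq_square)
      moreover have "(1 - t) * (1 + t) = 1 - t\<^sup>2" by (simp add: power2_eq_square algebra_simps)
      moreover have "?E \<le> 1 + t \<longleftrightarrow> (1 - t) * ?E \<le> (1 - t) * (1 + t)"
        using t1 by (intro mult_le_cancel_left_pos[symmetric]) simp
      ultimately have "?E \<le> 1 + t \<longleftrightarrow> (1 - t)\<^sup>2 / c\<^sup>2 \<le> 1 - x \<bullet> x"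
        unfolding xx by auto
      also have "\<dots> \<longleftrightarrow> (1 - t)\<^sup>2 \<le> c\<^sup>2 * (1 - x \<bullet> x)"
        using c by (simp add: pos_divide_le_eq mult.commute)
      finally show ?thesis .
    qed
    have poly: "x \<in> P24 \<longleftrightarrow> (\<forall>i. i \<noteq> 1 \<longrightarrow> \<bar>x \<bullet> a i\<bar> \<le> 1 - t)" if h: "(1 - t)\<^sup>2 \<le> c\<^sup>2 * (1 - x \<bullet> x)"
    proof
      assume "x \<in> P24"
      show "\<forall>i. i \<noteq> 1 \<longrightarrow> \<bar>x \<bullet> a i\<bar> \<le> 1 - t"
      proof (intro allI impI)
        fix i :: 4 assume "i \<noteq> 1"
        then have "\<bar>x \<bullet> a i\<bar> + \<bar>x \<bullet> a 1\<bar> \<le> 1" using \<open>x \<in> P24\<close> unfolding P by (intro frame_polytopeD)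
        then show "\<bar>x \<bullet> a i\<bar> \<le> 1 - t" unfolding y(1) by linarith
      qed
    next
      assume R: "\<forall>i. i \<noteq> 1 \<longrightarrow> \<bar>x \<bullet> a i\<bar> \<le> 1 - t"
      have "c\<^sup>2 * (1 - x \<bullet> x) \<le> 1 * (1 - x \<bullet> x)"
        using c True by (intro mult_right_mono) (auto simp: power_le_one)
      with h have "(1 - t)\<^sup>2 \<le> 1 * (1 - x \<bullet> x)" by (rule order_trans)
      then have "(1 - t)\<^sup>2 \<le> 1 - t\<^sup>2 - r" unfolding xx by simp
      then have r: "r \<le> 2 * t * (1 - t)" by (simp add: power2_eq_square algebra_simps)
      have "0 \<le> r" by (simp add: r_def)
      then have "0 \<le> t * (1 - t)" using r by linarith
      then have t0: "0 \<le> t" using mult_neg_pos[of t "1 - t"] t1 by linarith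
      have pair: "\<bar>u\<bar> + \<bar>v\<bar> \<le> 1" if "u\<^sup>2 + v\<^sup>2 \<le> r" for u v
      proof -
        have "(\<bar>u\<bar> + \<bar>v\<bar>)\<^sup>2 + (\<bar>u\<bar> - \<bar>v\<bar>)\<^sup>2 = 2 * (u\<^sup>2 + v\<^sup>2)"
          by (simp add: power2_sum power2_diff)
        moreover have "(\<bar>u\<bar> + \<bar>v\<bar>)\<^sup>2 \<le> (\<bar>u\<bar> + \<bar>v\<bar>)\<^sup>2 + (\<bar>u\<bar> - \<bar>v\<bar>)\<^sup>2" by simp
        ultimately have "(\<bar>u\<bar> + \<bar>v\<bar>)\<^sup>2 \<le> 2 * (u\<^sup>2 + v\<^sup>2)" by (simp only:)
        also have "\<dots> \<le> 2 * r" using that by simp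
        also have "\<dots> \<le> 1" using r zero_le_power2[of "2 * t - 1"] by (simp add: power2_eq_square algebra_simps)
        finally show ?thesis using abs_square_le_1[of "\<bar>u\<bar> + \<bar>v\<bar>"] by simp
      qed
      have y1: "\<bar>t\<bar> + \<bar>y2\<bar> \<le> 1" "\<bar>t\<bar> + \<bar>y3\<bar> \<le> 1" "\<bar>t\<bar> + \<bar>y4\<bar> \<le> 1"
        using R t0 by (auto simp: y forall_4)
      have y2: "\<bar>y2\<bar> + \<bar>y3\<bar> \<le> 1" "\<bar>y2\<bar> + \<bar>y4\<bar> \<le> 1" "\<bar>y3\<bar> + \<bar>y4\<bar> \<le> 1"
        by (rule pair; simp add: r_def)+
      show "x \<in> P24" unfolding P frame_polytope_def mem_Collect_eq forall_4 y[symmetric]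
        using y1 y2 by (simp add: add.commute)
    qed
    have "x \<in> cusp_region a (\<lambda>p. p \<bullet> p + 1 / c\<^sup>2) \<longleftrightarrow> (\<forall>i. i \<noteq> 1 \<longrightarrow> \<bar>x \<bullet> a i\<bar> \<le> 1 - t) \<and> (1 - t)\<^sup>2 \<le> c\<^sup>2 * (1 - x \<bullet> x)"
      unfolding cusp_region_def mem_Collect_eq klein_ball_iff y[symmetric] cond using True by simp
    then show ?thesis
      using poly True unfolding Int_iff horoball_iff[OF n1 c(1)] y(1)[symmetric] by blast
  qed
  then show ?thesis by blast
qed

text \<open>
  Since \<^const>\<open>exp_busemann\<close> at \<open>x\<close> decreases as \<open>x \<bullet> v\<close> grows, this is the set of points of
  the 24-cell at which no other vertex has a smaller Busemann function.
\<close>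

definition vertex_cell :: "real^4 \<Rightarrow> (real^4) set" where
  "vertex_cell v = {x \<in> P24 \<inter> ball 0 1. \<forall>w\<in>vertices24. x \<bullet> w \<le> x \<bullet> v}"

text \<open>
  Only the cube vertices in the half-space of \<open>a 1\<close> contribute to the lower boundary of the
  cell; the most restrictive one has the signs of the coordinates of \<open>x\<close>.
\<close>

lemma vertex_cell_eq_cusp_region:
  assumes fr: "vertex_frame a"
  shows "vertex_cell (a 1) = cusp_region a (\<lambda>p. 1 + 2 * (\<bar>fst p\<bar> + \<bar>fst (snd p)\<bar> + \<bar>snd (snd p)\<bar>))"
    (is "_ = cusp_region a ?k")
proof -
  have a: "orthonormal_frame a" and P: "P24 = frame_polytope a" and V: "vertices24 = frame_vertices a"
    using fr by (auto simp: vertex_frame_def)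
  have "x \<in> vertex_cell (a 1) \<longleftrightarrow> x \<in> cusp_region a ?k" for x
  proof (cases "x \<bullet> x < 1")
    case False
    then show ?thesis by (simp add: vertex_cell_def cusp_region_def klein_ball_iff del: mem_ball mem_ball_0)
  next
    case True
    define t y2 y3 y4 where y: "t = x \<bullet> a 1" "y2 = x \<bullet> a 2" "y3 = x \<bullet> a 3" "y4 = x \<bullet> a 4"
    have "t\<^sup>2 < 1" using norm_in_frame[OF a, of x] True unfolding y[symmetric] by (smt (verit) zero_le_power2)
    then have t1: "\<bar>t\<bar> < 1" by (simp add: abs_square_less_1)
    define s where "s = \<bar>y2\<bar> + \<bar>y3\<bar> + \<bar>y4\<bar>"
    have cond: "(1 - t) * ?k ((1 / (1 - t)) *\<^sub>R (y2, y3, y4)) \<le> 1 + t \<longleftrightarrow> s \<le> t"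
    proof -
      have "(1 - t) * ?k ((1 / (1 - t)) *\<^sub>R (y2, y3, y4)) = (1 - t) + 2 * s"
        using t1 by (simp add: s_def abs_divide distrib_left)
      then show ?thesis by auto
    qed
    have cusp: "x \<in> cusp_region a ?k \<longleftrightarrow> (\<forall>i. i \<noteq> 1 \<longrightarrow> \<bar>x \<bullet> a i\<bar> \<le> 1 - t) \<and> s \<le> t"
      unfolding cusp_region_def mem_Collect_eq klein_ball_iff y[symmetric] cond using True by simp
    have cell: "x \<in> vertex_cell (a 1) \<longleftrightarrow> x \<in> P24 \<and> (\<forall>w\<in>frame_vertices a. x \<bullet> w \<le> t)"
      unfolding vertex_cell_def mem_Collect_eq Int_iff klein_ball_iff V[symmetric] y(1) using True by simp
    show ?thesis
    proof
      assume "x \<in> vertex_cell (a 1)"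
      then have xP: "x \<in> P24" and xw: "\<And>w. w \<in> frame_vertices a \<Longrightarrow> x \<bullet> w \<le> t" using cell by auto
      have 1: "\<forall>i. i \<noteq> 1 \<longrightarrow> \<bar>x \<bullet> a i\<bar> \<le> 1 - t"
      proof (intro allI impI)
        fix i :: 4 assume "i \<noteq> 1"
        then have "\<bar>x \<bullet> a i\<bar> + \<bar>x \<bullet> a 1\<bar> \<le> 1" using xP unfolding P by (intro frame_polytopeD)
        then show "\<bar>x \<bullet> a i\<bar> \<le> 1 - t" unfolding y(1) by linarith
      qed
      define e where "e i = (if i = 1 \<or> x \<bullet> a i \<ge> 0 then 1 else - 1 :: real)" for i
      have "(1 / 2) *\<^sub>R (\<Sum>i\<in>UNIV. e i *\<^sub>R a i) \<in> frame_vertices a"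
      proof -
        have "\<forall>i. e i \<in> {-1, 1}" by (simp add: e_def)
        then show ?thesis unfolding frame_vertices_def by blast
      qed
      from xw[OF this] have "(t + s) / 2 \<le> t"
        by (simp add: inner_sum_right sum_4 e_def s_def y abs_if inner_add_right inner_diff_right split: if_splits)
      then show "x \<in> cusp_region a ?k" using 1 cusp by simp
    next
      assume "x \<in> cusp_region a ?k"
      then have R: "\<forall>i. i \<noteq> 1 \<longrightarrow> \<bar>x \<bullet> a i\<bar> \<le> 1 - t" and st: "s \<le> t" using cusp by auto
      have s0: "0 \<le> s" "\<bar>y2\<bar> \<le> s" "\<bar>y3\<bar> \<le> s" "\<bar>y4\<bar> \<le> s" by (auto simp: s_def)
      have xi: "\<bar>x \<bullet> a i\<bar> \<le> t" for i
        using exhaust_4[of i] s0 st by (elim disjE) (simp_all add: y[symmetric])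
      have y1: "\<bar>y2\<bar> \<le> 1 - t" "\<bar>y3\<bar> \<le> 1 - t" "\<bar>y4\<bar> \<le> 1 - t" using R by (auto simp: y)
      have "x \<in> P24" unfolding P frame_polytope_def mem_Collect_eq forall_4 y[symmetric]
        using y1 st t1 s0 by (auto simp: s_def)
      moreover have "x \<bullet> w \<le> t" if "w \<in> frame_vertices a" for w
      proof -
        from that consider k e where "e \<in> {-1, 1}" "w = e *\<^sub>R a k"
          | e where "\<forall>i. e i \<in> {-1, 1::real}" "w = (1 / 2) *\<^sub>R (\<Sum>i\<in>UNIV. e i *\<^sub>R a i)"
          unfolding frame_vertices_def by blast
        then show ?thesis
        proof cases
          case 1
          then show ?thesis using xi[of k] by auto
        next
          case 2
          have le: "e i * u \<le> \<bar>u\<bar>" for i u using spec[OF 2(1), of i] by auto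
          have "x \<bullet> w = (e 1 * t + e 2 * y2 + e 3 * y3 + e 4 * y4) / 2"
            by (simp add: 2(2) inner_add_right sum_4 y add_divide_distrib)
          also have "\<dots> \<le> (\<bar>t\<bar> + s) / 2"
            using le[of 1 t] le[of 2 y2] le[of 3 y3] le[of 4 y4] by (simp add: s_def)
          also have "\<dots> \<le> t" using st s0 by simp
          finally show ?thesis .
        qed
      qed
      ultimately show "x \<in> vertex_cell (a 1)" using cell by blast
    qed
  qed
  then show ?thesis by blast
qed

lemma nn_integral_reflected_interval:
  fixes f :: "real \<Rightarrow> ennreal"
  assumes [measurable]: "f \<in> borel_measurable borel"
  shows "(\<integral>\<^sup>+u\<in>{-1..1}. f \<bar>u\<bar> \<partial>lborel) = 2 * (\<integral>\<^sup>+x\<in>{0..1}. f (1 - x) \<partial>lborel)"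
proof -
  have "(\<integral>\<^sup>+u\<in>{-1..1}. f \<bar>u\<bar> \<partial>lborel) = (\<integral>\<^sup>+u. f (- u) * indicator {-1..0} u + f u * indicator {0..1} u \<partial>lborel)"
  proof (rule nn_integral_cong_AE)
    have "AE u in lborel. u \<noteq> (0::real)" by (rule AE_lborel_singleton)
    then show "AE u in lborel. f \<bar>u\<bar> * indicator {-1..1} u = f (- u) * indicator {-1..0} u + f u * indicator {0..1} u"
      by eventually_elim (auto simp: indicator_def)
  qed
  also have "\<dots> = (\<integral>\<^sup>+u. f (- u) * indicator {-1..0} u \<partial>lborel) + (\<integral>\<^sup>+u. f u * indicator {0..1} u \<partial>lborel)"
    by (intro nn_integral_add) measurable
  also have "(\<integral>\<^sup>+u. f (- u) * indicator {-1..0} u \<partial>lborel) = (\<integral>\<^sup>+x\<in>{0..1}. f (1 - x) \<partial>lborel)"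
    by (subst nn_integral_real_affine[where c = 1 and t = "-1"]) (auto intro!: nn_integral_cong simp: indicator_def)
  also have "(\<integral>\<^sup>+u. f u * indicator {0..1} u \<partial>lborel) = (\<integral>\<^sup>+x\<in>{0..1}. f (1 - x) \<partial>lborel)"
    by (subst nn_integral_real_affine[where c = "-1" and t = 1]) (auto intro!: nn_integral_cong simp: indicator_def)
  finally show ?thesis by (simp add: mult_2)
qed

lemma nn_integral_cube3:
  assumes [measurable]: "f \<in> borel_measurable borel"
  shows "(\<integral>\<^sup>+p\<in>cube3. f p \<partial>lborel)
    = (\<integral>\<^sup>+x\<in>{-1..1}. (\<integral>\<^sup>+y\<in>{-1..1}. (\<integral>\<^sup>+z\<in>{-1..1}. f (x, y, z) \<partial>lborel) \<partial>lborel) \<partial>lborel)"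
proof -
  let ?J = "{-1..1::real}"
  have m: "f \<in> borel_measurable (lborel \<Otimes>\<^sub>M lborel \<Otimes>\<^sub>M lborel)" by (simp add: lborel_prod)
  note [measurable] = m
  have "(\<integral>\<^sup>+p\<in>cube3. f p \<partial>lborel) = (\<integral>\<^sup>+p. f p * indicator cube3 p \<partial>(lborel \<Otimes>\<^sub>M (lborel \<Otimes>\<^sub>M lborel)))"
    by (simp add: lborel_prod)
  also have "\<dots> = (\<integral>\<^sup>+x. (\<integral>\<^sup>+q. f (x, q) * indicator cube3 (x, q) \<partial>(lborel \<Otimes>\<^sub>M lborel)) \<partial>lborel)"
  proof (rule sigma_finite_measure.nn_integral_fst[symmetric])
    show "sigma_finite_measure (lborel \<Otimes>\<^sub>M lborel :: (real \<times> real) measure)"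
      by (simp add: lborel_prod sigma_finite_lborel)
    have "cube3 \<in> sets (lborel \<Otimes>\<^sub>M lborel \<Otimes>\<^sub>M lborel)" unfolding cube3_def by measurable
    then show "(\<lambda>p. f p * indicator cube3 p) \<in> borel_measurable (lborel \<Otimes>\<^sub>M lborel \<Otimes>\<^sub>M lborel)" by measurable
  qed
  also have "\<dots> = (\<integral>\<^sup>+x. (\<integral>\<^sup>+y. (\<integral>\<^sup>+z. f (x, y, z) * indicator ?J z * indicator ?J y * indicator ?J x \<partial>lborel) \<partial>lborel) \<partial>lborel)"
  proof (rule nn_integral_cong)
    fix x :: real
    have [measurable]: "(\<lambda>q. f (x, q)) \<in> borel_measurable (lborel \<Otimes>\<^sub>M lborel)"
      by (rule measurable_compose[OF _ m]) measurable
    have "(\<integral>\<^sup>+q. f (x, q) * indicator cube3 (x, q) \<partial>(lborel \<Otimes>\<^sub>M lborel))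
      = (\<integral>\<^sup>+q. f (x, q) * indicator ?J (snd q) * indicator ?J (fst q) * indicator ?J x \<partial>(lborel \<Otimes>\<^sub>M lborel))"
      by (rule nn_integral_cong) (auto simp: cube3_def indicator_def)
    also have "\<dots> = (\<integral>\<^sup>+y. (\<integral>\<^sup>+z. f (x, y, z) * indicator ?J z * indicator ?J y * indicator ?J x \<partial>lborel) \<partial>lborel)"
    proof -
      have "(\<lambda>q. f (x, q) * indicator ?J (snd q) * indicator ?J (fst q) * indicator ?J x) \<in> borel_measurable (lborel \<Otimes>\<^sub>M lborel)"
        by measurable
      from lborel.nn_integral_fst[OF this] show ?thesis by (simp only: fst_conv snd_conv)
    qed
    finally show "(\<integral>\<^sup>+q. f (x, q) * indicator cube3 (x, q) \<partial>(lborel \<Otimes>\<^sub>M lborel)) = \<dots>" .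
  qed
  also have "\<dots> = (\<integral>\<^sup>+x\<in>?J. (\<integral>\<^sup>+y\<in>?J. (\<integral>\<^sup>+z\<in>?J. f (x, y, z) \<partial>lborel) \<partial>lborel) \<partial>lborel)"
  proof (rule nn_integral_cong)
    fix x :: real
    have "(\<lambda>q. f (x, q)) \<in> borel_measurable (lborel \<Otimes>\<^sub>M lborel)"
      by (rule measurable_compose[OF _ m]) measurable
    moreover have "(\<lambda>q. f (x, q)) = (\<lambda>(y, z). f (x, y, z))" by auto
    ultimately have [measurable]: "(\<lambda>(y, z). f (x, y, z)) \<in> borel_measurable (lborel \<Otimes>\<^sub>M lborel)"
      by (simp only:)
    have "(\<integral>\<^sup>+y. (\<integral>\<^sup>+z. f (x, y, z) * indicator ?J z * indicator ?J y * indicator ?J x \<partial>lborel) \<partial>lborel)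
      = (\<integral>\<^sup>+y. (\<integral>\<^sup>+z\<in>?J. f (x, y, z) \<partial>lborel) * indicator ?J y * indicator ?J x \<partial>lborel)"
    proof (rule nn_integral_cong)
      fix y
      have [measurable]: "(\<lambda>z. f (x, y, z)) \<in> borel_measurable lborel"
        by (rule measurable_compose[OF _ m]) measurable
      show "(\<integral>\<^sup>+z. f (x, y, z) * indicator ?J z * indicator ?J y * indicator ?J x \<partial>lborel)
        = (\<integral>\<^sup>+z\<in>?J. f (x, y, z) \<partial>lborel) * indicator ?J y * indicator ?J x"
        by (simp add: nn_integral_multc)
    qed
    also have "\<dots> = (\<integral>\<^sup>+y\<in>?J. (\<integral>\<^sup>+z\<in>?J. f (x, y, z) \<partial>lborel) \<partial>lborel) * indicator ?J x"
      by (rule nn_integral_multc) measurable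
    finally show "(\<integral>\<^sup>+y. (\<integral>\<^sup>+z. f (x, y, z) * indicator ?J z * indicator ?J y * indicator ?J x \<partial>lborel) \<partial>lborel) = \<dots>" .
  qed
  finally show ?thesis .
qed

text \<open>
  Reflecting each coordinate by \<open>x = 1 - |u|\<close> turns the integrand into a function of the distance
  from the origin.
\<close>

lemma vertex_cell_integral:
  "(\<integral>\<^sup>+p\<in>cube3. ennreal (1 / (3 * sqrt (1 + 2 * (\<bar>fst p\<bar> + \<bar>fst (snd p)\<bar> + \<bar>snd (snd p)\<bar>) - p \<bullet> p) ^ 3)) \<partial>lborel)
    = ennreal (pi\<^sup>2 / 18)"
proof -
  define f where "f x y z = ennreal (1 / (3 * sqrt (4 - (1 - x)\<^sup>2 - (1 - y)\<^sup>2 - (1 - z)\<^sup>2) ^ 3))" for x y z :: real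
  have f: "ennreal (1 / (3 * sqrt (1 + 2 * (\<bar>x\<bar> + \<bar>y\<bar> + \<bar>z\<bar>) - (x, y, z) \<bullet> (x, y, z)) ^ 3)) = f \<bar>x\<bar> \<bar>y\<bar> \<bar>z\<bar>" for x y z :: real
  proof -
    have "1 + 2 * (\<bar>x\<bar> + \<bar>y\<bar> + \<bar>z\<bar>) - (x, y, z) \<bullet> (x, y, z) = 4 - (1 - \<bar>x\<bar>)\<^sup>2 - (1 - \<bar>y\<bar>)\<^sup>2 - (1 - \<bar>z\<bar>)\<^sup>2"
      by (simp add: power2_eq_square algebra_simps)
    then show ?thesis by (simp only: f_def)
  qed
  have meas: "(\<lambda>p. ennreal (1 / (3 * sqrt (1 + 2 * (\<bar>fst p\<bar> + \<bar>fst (snd p)\<bar> + \<bar>snd (snd p)\<bar>) - p \<bullet> p) ^ 3))) \<in> borel_measurable (borel :: (real \<times> real \<times> real) measure)"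
  proof -
    have "(\<lambda>p. 1 + 2 * (\<bar>fst p\<bar> + \<bar>fst (snd p)\<bar> + \<bar>snd (snd p)\<bar>) - p \<bullet> p) \<in> borel_measurable (borel :: (real \<times> real \<times> real) measure)"
      by (intro borel_measurable_continuous_onI continuous_intros)
    then show ?thesis by measurable
  qed
  let ?J = "{-1..1::real}" and ?I = "{0..1::real}"
  have "(\<integral>\<^sup>+p\<in>cube3. ennreal (1 / (3 * sqrt (1 + 2 * (\<bar>fst p\<bar> + \<bar>fst (snd p)\<bar> + \<bar>snd (snd p)\<bar>) - p \<bullet> p) ^ 3)) \<partial>lborel)
    = (\<integral>\<^sup>+x\<in>?J. (\<integral>\<^sup>+y\<in>?J. (\<integral>\<^sup>+z\<in>?J. f \<bar>x\<bar> \<bar>y\<bar> \<bar>z\<bar> \<partial>lborel) \<partial>lborel) \<partial>lborel)"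
    unfolding nn_integral_cube3[OF meas] fst_conv snd_conv f ..
  also have "\<dots> = 2 * (\<integral>\<^sup>+x\<in>?I. 2 * (\<integral>\<^sup>+y\<in>?I. 2 * (\<integral>\<^sup>+z\<in>?I. f (1 - x) (1 - y) (1 - z) \<partial>lborel) \<partial>lborel) \<partial>lborel)"
  proof -
    have 1: "(\<integral>\<^sup>+z\<in>?J. f u v \<bar>z\<bar> \<partial>lborel) = 2 * (\<integral>\<^sup>+z\<in>?I. f u v (1 - z) \<partial>lborel)" for u v
      by (rule nn_integral_reflected_interval) (unfold f_def, measurable)
    have 2: "(\<integral>\<^sup>+y\<in>?J. 2 * (\<integral>\<^sup>+z\<in>?I. f u \<bar>y\<bar> (1 - z) \<partial>lborel) \<partial>lborel)
      = 2 * (\<integral>\<^sup>+y\<in>?I. 2 * (\<integral>\<^sup>+z\<in>?I. f u (1 - y) (1 - z) \<partial>lborel) \<partial>lborel)" for u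
      by (rule nn_integral_reflected_interval[of "\<lambda>v. 2 * (\<integral>\<^sup>+z\<in>?I. f u v (1 - z) \<partial>lborel)"]) (unfold f_def, measurable)
    show ?thesis unfolding 1 2
      by (rule nn_integral_reflected_interval[of "\<lambda>u. 2 * (\<integral>\<^sup>+y\<in>?I. 2 * (\<integral>\<^sup>+z\<in>?I. f u (1 - y) (1 - z) \<partial>lborel) \<partial>lborel)"])
        (unfold f_def, measurable)
  qed
  also have "\<dots> = 2 * (2 * (2 * (ennreal (1 / 3) * ennreal (pi\<^sup>2 / 48))))"
  proof -
    define g where "g x y z = ennreal (1 / sqrt (4 - x\<^sup>2 - y\<^sup>2 - z\<^sup>2) ^ 3)" for x y z :: real
    have pull: "(\<integral>\<^sup>+z\<in>?I. c * h z \<partial>lborel) = c * (\<integral>\<^sup>+z\<in>?I. h z \<partial>lborel)"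
      if [measurable]: "h \<in> borel_measurable borel" for c and h :: "real \<Rightarrow> ennreal"
      unfolding mult.assoc by (rule nn_integral_cmult) measurable
    have f3: "f (1 - x) (1 - y) (1 - z) = ennreal (1 / 3) * g x y z" for x y z
      unfolding f_def g_def by (subst ennreal_mult'[symmetric]) simp_all
    have 1: "(\<integral>\<^sup>+z\<in>?I. ennreal (1 / 3) * g x y z \<partial>lborel) = ennreal (1 / 3) * (\<integral>\<^sup>+z\<in>?I. g x y z \<partial>lborel)" for x y
      by (rule pull) (unfold g_def, measurable)
    have 2: "(\<integral>\<^sup>+y\<in>?I. 2 * (ennreal (1 / 3) * (\<integral>\<^sup>+z\<in>?I. g x y z \<partial>lborel)) \<partial>lborel)
      = 2 * (ennreal (1 / 3) * (\<integral>\<^sup>+y\<in>?I. (\<integral>\<^sup>+z\<in>?I. g x y z \<partial>lborel) \<partial>lborel))" for x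
      unfolding mult.assoc[symmetric, of 2 "ennreal (1 / 3)"] by (rule pull) (unfold g_def, measurable)
    have 3: "(\<integral>\<^sup>+x\<in>?I. 2 * (2 * (ennreal (1 / 3) * (\<integral>\<^sup>+y\<in>?I. (\<integral>\<^sup>+z\<in>?I. g x y z \<partial>lborel) \<partial>lborel))) \<partial>lborel)
      = 2 * (2 * (ennreal (1 / 3) * (\<integral>\<^sup>+x\<in>?I. (\<integral>\<^sup>+y\<in>?I. (\<integral>\<^sup>+z\<in>?I. g x y z \<partial>lborel) \<partial>lborel) \<partial>lborel)))"
      unfolding mult.assoc[symmetric, of 2 "2 * _"] mult.assoc[symmetric, of 2 "ennreal (1 / 3)"]
        mult.assoc[symmetric, of "2" "2 * ennreal (1 / 3)"]
      by (rule pull) (unfold g_def, measurable)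
    show ?thesis unfolding f3 1 2 3 unfolding g_def cube_integral ..
  qed
  also have "\<dots> = ennreal (pi\<^sup>2 / 18)"
  proof -
    have "(2 :: ennreal) = ennreal 2" by simp
    then show ?thesis by (simp only: ennreal_mult'[symmetric]) (simp add: ennreal_mult'[symmetric])
  qed
  finally show ?thesis .
qed

section \<open>Volumes of cusps and of the 24-cell\<close>

lemma emeasure_cube3: "emeasure lborel cube3 = 8"
proof -
  have I: "(\<integral>\<^sup>+x\<in>{-1..1::real}. k \<partial>lborel) = k * 2" for k
    by (simp add: nn_integral_cmult_indicator)
  have "cube3 \<in> sets lborel"
    unfolding cube3_def by (simp add: borel_closed closed_Times)
  then have "emeasure lborel cube3 = (\<integral>\<^sup>+p\<in>cube3. 1 \<partial>lborel)" by simp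
  also have "\<dots> = (\<integral>\<^sup>+x\<in>{-1..1::real}. (\<integral>\<^sup>+y\<in>{-1..1::real}. (\<integral>\<^sup>+z\<in>{-1..1::real}. 1 \<partial>lborel) \<partial>lborel) \<partial>lborel)"
    by (rule nn_integral_cube3) simp
  finally show ?thesis unfolding I by simp
qed

lemma hyp_vol_horoball_Int_P24:
  assumes v: "v \<in> vertices24" and c: "0 < c" "c \<le> 1"
  shows "hyp_vol (horoball v c \<inter> P24) = 8 / 3 * c ^ 3"
proof -
  obtain a where fr: "vertex_frame a" and a1: "a 1 = v" by (rule vertex_frame_exists[OF v])
  have a: "orthonormal_frame a" using fr by (simp add: vertex_frame_def)
  let ?k = "\<lambda>p::real \<times> real \<times> real. p \<bullet> p + 1 / c\<^sup>2"
  have [measurable]: "?k \<in> borel_measurable borel" 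
    by (intro borel_measurable_continuous_onI continuous_intros) (use c in auto)
  have "emeasure hyp_measure (horoball v c \<inter> P24) = (\<integral>\<^sup>+p\<in>cube3. ennreal (1 / (3 * sqrt (?k p - p \<bullet> p) ^ 3)) \<partial>lborel)"
    unfolding a1[symmetric] horoball_Int_P24_eq_cusp_region[OF fr c]
    by (rule emeasure_cusp_region[OF a]) (use c in auto)
  also have "\<dots> = (\<integral>\<^sup>+p\<in>cube3. ennreal (c ^ 3 / 3) \<partial>lborel)"
    using c by (simp add: real_sqrt_divide power_divide)
  also have "\<dots> = ennreal (c ^ 3 / 3) * emeasure lborel cube3"
    unfolding cube3_def by (rule nn_integral_cmult_indicator) (simp add: borel_closed closed_Times)
  also have "\<dots> = ennreal (8 / 3 * c ^ 3)"
  proof -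
    have "ennreal (c ^ 3 / 3) * ennreal 8 = ennreal (c ^ 3 / 3 * 8)"
      using c by (intro ennreal_mult[symmetric]) auto
    then show ?thesis unfolding emeasure_cube3 by (simp add: mult.commute)
  qed
  finally show ?thesis using c by (simp add: hyp_vol_def measure_def)
qed

lemma emeasure_vertex_cell:
  assumes v: "v \<in> vertices24"
  shows "emeasure hyp_measure (vertex_cell v) = ennreal (pi\<^sup>2 / 18)" "vertex_cell v \<in> sets borel"
proof -
  obtain a where fr: "vertex_frame a" and a1: "a 1 = v" by (rule vertex_frame_exists[OF v])
  have a: "orthonormal_frame a" using fr by (simp add: vertex_frame_def)
  let ?k = "\<lambda>p::real \<times> real \<times> real. 1 + 2 * (\<bar>fst p\<bar> + \<bar>fst (snd p)\<bar> + \<bar>snd (snd p)\<bar>)"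
  have k: "?k \<in> borel_measurable borel"
    by (intro borel_measurable_continuous_onI continuous_intros)
  show "vertex_cell v \<in> sets borel"
    unfolding a1[symmetric] vertex_cell_eq_cusp_region[OF fr] by (rule sets_cusp_region[OF k])
  have "emeasure hyp_measure (vertex_cell v) = (\<integral>\<^sup>+p\<in>cube3. ennreal (1 / (3 * sqrt (?k p - p \<bullet> p) ^ 3)) \<partial>lborel)"
    unfolding a1[symmetric] vertex_cell_eq_cusp_region[OF fr]
  proof (rule emeasure_cusp_region[OF a k])
    fix p assume p: "p \<in> cube3"
    obtain x y z where xyz: "p = (x, y, z)" by (cases p) auto
    have sq: "u * u \<le> \<bar>u\<bar>" if "-1 \<le> u" "u \<le> 1" for u :: real
      using that mult_left_le[of "\<bar>u\<bar>" "\<bar>u\<bar>"] by (simp add: abs_le_iff)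
    show "p \<bullet> p < ?k p"
      using p sq[of x] sq[of y] sq[of z] unfolding xyz cube3_def by simp
  qed
  then show "emeasure hyp_measure (vertex_cell v) = ennreal (pi\<^sup>2 / 18)"
    unfolding vertex_cell_integral .
qed

lemma card_vertices24: "card vertices24 = 24"
proof -
  have "orthonormal_frame large_frame" "vertices24 = frame_vertices large_frame"
    using vertex_frame_large by (auto simp: vertex_frame_def)
  then have "(\<Sum>v\<in>vertices24. 1::real) = 24"
    using sum_frame_vertices[of large_frame "\<lambda>_. 1"] by (simp add: UNIV_bool)
  then show ?thesis by simp
qed

lemma AE_lborel_inner_neq:
  fixes v w :: "'a::euclidean_space"
  assumes "v \<noteq> w"
  shows "AE x in lborel. x \<bullet> v \<noteq> x \<bullet> w"
proof (rule AE_I')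
  have "negligible {x. (v - w) \<bullet> x = 0}" using assms by (intro negligible_hyperplane) simp
  moreover have "{x. (v - w) \<bullet> x = 0} \<in> sets lborel" by (simp add: borel_closed closed_hyperplane)
  ultimately show "{x. (v - w) \<bullet> x = 0} \<in> null_sets lborel"
    by (simp add: negligible_iff_null_sets null_sets_completion_iff)
  show "{x \<in> space lborel. \<not> x \<bullet> v \<noteq> x \<bullet> w} \<subseteq> {x. (v - w) \<bullet> x = 0}"
    by (auto simp: inner_diff_left inner_commute[of v] inner_commute[of w])
qed

text \<open>
  The cells cover the part of the 24-cell in the open ball and overlap only where two of the linear functions
  \<open>x \<bullet> v\<close> agree, which is a null set.
\<close>

lemma hyp_vol_P24: "hyp_vol P24 = 4 / 3 * pi\<^sup>2"
proof -
  define f where "f x = ennreal (indicator (ball 0 1) x * (1 - x \<bullet> x) powr (- (5 / 2)))" for x :: "real^4"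
  have [measurable]: "f \<in> borel_measurable borel" unfolding f_def by measurable
  have dens: "emeasure hyp_measure A = (\<integral>\<^sup>+x. f x * indicator A x \<partial>lborel)" if "A \<in> sets borel" for A
    unfolding hyp_measure_def f_def[symmetric] using that by (intro emeasure_density) auto
  have P: "P24 \<in> sets borel"
    unfolding P24_def using finite_vertices24
    by (intro borel_closed compact_imp_closed finite_imp_compact_convex_hull)
  have [measurable]: "vertex_cell v \<in> sets borel" if "v \<in> vertices24" for v
    by (rule emeasure_vertex_cell(2)[OF that])
  have ties: "AE x in lborel. \<forall>v\<in>vertices24. \<forall>w\<in>vertices24. v \<noteq> w \<longrightarrow> x \<bullet> v \<noteq> x \<bullet> w"
    by (intro AE_finite_allI[OF finite_vertices24]) (auto intro: AE_lborel_inner_neq AE_I2)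
  have "emeasure hyp_measure P24 = (\<integral>\<^sup>+x. (\<Sum>v\<in>vertices24. f x * indicator (vertex_cell v) x) \<partial>lborel)"
    unfolding dens[OF P]
  proof (rule nn_integral_cong_AE)
    show "AE x in lborel. f x * indicator P24 x = (\<Sum>v\<in>vertices24. f x * indicator (vertex_cell v) x)"
      using ties
    proof eventually_elim
      case (elim x)
      show ?case
      proof (cases "x \<in> P24 \<inter> ball 0 1")
        case False
        then have "x \<notin> vertex_cell v" for v by (auto simp: vertex_cell_def)
        moreover have "f x * indicator P24 x = 0" using False by (auto simp: f_def indicator_def)
        ultimately show ?thesis by simp
      next
        case True
        have ne: "vertices24 \<noteq> {}" using card_vertices24 by auto
        obtain u where u: "u \<in> vertices24" "\<And>w. w \<in> vertices24 \<Longrightarrow> x \<bullet> w \<le> x \<bullet> u"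
          by (rule finite_max_arg[OF finite_vertices24 ne, where f = "\<lambda>w. x \<bullet> w"], rule that)
        have "x \<in> vertex_cell v \<longleftrightarrow> v = u" if v: "v \<in> vertices24" for v
        proof
          assume "x \<in> vertex_cell v"
          then have "x \<bullet> u = x \<bullet> v" using u v by (auto simp: vertex_cell_def intro!: antisym)
          then show "v = u" using elim u(1) v by metis
        next
          assume "v = u"
          then show "x \<in> vertex_cell v" using True u by (simp add: vertex_cell_def)
        qed
        then have "(\<Sum>v\<in>vertices24. f x * indicator (vertex_cell v) x) = (\<Sum>v\<in>vertices24. if v = u then f x else 0)"
          by (intro sum.cong) (auto simp: indicator_def)
        also have "\<dots> = f x" using u(1) finite_vertices24 by simp
        finally show ?thesis using True by simp
      qed
    qed
  qed
  also have "\<dots> = (\<Sum>v\<in>vertices24. emeasure hyp_measure (vertex_cell v))"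
    by (subst nn_integral_sum) (auto simp: dens intro!: sum.cong)
  also have "\<dots> = (\<Sum>v\<in>vertices24. ennreal (pi\<^sup>2 / 18))"
    by (intro sum.cong refl emeasure_vertex_cell)
  also have "\<dots> = 24 * ennreal (pi\<^sup>2 / 18)"
    by (simp add: card_vertices24)
  also have "\<dots> = ennreal (4 / 3 * pi\<^sup>2)"
  proof -
    have "(24 :: ennreal) = ennreal 24" by simp
    then show ?thesis by (simp only: ennreal_mult'[symmetric]) (simp add: ennreal_mult'[symmetric])
  qed
  finally show ?thesis by (simp add: hyp_vol_def measure_def)
qed

section \<open>Admissible packings\<close>

lemma vertices24_norm:
  assumes "v \<in> vertices24"
  shows "v \<bullet> v = 1" "norm v = 1"
proof -
  obtain a where "vertex_frame a" "a 1 = v" by (rule vertex_frame_exists[OF assms])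
  then show "v \<bullet> v = 1" using orthonormal_frame_inner[of a 1 1] by (simp add: vertex_frame_def)
  then show "norm v = 1" by (simp add: norm_eq_sqrt_inner)
qed

lemma unit_vectors_inner_eq_1: "v \<bullet> v = 1 \<Longrightarrow> w \<bullet> w = 1 \<Longrightarrow> v \<bullet> w = 1 \<Longrightarrow> v = w"
  for v w :: "'a::real_inner"
  by (metis diff_self eq_iff_diff_eq_0 inner_commute inner_diff_left inner_diff_right inner_eq_zero_iff)

lemma frame_vertices_cases:
  assumes "w \<in> frame_vertices a"
  obtains i s where "w = axis_vertex a i s" | b c d e where "w = cube_vertex a b c d e"
  using assms unfolding frame_vertices_eq_range by auto

lemma cube_vertex_inner_axis:
  assumes "orthonormal_frame a"
  shows "cube_vertex a b c d e \<bullet> axis_vertex a i s \<in> {1 / 2, - 1 / 2}"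
proof -
  have pm: "pm_one s * pm_one t / 2 \<in> {1 / 2, - 1 / 2}" for t by (simp add: pm_one_def)
  show ?thesis
    unfolding inner_commute[of "cube_vertex a b c d e"]
    using exhaust_4[of i] by (elim disjE) (simp_all only: vertex_inner[OF assms] pm)
qed

lemma vertices24_inner:
  assumes v: "v \<in> vertices24" and w: "w \<in> vertices24" and "v \<noteq> w"
  shows "v \<bullet> w \<in> {1 / 2, 0, - 1 / 2, - 1}"
proof -
  obtain a where fr: "vertex_frame a" and a1: "a 1 = v" by (rule vertex_frame_exists[OF v])
  then have a: "orthonormal_frame a" and V: "vertices24 = frame_vertices a" by (auto simp: vertex_frame_def)
  have v1: "v = axis_vertex a 1 True" by (simp add: axis_vertex_def a1)
  have "v \<bullet> w \<noteq> 1" using unit_vectors_inner_eq_1 vertices24_norm(1) v w \<open>v \<noteq> w\<close> by blast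
  moreover from w have "w \<in> frame_vertices a" by (simp add: V)
  then have "v \<bullet> w \<in> {1, 1 / 2, 0, - 1 / 2, - 1}"
    by (cases rule: frame_vertices_cases) (auto simp: v1 vertex_inner[OF a] pm_one_def)
  ultimately show ?thesis by auto
qed

lemma vertices24_inner_less_1:
  assumes "v \<in> vertices24" "w \<in> vertices24" "v \<noteq> w"
  shows "v \<bullet> w < 1"
  using vertices24_inner[OF assms] by auto

lemma facet_hyperplane:
  assumes fr: "vertex_frame a" and F: "F facet_of P24"
  obtains n where "n \<in> frame_normals a" "n \<bullet> n = 2" "F = P24 \<inter> {x. n \<bullet> x = 1}" "affine hull F = {x. n \<bullet> x = 1}"
proof -
  have a: "orthonormal_frame a" using fr by (simp add: vertex_frame_def)
  obtain n where n: "n \<in> frame_normals a" "F = P24 \<inter> {x. n \<bullet> x = 1}"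
    using F facet_of_P24_iff[OF fr] by auto
  have nn: "n \<bullet> n = 2" by (rule frame_normals_inner_self[OF n(1) a])
  show ?thesis
  proof (rule that[OF n(1) nn n(2)])
    show "affine hull F = {x. n \<bullet> x = 1}"
      using n(2) by (intro affine_hull_facet_of_P24[OF F nn]) auto
  qed
qed

text \<open>
  For necessity it suffices to find one facet whose normal is orthogonal to \<open>v\<close>.
\<close>

lemma facet_condition_iff:
  assumes v: "v \<in> vertices24" and c: "c > 0"
  shows "(\<forall>F. F facet_of P24 \<and> v \<notin> affine hull F \<longrightarrow> interior (horoball v c) \<inter> affine hull F = {}) \<longleftrightarrow> c \<le> 1"
proof
  obtain a where fr: "vertex_frame a" and a1: "a 1 = v" by (rule vertex_frame_exists[OF v])
  then have a: "orthonormal_frame a" by (simp add: vertex_frame_def)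
  note nv = vertices24_norm(2)[OF v]
  {
    assume R: "\<forall>F. F facet_of P24 \<and> v \<notin> affine hull F \<longrightarrow> interior (horoball v c) \<inter> affine hull F = {}"
    define n where "n = 1 *\<^sub>R a 2 + 1 *\<^sub>R a 3"
    have n: "n \<in> frame_normals a" unfolding n_def by (rule frame_normalsI) auto
    have nn: "n \<bullet> n = 2" by (rule frame_normals_inner_self[OF n a])
    have vn: "v \<bullet> n = 0" by (simp add: n_def a1[symmetric] inner_add_right orthonormal_frame_inner[OF a])
    have F: "P24 \<inter> {x. n \<bullet> x = 1} facet_of P24" using n facet_of_P24_iff[OF fr] by blast
    have "affine hull (P24 \<inter> {x. n \<bullet> x = 1}) = {x. n \<bullet> x = 1}"
      by (rule affine_hull_facet_of_P24[OF F nn]) blast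
    then have disj: "interior (horoball v c) \<inter> {x. n \<bullet> x = 1} = {}"
      using R F vn by (metis (mono_tags, lifting) inner_commute mem_Collect_eq zero_neq_one)
    show "c \<le> 1"
    proof (rule ccontr)
      assume "\<not> c \<le> 1"
      then have "1 < c" by simp
      from horoball_hyperplane_meet[OF nv nn vn this] show False using disj by contradiction
    qed
  next
    assume c1: "c \<le> 1"
    show "\<forall>F. F facet_of P24 \<and> v \<notin> affine hull F \<longrightarrow> interior (horoball v c) \<inter> affine hull F = {}"
    proof (intro allI impI, elim conjE)
      fix F assume F: "F facet_of P24" and vF: "v \<notin> affine hull F"
      obtain n where n: "n \<in> frame_normals a" "n \<bullet> n = 2" "affine hull F = {x. n \<bullet> x = 1}"
        by (rule facet_hyperplane[OF fr F], rule that)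
      obtain i j s t where ij: "n = s *\<^sub>R a i + t *\<^sub>R a j" "i \<noteq> j" "s \<in> {-1, 1}" "t \<in> {-1, 1}" "n \<bullet> n = 2"
          "\<And>k. n \<bullet> a k = (if k = i then s else if k = j then t else 0)"
        by (rule frame_normalsE[OF n(1) a], rule that)
      have "n \<bullet> v \<noteq> 1" using vF n(3) by simp
      then have "v \<bullet> n \<le> 0" using ij(3,4) ij(6)[of 1] by (auto simp: a1 inner_commute[of v] split: if_splits)
      then show "interior (horoball v c) \<inter> affine hull F = {}"
        unfolding n(3) by (rule horoball_hyperplane_disjoint[OF nv n(2) _ c c1])
    qed
  }
qed

lemma admissible_packing_iff:
  assumes B: "\<And>v. v \<in> vertices24 \<Longrightarrow> B v = horoball v (c v)" and c: "\<And>v. v \<in> vertices24 \<Longrightarrow> c v > 0"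
  shows "admissible_packing B \<longleftrightarrow> (\<forall>v\<in>vertices24. c v \<le> 1) \<and>
    (\<forall>v\<in>vertices24. \<forall>w\<in>vertices24. v \<noteq> w \<longrightarrow> c v * c w \<le> (1 - v \<bullet> w) / 2)"
proof -
  have "is_horoball v (B v)" if "v \<in> vertices24" for v
    unfolding is_horoball_def using that B c vertices24_norm(2) by blast
  moreover have "interior (B v) \<inter> interior (B w) = {} \<longleftrightarrow> c v * c w \<le> (1 - v \<bullet> w) / 2"
    if "v \<in> vertices24" "w \<in> vertices24" "v \<noteq> w" for v w
    unfolding B[OF that(1)] B[OF that(2)]
    by (rule horoballs_disjoint_iff) (use that c vertices24_norm(2) vertices24_inner_less_1 in auto)
  moreover have "(\<forall>F. F facet_of P24 \<and> v \<notin> affine hull F \<longrightarrow> interior (B v) \<inter> affine hull F = {}) \<longleftrightarrow> c v \<le> 1"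
    if "v \<in> vertices24" for v
    unfolding B[OF that] by (rule facet_condition_iff[OF that c[OF that]])
  ultimately show ?thesis unfolding admissible_packing_def by blast
qed

lemma packing_density_eq:
  assumes B: "\<And>v. v \<in> vertices24 \<Longrightarrow> B v = horoball v (c v)" and c: "\<And>v. v \<in> vertices24 \<Longrightarrow> 0 < c v \<and> c v \<le> 1"
  shows "packing_density B = (\<Sum>v\<in>vertices24. 8 * c v ^ 3) / (4 * pi\<^sup>2)"
proof -
  have "(\<Sum>v\<in>vertices24. hyp_vol (B v \<inter> P24)) = (\<Sum>v\<in>vertices24. 8 * c v ^ 3 / 3)"
    using B c by (intro sum.cong) (simp_all add: hyp_vol_horoball_Int_P24)
  also have "\<dots> = (\<Sum>v\<in>vertices24. 8 * c v ^ 3) / 3" by (simp add: sum_divide_distrib)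
  finally show ?thesis by (simp add: packing_density_def hyp_vol_P24)
qed

lemma is_horoball_family_radii:
  assumes "\<forall>v\<in>vertices24. is_horoball v (B v)"
  obtains c where "\<And>v. v \<in> vertices24 \<Longrightarrow> B v = horoball v (c v)" "\<And>v. v \<in> vertices24 \<Longrightarrow> c v > (0::real)"
proof -
  have "\<forall>v\<in>vertices24. \<exists>c. c > 0 \<and> B v = horoball v c"
    using assms by (auto simp: is_horoball_def)
  then obtain c where "\<forall>v\<in>vertices24. c v > 0 \<and> B v = horoball v (c v)" by (metis bchoice)
  then show ?thesis using that[of c] by auto
qed

lemma packing_density_le:
  assumes "admissible_packing B"
  shows "packing_density B \<le> 5 * sqrt 2 / pi\<^sup>2"
proof -
  have H: "\<forall>v\<in>vertices24. is_horoball v (B v)" using assms by (simp add: admissible_packing_def)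
  obtain c where B: "\<And>v. v \<in> vertices24 \<Longrightarrow> B v = horoball v (c v)" and c: "\<And>v. v \<in> vertices24 \<Longrightarrow> c v > 0"
    by (rule is_horoball_family_radii[OF H], rule that)
  have c1: "c v \<le> 1" if "v \<in> vertices24" for v
    using assms that admissible_packing_iff[of B c, OF B c] by blast
  have cc: "8 * c v ^ 3 * (8 * c w ^ 3) \<le> 64 * ((1 - v \<bullet> w) / 2) ^ 3" if "v \<in> vertices24" "w \<in> vertices24" "v \<bullet> w < 1" for v w
  proof -
    have "v \<noteq> w" using that vertices24_norm(1)[OF that(1)] by auto
    then have "c v * c w \<le> (1 - v \<bullet> w) / 2"
      using assms that admissible_packing_iff[of B c, OF B c] by blast
    then have "(c v * c w) ^ 3 \<le> ((1 - v \<bullet> w) / 2) ^ 3"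
      using c[OF that(1)] c[OF that(2)] by (intro power_mono) auto
    then show ?thesis by (simp add: power_mult_distrib)
  qed
  have "(\<Sum>v\<in>vertices24. 8 * c v ^ 3) \<le> 20 * sqrt 2"
  proof (rule vertex_weights_bound)
    fix v assume v: "v \<in> vertices24"
    show "0 \<le> 8 * c v ^ 3" using c[OF v] by simp
    show "8 * c v ^ 3 \<le> 8" using c[OF v] c1[OF v] by (simp add: power_le_one)
  next
    fix v w assume vw: "v \<in> vertices24" "w \<in> vertices24" "v \<bullet> w = 1 / 2"
    show "8 * c v ^ 3 * (8 * c w ^ 3) \<le> 1" using cc[OF vw(1,2)] unfolding vw(3) by (simp add: power3_eq_cube)
  next
    fix v w assume vw: "v \<in> vertices24" "w \<in> vertices24" "v \<bullet> w = 0"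
    show "8 * c v ^ 3 * (8 * c w ^ 3) \<le> 8" using cc[OF vw(1,2)] unfolding vw(3) by (simp add: power3_eq_cube)
  next
    fix v w assume vw: "v \<in> vertices24" "w \<in> vertices24" "v \<bullet> w = - 1 / 2"
    show "8 * c v ^ 3 * (8 * c w ^ 3) \<le> 27" using cc[OF vw(1,2)] unfolding vw(3) by (simp add: power3_eq_cube)
  qed
  moreover have "packing_density B = (\<Sum>v\<in>vertices24. 8 * c v ^ 3) / (4 * pi\<^sup>2)"
    by (rule packing_density_eq) (use B c c1 in auto)
  ultimately have "packing_density B \<le> 20 * sqrt 2 / (4 * pi\<^sup>2)"
    using divide_right_mono[of "\<Sum>v\<in>vertices24. 8 * c v ^ 3" "20 * sqrt 2" "4 * pi\<^sup>2"] by simp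
  then show ?thesis by simp
qed

lemma large_frame_orthonormal: "orthonormal_frame large_frame"
  and vertices24_large_frame: "vertices24 = frame_vertices large_frame"
  using vertex_frame_large by (auto simp: vertex_frame_def)

lemma large_centresE:
  assumes "v \<in> large_centres"
  obtains i s where "v = axis_vertex large_frame i s"
proof -
  obtain i s where "v = s *\<^sub>R large_frame i" "s \<in> {-1, 1}" using assms unfolding large_centres_eq by blast
  then have "v = axis_vertex large_frame i (s = 1)" by (auto simp: axis_vertex_def pm_one_def)
  then show ?thesis by (rule that)
qed

lemma axis_vertex_large: "axis_vertex large_frame i s \<in> large_centres"
proof -
  have "pm_one s \<in> {-1, 1}" by (simp add: pm_one_def)
  then show ?thesis unfolding large_centres_eq axis_vertex_def by blast
qed

lemma small_centresE:
  assumes "v \<in> vertices24 - large_centres"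
  obtains b c d e where "v = cube_vertex large_frame b c d e"
proof -
  have "v \<in> frame_vertices large_frame" using assms by (simp add: vertices24_large_frame)
  then show ?thesis
    by (cases rule: frame_vertices_cases) (use assms axis_vertex_large that in auto)
qed

lemma small_large_inner:
  assumes "v \<in> vertices24 - large_centres" "w \<in> large_centres"
  shows "v \<bullet> w \<in> {1 / 2, - 1 / 2}"
proof -
  obtain b c d e where v: "v = cube_vertex large_frame b c d e" by (rule small_centresE[OF assms(1)])
  obtain i s where w: "w = axis_vertex large_frame i s" by (rule large_centresE[OF assms(2)])
  show ?thesis unfolding v w by (rule cube_vertex_inner_axis[OF large_frame_orthonormal])
qed

lemma cube_vertex_small: "cube_vertex large_frame b c d e \<in> vertices24 - large_centres"
proof -
  have "cube_vertex large_frame b c d e \<noteq> axis_vertex large_frame i s" for i s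
  proof
    assume eq: "cube_vertex large_frame b c d e = axis_vertex large_frame i s"
    have "axis_vertex large_frame i s \<bullet> axis_vertex large_frame i s = 1"
      by (simp add: vertex_inner[OF large_frame_orthonormal])
    then show False using cube_vertex_inner_axis[OF large_frame_orthonormal, of b c d e i s] unfolding eq by simp
  qed
  then have "cube_vertex large_frame b c d e \<notin> large_centres" by (metis large_centresE)
  moreover have "cube_vertex large_frame b c d e \<in> vertices24"
    unfolding vertices24_large_frame frame_vertices_eq_range
    by (rule UnI2, rule range_eqI[of _ _ "(b, c, d, e)"]) simp
  ultimately show ?thesis by blast
qed

text \<open>
  The functional \<open>v + w\<close> attains its maximum \<open>3/2\<close> over the vertices at \<open>v\<close> and \<open>w\<close> only.
\<close>

lemma joined_by_edge_if_inner_half: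
  assumes v: "v \<in> vertices24" and w: "w \<in> vertices24" and vw: "v \<bullet> w = 1 / 2"
  shows "joined_by_edge v w"
proof -
  have ne: "v \<noteq> w" using vw vertices24_norm(1)[OF v] by auto
  define T where "T = P24 \<inter> {x. (v + w) \<bullet> x = 3 / 2}"
  have vert: "(v + w) \<bullet> x \<le> 3 / 2 \<and> ((v + w) \<bullet> x = 3 / 2 \<longrightarrow> x = v \<or> x = w)" if x: "x \<in> vertices24" for x
  proof (cases "x = v \<or> x = w")
    case True
    then show ?thesis using vw vertices24_norm(1)[OF v] vertices24_norm(1)[OF w]
      by (auto simp: inner_add_left inner_commute[of w v])
  next
    case False
    then have "v \<bullet> x \<le> 1 / 2" "w \<bullet> x \<le> 1 / 2"
      using vertices24_inner[OF v x] vertices24_inner[OF w x] by auto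
    then show ?thesis by (simp add: inner_add_left)
  qed
  have "P24 \<subseteq> {x. (v + w) \<bullet> x \<le> 3 / 2}"
    unfolding P24_def using vert by (intro hull_minimal convex_halfspace_le) auto
  then have T: "T face_of P24"
    unfolding T_def P24_def[symmetric] by (intro face_of_Int_supporting_hyperplane_le) (auto simp: P24_def)
  obtain S where S: "S \<subseteq> vertices24" "T = convex hull S"
    using face_of_convex_hull_subset[of vertices24 T] T finite_vertices24 unfolding P24_def by (metis finite_imp_compact)
  have "S \<subseteq> {v, w}"
  proof
    fix x assume x: "x \<in> S"
    then have "x \<in> T" using S(2) hull_inc by fastforce
    then show "x \<in> {v, w}" using vert[of x] S(1) x by (auto simp: T_def)
  qed
  then have "T \<subseteq> convex hull {v, w}" unfolding S(2) by (rule hull_mono)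
  moreover have "convex hull {v, w} \<subseteq> T"
  proof (rule hull_minimal)
    have "v \<in> P24" "w \<in> P24" using v w hull_inc unfolding P24_def by fastforce+
    then show "{v, w} \<subseteq> T" using vw vertices24_norm(1)[OF v] vertices24_norm(1)[OF w]
      by (auto simp: T_def inner_add_left inner_commute[of w v])
    show "convex T" using T by (rule face_of_imp_convex)
  qed
  ultimately have "T = closed_segment v w" by (simp add: segment_convex_hull)
  then have "closed_segment v w face_of P24" using T by simp
  moreover have "aff_dim (closed_segment v w) = 1" using ne by (simp add: segment_convex_hull aff_dim_convex_hull aff_dim_2)
  ultimately show ?thesis by (simp add: joined_by_edge_def edge_of_def)
qed

text \<open>
  Shows that a segment is no edge by exhibiting another segment of the polytope with the same
  midpoint.
\<close>

lemma edge_midpoint_extreme: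
  assumes "joined_by_edge v w" "x \<in> P24" "y \<in> P24" "x \<noteq> y" "v + w = x + y"
  shows "x \<in> closed_segment v w"
proof -
  have "closed_segment v w face_of P24" using assms(1) by (simp add: joined_by_edge_def edge_of_def)
  moreover have "midpoint v w \<in> closed_segment v w" by simp
  moreover have "midpoint v w = midpoint x y" using assms(5) by (simp add: midpoint_def)
  then have "midpoint v w \<in> open_segment x y" using assms(4) by simp
  ultimately show ?thesis using assms(2,3) unfolding face_of_def by blast
qed

lemma frame_coords_eqI:
  assumes a: "orthonormal_frame a" and "\<And>k. u \<bullet> a k = u' \<bullet> a k"
  shows "u = u'"
proof -
  have "(u - u') \<bullet> a k = 0" for k using assms(2)[of k] by (simp add: inner_diff_left)
  then have "(u - u') \<bullet> (u - u') = 0" using norm_in_frame[OF a, of "u - u'"] by simp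
  then show ?thesis by simp
qed

text \<open>
  The two vertices are opposite in an octahedral facet, so another diagonal of this facet has the
  same midpoint.
\<close>

lemma axis_vertices_not_joined:
  assumes "i \<noteq> j"
  shows "\<not> joined_by_edge (axis_vertex large_frame i s) (axis_vertex large_frame j t)"
proof
  let ?v = "axis_vertex large_frame i s" and ?w = "axis_vertex large_frame j t"
  assume J: "joined_by_edge ?v ?w"
  define e where "e k = (if k = i then pm_one s else if k = j then pm_one t else 1)" for k
  define e' where "e' k = (if k = i then pm_one s else if k = j then pm_one t else - 1)" for k
  define x where "x = (1 / 2) *\<^sub>R (\<Sum>k\<in>UNIV. e k *\<^sub>R large_frame k)"
  define y where "y = (1 / 2) *\<^sub>R (\<Sum>k\<in>UNIV. e' k *\<^sub>R large_frame k)"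
  have "x \<in> vertices24" "y \<in> vertices24"
  proof -
    have "\<forall>k. e k \<in> {-1, 1}" "\<forall>k. e' k \<in> {-1, 1}" by (auto simp: e_def e'_def pm_one_def)
    then show "x \<in> vertices24" "y \<in> vertices24"
      unfolding vertices24_large_frame frame_vertices_def x_def y_def by blast+
  qed
  then have xy: "x \<in> P24" "y \<in> P24" using hull_inc unfolding P24_def by fastforce+
  have xk: "x \<bullet> large_frame k = e k / 2" "y \<bullet> large_frame k = e' k / 2" for k
    by (simp_all add: x_def y_def inner_sign_sum[OF large_frame_orthonormal])
  have vk: "?v \<bullet> large_frame k = (if k = i then pm_one s else 0)" "?w \<bullet> large_frame k = (if k = j then pm_one t else 0)" for k
    by (auto simp: axis_vertex_def orthonormal_frame_inner[OF large_frame_orthonormal])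
  obtain k where k: "k \<noteq> i" "k \<noteq> j"
  proof -
    have "card {i, j} < card (UNIV :: 4 set)" by (simp add: card_insert_if)
    then have "{i, j} \<noteq> UNIV" by (metis less_irrefl)
    then show ?thesis using that by auto
  qed
  have "x \<bullet> large_frame k = 1 / 2" "y \<bullet> large_frame k = - 1 / 2" using k by (simp_all add: xk e_def e'_def)
  then have "x \<noteq> y" by auto
  moreover have "?v + ?w = x + y"
  proof -
    show ?thesis by (rule frame_coords_eqI[OF large_frame_orthonormal]) (use assms in \<open>auto simp: inner_add_left xk vk e_def e'_def\<close>)
  qed
  ultimately have "x \<in> closed_segment ?v ?w" using edge_midpoint_extreme[OF J xy] by blast
  then obtain u where "x = (1 - u) *\<^sub>R ?v + u *\<^sub>R ?w" unfolding closed_segment_def by blast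
  then have "x \<bullet> large_frame k = 0" using k by (simp add: inner_add_left vk)
  then show False using k by (simp add: xk e_def)
qed

text \<open>
  If the inner product is \<open>-1/2\<close>, then \<open>v + w\<close> is a vertex, and the segment from it to the
  centre of the polytope passes through the midpoint of \<open>v\<close> and \<open>w\<close>.
\<close>

lemma joined_by_edge_inner:
  assumes v: "v \<in> vertices24" and w: "w \<in> vertices24" and J: "joined_by_edge v w"
  shows "v \<bullet> w \<noteq> - 1 / 2"
proof
  assume vw: "v \<bullet> w = - 1 / 2"
  note nv = vertices24_norm(1)[OF v] and nw = vertices24_norm(1)[OF w]
  have sub: "vertices24 \<subseteq> P24" unfolding P24_def by (rule hull_subset)
  have cv: "convex P24" by (simp add: P24_def)
  obtain a where fr: "vertex_frame a" and a1: "a 1 = v" by (rule vertex_frame_exists[OF v])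
  then have a: "orthonormal_frame a" and V: "vertices24 = frame_vertices a" by (auto simp: vertex_frame_def)
  have v1: "v = axis_vertex a 1 True" by (simp add: axis_vertex_def a1)
  have "w \<in> frame_vertices a" using w by (simp add: V)
  then obtain b c d e where w': "w = cube_vertex a b c d e"
    by (cases rule: frame_vertices_cases) (use vw in \<open>auto simp: v1 vertex_inner[OF a] split: if_splits\<close>, simp add: pm_one_def split: if_splits)
  have "pm_one b = - 1" using vw by (simp add: w' v1 vertex_inner[OF a])
  then have b: "b = False" by (simp add: pm_one_def split: if_splits)
  have "v + w = cube_vertex a True c d e"
    by (simp add: w' b v1 axis_vertex_def cube_vertex_def vec_eq_iff algebra_simps)
  then have "v + w \<in> vertices24" unfolding V frame_vertices_eq_range by (auto intro: range_eqI[of _ _ "(True, c, d, e)"])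
  then have P1: "v + w \<in> P24" using sub by blast
  have P0: "0 \<in> P24"
  proof -
    have "axis_vertex a 1 False \<in> frame_vertices a"
      unfolding frame_vertices_eq_range by (rule UnI1, rule range_eqI[of _ _ "(1, False)"]) simp
    then have "- v \<in> P24" using sub by (auto simp: axis_vertex_def a1 V)
    moreover have "v \<in> P24" using v sub by blast
    ultimately have "(1 / 2) *\<^sub>R v + (1 / 2) *\<^sub>R (- v) \<in> P24" by (intro convexD[OF cv]) auto
    then show ?thesis by simp
  qed
  have "0 \<noteq> v + w"
  proof
    assume "0 = v + w"
    then have "w = - v" by (simp add: eq_neg_iff_add_eq_0 add.commute)
    then show False using vw nv by simp
  qed
  then have "0 \<in> closed_segment v w" using edge_midpoint_extreme[OF J P0 P1] by simp
  then obtain u where u: "0 = (1 - u) *\<^sub>R v + u *\<^sub>R w" unfolding closed_segment_def by auto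
  have "((1 - u) *\<^sub>R v + u *\<^sub>R w) \<bullet> v = 0" "((1 - u) *\<^sub>R v + u *\<^sub>R w) \<bullet> w = 0" by (simp_all flip: u)
  then show False using vw nv nw by (simp add: inner_add_left inner_commute[of w v])
qed

section \<open>The optimal arrangement\<close>

text \<open>
  Two opposite vertices of a facet add up to the normal \<open>n\<close> of the facet, and the facet is
  symmetric about \<open>n / 2\<close>; so this point is the average of the vertices.
\<close>

lemma facet_diagonal_large:
  assumes F: "F facet_of P24" and v: "v \<in> large_centres" and w: "w \<in> large_centres" and d: "facet_diagonal F v w"
  shows "v \<bullet> w = 0" "facet_centre F = (1 / 2) *\<^sub>R (v + w)"
proof -
  let ?a = large_frame
  note a = large_frame_orthonormal
  obtain n where n: "n \<bullet> n = 2" "F = P24 \<inter> {x. n \<bullet> x = 1}"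
    by (rule facet_hyperplane[OF vertex_frame_large F], rule that)
  obtain i s where vi: "v = axis_vertex ?a i s" by (rule large_centresE[OF v])
  obtain j t where wj: "w = axis_vertex ?a j t" by (rule large_centresE[OF w])
  have nvw: "n \<bullet> v = 1" "n \<bullet> w = 1" "v \<noteq> w" using d by (auto simp: facet_diagonal_def n(2))
  have ij: "i \<noteq> j"
  proof
    assume "i = j"
    have "s \<noteq> t"
    proof
      assume "s = t"
      with \<open>i = j\<close> have "v = w" by (simp add: vi wj)
      with nvw(3) show False by simp
    qed
    then have "pm_one t = - pm_one s" by (simp add: pm_one_def)
    then have "w = - v" by (simp add: vi wj axis_vertex_def \<open>i = j\<close>)
    then show False using nvw by simp
  qed
  show vw: "v \<bullet> w = 0" using ij by (simp add: vi wj vertex_inner[OF a])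
  have vv: "v \<bullet> v = 1" "w \<bullet> w = 1" by (simp_all add: vi wj vertex_inner[OF a])
  have "(n - (v + w)) \<bullet> (n - (v + w)) = 0"
    using n(1) nvw vv vw by (simp add: inner_diff_left inner_diff_right inner_add_left inner_add_right inner_commute[of v n] inner_commute[of w n] inner_commute[of w v])
  then have nsum: "n = v + w" by simp
  have nk: "n \<bullet> ?a k = (if k = i then pm_one s else if k = j then pm_one t else 0)" for k
    using ij by (auto simp: nsum vi wj axis_vertex_def inner_add_left orthonormal_frame_inner[OF a])
  \<comment> \<open>the octahedron is symmetric about the point \<open>n / 2\<close>\<close>
  have refl: "n - x \<in> vertices24 \<inter> F" if x: "x \<in> vertices24 \<inter> F" for x
  proof -
    have nx: "n \<bullet> x = 1" using x by (simp add: n(2))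
    have "x \<in> frame_vertices ?a" using x by (simp add: vertices24_large_frame)
    then have "n - x \<in> frame_vertices ?a"
      unfolding frame_vertices_def[of ?a]
    proof (elim UnE CollectE exE conjE)
      fix k r assume r: "x = r *\<^sub>R ?a k" "r \<in> {-1, 1}"
      then have "r * (n \<bullet> ?a k) = 1" using nx by simp
      then have "(k = i \<and> r = pm_one s) \<or> (k = j \<and> r = pm_one t)"
        using r(2) by (auto simp: nk pm_one_def split: if_splits)
      then have "n - x = pm_one t *\<^sub>R ?a j \<or> n - x = pm_one s *\<^sub>R ?a i"
        using r(1) by (auto simp: nsum vi wj axis_vertex_def)
      moreover have "pm_one t \<in> {-1, 1}" "pm_one s \<in> {-1, 1}" by (simp_all add: pm_one_def)
      ultimately show "n - x \<in> {s *\<^sub>R ?a i |i s. s \<in> {-1, 1}} \<union> {(1 / 2) *\<^sub>R (\<Sum>i\<in>UNIV. s i *\<^sub>R ?a i) |s. \<forall>i. s i \<in> {-1, 1}}"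
        by blast
    next
      fix r assume r: "x = (1 / 2) *\<^sub>R (\<Sum>i\<in>UNIV. r i *\<^sub>R ?a i)" "\<forall>i. r i \<in> {-1, 1}"
      have xk: "x \<bullet> ?a k = r k / 2" for k by (simp add: r(1) inner_sign_sum[OF a])
      have "x \<bullet> n = pm_one s * (r i / 2) + pm_one t * (r j / 2)"
        by (simp add: nsum vi wj axis_vertex_def inner_add_right xk)
      then have "pm_one s * r i + pm_one t * r j = 2" using nx by (simp add: inner_commute[of x n])
      moreover have "r i \<in> {-1, 1}" "r j \<in> {-1, 1}" using r(2) by blast+
      ultimately have rij: "r i = pm_one s" "r j = pm_one t" by (auto simp: pm_one_def split: if_splits)
      define r' where "r' k = (if k = i \<or> k = j then r k else - r k)" for k
      have "n - x = (1 / 2) *\<^sub>R (\<Sum>k\<in>UNIV. r' k *\<^sub>R ?a k)"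
        by (rule frame_coords_eqI[OF a]) (use ij in \<open>auto simp: inner_diff_left xk nk inner_sign_sum[OF a] r'_def rij\<close>)
      moreover have "\<forall>k. r' k \<in> {-1, 1}" using r(2) by (auto simp: r'_def)
      ultimately show "n - x \<in> {s *\<^sub>R ?a i |i s. s \<in> {-1, 1}} \<union> {(1 / 2) *\<^sub>R (\<Sum>i\<in>UNIV. s i *\<^sub>R ?a i) |s. \<forall>i. s i \<in> {-1, 1}}"
        by blast
    qed
    then have V: "n - x \<in> vertices24" by (simp add: vertices24_large_frame)
    then have "n - x \<in> P24" unfolding P24_def by (rule hull_inc)
    then show ?thesis using V nx n(1) by (simp add: n(2) inner_diff_right)
  qed
  define S where "S = vertices24 \<inter> F"
  have fin: "finite S" using finite_vertices24 by (simp add: S_def)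
  have "v \<in> S" using d by (simp add: facet_diagonal_def S_def)
  then have card: "card S \<noteq> 0" using fin by auto
  have "(\<Sum>x\<in>S. x) = (\<Sum>x\<in>S. n - x)"
    by (rule sum.reindex_bij_witness[of _ "\<lambda>x. n - x" "\<lambda>x. n - x"]) (use refl in \<open>auto simp: S_def\<close>)
  also have "\<dots> = real (card S) *\<^sub>R n - (\<Sum>x\<in>S. x)" by (simp add: sum_subtractf scaleR_conv_of_real sum_constant_scaleR)
  finally have twice: "2 *\<^sub>R (\<Sum>x\<in>S. x) = real (card S) *\<^sub>R n" by (simp add: scaleR_2)
  have "(\<Sum>x\<in>S. x) = (1 / 2) *\<^sub>R (2 *\<^sub>R (\<Sum>x\<in>S. x))" by simp
  also have "\<dots> = (real (card S) / 2) *\<^sub>R n" unfolding twice by simp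
  finally have "(\<Sum>x\<in>S. x) = (real (card S) / 2) *\<^sub>R n" .
  then show "facet_centre F = (1 / 2) *\<^sub>R (v + w)"
    unfolding facet_centre_def S_def[symmetric] nsum[symmetric] using card by simp
qed

lemma large_centre_on_diagonal:
  assumes v: "v \<in> large_centres"
  obtains F w where "F facet_of P24" "w \<in> large_centres" "facet_diagonal F v w"
proof -
  note a = large_frame_orthonormal
  obtain i s where vi: "v = axis_vertex large_frame i s" by (rule large_centresE[OF v])
  obtain j :: 4 where j: "j \<noteq> i"
  proof -
    have "(1::4) \<noteq> 2" by simp
    then show ?thesis using that by metis
  qed
  define w where "w = axis_vertex large_frame j True"
  have w: "w \<in> large_centres" unfolding w_def by (rule axis_vertex_large)
  have "pm_one s *\<^sub>R large_frame i + pm_one True *\<^sub>R large_frame j \<in> frame_normals large_frame"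
    using j by (intro frame_normalsI) (auto simp: pm_one_def)
  then have "v + w \<in> frame_normals large_frame" by (simp add: vi w_def axis_vertex_def)
  then have F: "P24 \<inter> {x. (v + w) \<bullet> x = 1} facet_of P24" using facet_of_P24_iff[OF vertex_frame_large] by blast
  have inner: "v \<bullet> v = 1" "w \<bullet> w = 1" "v \<bullet> w = 0" using j by (simp_all add: vi w_def vertex_inner[OF a])
  have "v \<in> vertices24" "w \<in> vertices24" using v w large_centres_subset by auto
  moreover from this have "v \<in> P24" "w \<in> P24" unfolding P24_def by (auto intro: hull_inc)
  moreover have "v \<noteq> w" using inner by auto
  moreover have "\<not> joined_by_edge v w" unfolding vi w_def using j by (intro axis_vertices_not_joined) simp
  ultimately have "facet_diagonal (P24 \<inter> {x. (v + w) \<bullet> x = 1}) v w"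
    using inner by (simp add: facet_diagonal_def inner_add_left inner_commute[of w v])
  with F w show ?thesis by (rule that)
qed

definition optimal_radius :: "real^4 \<Rightarrow> real" where
  "optimal_radius v = (if v \<in> large_centres then 1 / sqrt 2 else sqrt 2 / 4)"

lemma optimal_radius_bounds: "0 < optimal_radius v" "optimal_radius v \<le> 1"
proof -
  have "sqrt 2 \<le> 2" using sqrt2_less_2 by simp
  then show "0 < optimal_radius v" "optimal_radius v \<le> 1" by (auto simp: optimal_radius_def)
qed

text \<open>
  The midpoint of orthogonal vertices \<open>u\<close> and \<open>w\<close> lies in both large horoballs, which makes
  both numbers at least \<open>1 / sqrt 2\<close>, while their product is \<open>1/2\<close> as they touch.  The small
  horoballs then follow from the tangency along an edge.
\<close>

lemma arrangement_B1_radii: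
  assumes B1: "arrangement_B1 B" and v: "v \<in> vertices24"
  shows "B v = horoball v (optimal_radius v)"
proof -
  have H: "\<forall>v\<in>vertices24. is_horoball v (B v)" using B1 by (simp add: arrangement_B1_def)
  obtain c where B: "\<And>v. v \<in> vertices24 \<Longrightarrow> B v = horoball v (c v)" and c: "\<And>v. v \<in> vertices24 \<Longrightarrow> c v > 0"
    by (rule is_horoball_family_radii[OF H], rule that)
  have large: "c u = 1 / sqrt 2" if u: "u \<in> large_centres" for u
  proof -
    obtain F w where F: "F facet_of P24" and w: "w \<in> large_centres" and d: "facet_diagonal F u w"
      by (rule large_centre_on_diagonal[OF u])
    have u': "u \<in> vertices24" and w': "w \<in> vertices24" using u w large_centres_subset by auto
    note nu = vertices24_norm[OF u'] and nw = vertices24_norm[OF w']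
    note uw = facet_diagonal_large(1)[OF F u w d]
    define p where "p = (1 / 2) *\<^sub>R (u + w)"
    have "touch_at (B u) (B w) (facet_centre F)" using B1 F u w d by (simp add: arrangement_B1_def)
    then have t: "touch_at (horoball u (c u)) (horoball w (c w)) p"
      by (simp add: B[OF u'] B[OF w'] p_def facet_diagonal_large(2)[OF F u w d])
    have prod: "c u * c w = (1 - u \<bullet> w) / 2"
      by (rule touch_at_imp_eq[OF nu(2) nw(2) _ c[OF u'] c[OF w'] t]) (simp add: uw)
    have pp: "p \<bullet> p = 1 / 2" "p \<bullet> u = 1 / 2" "p \<bullet> w = 1 / 2"
      using nu(1) nw(1) uw by (simp_all add: p_def inner_add_left inner_add_right inner_commute[of w u])
    have "(1 / 2)\<^sup>2 \<le> (c u)\<^sup>2 * (1 / 2)" "(1 / 2)\<^sup>2 \<le> (c w)\<^sup>2 * (1 / 2)"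
      using t unfolding touch_at_def Int_iff horoball_iff[OF nu(2) c[OF u']] horoball_iff[OF nw(2) c[OF w']] pp by simp_all
    then have ge: "1 / 2 \<le> (c u)\<^sup>2" "1 / 2 \<le> (c w)\<^sup>2" by (simp_all add: power2_eq_square)
    have half: "c u * c w = 1 / 2" using prod uw by simp
    have "(c u * c w)\<^sup>2 = 1 / 4" unfolding half by (simp add: power2_eq_square)
    then have "(c u)\<^sup>2 * (c w)\<^sup>2 = 1 / 4" by (simp only: power_mult_distrib)
    moreover have "(c u)\<^sup>2 * (1 / 2) \<le> (c u)\<^sup>2 * (c w)\<^sup>2" using ge(2) by (intro mult_left_mono) auto
    ultimately have "(c u)\<^sup>2 = 1 / 2" using ge(1) by linarith
    then have "c u = sqrt (1 / 2)" using c[OF u'] by (metis real_sqrt_unique less_imp_le)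
    then show ?thesis by (simp add: real_sqrt_divide)
  qed
  have small: "c u = sqrt 2 / 4" if u: "u \<in> vertices24 - large_centres" for u
  proof -
    obtain b c' d e where ub: "u = cube_vertex large_frame b c' d e" by (rule small_centresE[OF u])
    define w where "w = axis_vertex large_frame 1 b"
    have w: "w \<in> large_centres" unfolding w_def by (rule axis_vertex_large)
    have u': "u \<in> vertices24" and w': "w \<in> vertices24" using u w large_centres_subset by auto
    have uw: "u \<bullet> w = 1 / 2"
      by (simp add: ub w_def inner_commute[of "cube_vertex large_frame b c' d e"] vertex_inner[OF large_frame_orthonormal])
    have "joined_by_edge u w" by (rule joined_by_edge_if_inner_half[OF u' w' uw])
    then obtain p where "touch_at (B u) (B w) p" using B1 u w unfolding arrangement_B1_def by blast
    then have t: "touch_at (horoball u (c u)) (horoball w (c w)) p" by (simp add: B[OF u'] B[OF w'])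
    have "c u * c w = (1 - u \<bullet> w) / 2"
      by (rule touch_at_imp_eq[OF vertices24_norm(2)[OF u'] vertices24_norm(2)[OF w'] _ c[OF u'] c[OF w'] t]) (simp add: uw)
    then have quot: "c u * (1 / sqrt 2) = 1 / 4" unfolding large[OF w] uw by (rule trans) simp
    have "c u = c u * (1 / sqrt 2) * sqrt 2" by simp
    also have "\<dots> = 1 / 4 * sqrt 2" unfolding quot ..
    also have "\<dots> = sqrt 2 / 4" by simp
    finally show ?thesis .
  qed
  have "c v = optimal_radius v"
  proof (cases "v \<in> large_centres")
    case True
    then show ?thesis unfolding optimal_radius_def if_P[OF True] by (rule large)
  next
    case False
    with v have "v \<in> vertices24 - large_centres" by blast
    then show ?thesis unfolding optimal_radius_def if_not_P[OF False] by (rule small)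
  qed
  then show ?thesis using B[OF v] by simp
qed

lemma optimal_radius_product:
  assumes v: "v \<in> vertices24" and w: "w \<in> vertices24" and ne: "v \<noteq> w"
  shows "optimal_radius v * optimal_radius w \<le> (1 - v \<bullet> w) / 2"
proof (cases "v \<in> large_centres"; cases "w \<in> large_centres")
  assume vL: "v \<in> large_centres" and wL: "w \<in> large_centres"
  obtain i s where vi: "v = axis_vertex large_frame i s" by (rule large_centresE[OF vL])
  obtain j t where wj: "w = axis_vertex large_frame j t" by (rule large_centresE[OF wL])
  have "v \<bullet> w \<noteq> 1" using vertices24_inner_less_1[OF assms] by simp
  then have "v \<bullet> w \<le> 0" unfolding vi wj vertex_inner[OF large_frame_orthonormal]
    by (auto simp: pm_one_def split: if_splits)
  then show ?thesis using vL wL by (simp add: optimal_radius_def)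
next
  assume vL: "v \<in> large_centres" and wL: "w \<notin> large_centres"
  have "v \<bullet> w \<le> 1 / 2" using vertices24_inner[OF assms] by auto
  then show ?thesis using vL wL by (simp add: optimal_radius_def)
next
  assume vL: "v \<notin> large_centres" and wL: "w \<in> large_centres"
  have "v \<bullet> w \<le> 1 / 2" using vertices24_inner[OF assms] by auto
  then show ?thesis using vL wL by (simp add: optimal_radius_def)
next
  assume vL: "v \<notin> large_centres" and wL: "w \<notin> large_centres"
  have "v \<bullet> w \<le> 1 / 2" using vertices24_inner[OF assms] by auto
  then show ?thesis using vL wL by (simp add: optimal_radius_def)
qed

lemma arrangement_B1_optimal_radius: "arrangement_B1 (\<lambda>v. horoball v (optimal_radius v))"
proof -
  have touch: "touch_at (horoball v (optimal_radius v)) (horoball w (optimal_radius w))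
      ((1 / (optimal_radius v + optimal_radius w)) *\<^sub>R (optimal_radius w *\<^sub>R v + optimal_radius v *\<^sub>R w))"
    if "v \<in> vertices24" "w \<in> vertices24" "v \<noteq> w" "optimal_radius v * optimal_radius w = (1 - v \<bullet> w) / 2" for v w
    using that optimal_radius_bounds vertices24_norm(2) vertices24_inner_less_1 by (intro horoballs_touch) auto
  have same: "same_type (\<lambda>v. horoball v (optimal_radius v)) v w"
    if "v \<in> vertices24" "w \<in> vertices24" "optimal_radius v = optimal_radius w" for v w
    unfolding same_type_def using that by (simp add: hyp_vol_horoball_Int_P24 optimal_radius_bounds)
  show ?thesis
    unfolding arrangement_B1_def
  proof (intro conjI ballI allI impI)
    fix v assume "v \<in> vertices24"
    then show "is_horoball v (horoball v (optimal_radius v))"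
      unfolding is_horoball_def using vertices24_norm(2) optimal_radius_bounds by blast
  next
    fix v w assume "v \<in> large_centres" "w \<in> large_centres"
    then show "same_type (\<lambda>v. horoball v (optimal_radius v)) v w"
      using large_centres_subset by (intro same) (auto simp: optimal_radius_def)
  next
    fix F v w assume v: "v \<in> large_centres" and w: "w \<in> large_centres" and Fd: "F facet_of P24 \<and> facet_diagonal F v w"
    note diag = facet_diagonal_large[OF conjunct1[OF Fd] v w conjunct2[OF Fd]]
    have r: "optimal_radius v = 1 / sqrt 2" "optimal_radius w = 1 / sqrt 2" using v w by (simp_all add: optimal_radius_def)
    have "v \<noteq> w" using Fd by (simp add: facet_diagonal_def)
    then have "touch_at (horoball v (optimal_radius v)) (horoball w (optimal_radius w))
      ((1 / (optimal_radius v + optimal_radius w)) *\<^sub>R (optimal_radius w *\<^sub>R v + optimal_radius v *\<^sub>R w))"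
      using v w large_centres_subset diag(1) by (intro touch) (auto simp: r)
    moreover have "(1 / (optimal_radius v + optimal_radius w)) *\<^sub>R (optimal_radius w *\<^sub>R v + optimal_radius v *\<^sub>R w) = (1 / 2) *\<^sub>R (v + w)"
      unfolding r scaleR_add_right[symmetric] scaleR_scaleR by simp
    ultimately show "touch_at (horoball v (optimal_radius v)) (horoball w (optimal_radius w)) (facet_centre F)"
      by (simp only: diag(2))
  next
    fix v w assume "v \<in> vertices24 - large_centres" "w \<in> vertices24 - large_centres"
    then show "same_type (\<lambda>v. horoball v (optimal_radius v)) v w"
      by (intro same) (auto simp: optimal_radius_def)
  next
    fix v w assume v: "v \<in> vertices24 - large_centres" and w: "w \<in> large_centres" and J: "joined_by_edge v w"
    have v': "v \<in> vertices24" and w': "w \<in> vertices24" using v w large_centres_subset by auto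
    have "v \<bullet> w = 1 / 2" using small_large_inner[OF v w] joined_by_edge_inner[OF v' w' J] by auto
    moreover have "v \<noteq> w" using v w by auto
    ultimately have "touch_at (horoball v (optimal_radius v)) (horoball w (optimal_radius w))
      ((1 / (optimal_radius v + optimal_radius w)) *\<^sub>R (optimal_radius w *\<^sub>R v + optimal_radius v *\<^sub>R w))"
      using v w v' w' by (intro touch) (auto simp: optimal_radius_def)
    then show "\<exists>p. touch_at (horoball v (optimal_radius v)) (horoball w (optimal_radius w)) p" by blast
  qed
qed

lemma packing_density_arrangement_B1:
  assumes "arrangement_B1 B"
  shows "packing_density B = 5 * sqrt 2 / pi\<^sup>2"
proof -
  have L: "8 * optimal_radius (axis_vertex large_frame i s) ^ 3 = 2 * sqrt 2" for i s
  proof -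
    have "(1 / sqrt 2) ^ 3 = sqrt 2 / 4" by (simp add: power3_eq_cube divide_simps)
    then show ?thesis using axis_vertex_large[of i s] by (simp add: optimal_radius_def)
  qed
  have S: "8 * optimal_radius (cube_vertex large_frame b c d e) ^ 3 = sqrt 2 / 4" for b c d e
  proof -
    have "(sqrt 2 / 4) ^ 3 = sqrt 2 / 32" by (simp add: power3_eq_cube)
    then show ?thesis using cube_vertex_small[of b c d e] by (simp add: optimal_radius_def)
  qed
  have "(\<Sum>v\<in>vertices24. 8 * optimal_radius v ^ 3) = 20 * sqrt 2"
    unfolding vertices24_large_frame sum_frame_vertices[OF large_frame_orthonormal] L S
    by (simp add: UNIV_bool)
  moreover have "packing_density B = (\<Sum>v\<in>vertices24. 8 * optimal_radius v ^ 3) / (4 * pi\<^sup>2)"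
    by (rule packing_density_eq) (use arrangement_B1_radii[OF assms] optimal_radius_bounds in auto)
  ultimately show ?thesis by simp
qed

lemma optimal_density_approx: "\<bar>5 * sqrt 2 / pi\<^sup>2 - 0.71645\<bar> < 5 / 10 ^ 6"
proof -
  have s: "1414213 / 1000000 \<le> sqrt 2" by (rule real_le_rsqrt) (simp add: power2_eq_square)
  have s': "sqrt 2 \<le> 1414214 / 1000000" by (rule real_le_lsqrt) (simp_all add: power2_eq_square)
  have p: "3141592 / 1000000 \<le> pi" "pi \<le> 3141593 / 1000000" using pi_approx by simp_all
  have "(3141592 / 1000000)\<^sup>2 \<le> pi\<^sup>2" by (rule power_mono[OF p(1)]) simp
  then have p1: "9869600 / 1000000 \<le> pi\<^sup>2" by (simp add: power2_eq_square)
  have "pi\<^sup>2 \<le> (3141593 / 1000000)\<^sup>2" by (rule power_mono[OF p(2)]) simp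
  then have p2: "pi\<^sup>2 \<le> 9869607 / 1000000" by (simp add: power2_eq_square)
  have "5 * sqrt 2 < 716455 / 1000000 * pi\<^sup>2" "716445 / 1000000 * pi\<^sup>2 < 5 * sqrt 2"
    using s s' p1 p2 by linarith+
  moreover define d where "d = 5 * sqrt 2 / pi\<^sup>2"
  ultimately have "d < 716455 / 1000000" "716445 / 1000000 < d"
    by (simp_all add: pos_divide_less_eq pos_less_divide_eq)
  then have "\<bar>d - 0.71645\<bar> < 5 / 10 ^ 6" unfolding abs_less_iff by simp
  then show ?thesis by (simp only: d_def)
qed

theorem theorem4p11:
  shows "(\<exists>B. arrangement_B1 B) \<and>
    (\<forall>B. arrangement_B1 B \<longrightarrow>
       admissible_packing B \<and>
       (\<forall>B'. admissible_packing B' \<longrightarrow> packing_density B' \<le> packing_density B) \<and>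
       \<bar>packing_density B - 0.71645\<bar> < 5 / 10 ^ 6)"
proof (intro conjI allI impI)
  show "\<exists>B. arrangement_B1 B" using arrangement_B1_optimal_radius by blast
next
  fix B assume B: "arrangement_B1 B"
  show "admissible_packing B"
    using admissible_packing_iff[of B optimal_radius] arrangement_B1_radii[OF B] optimal_radius_bounds optimal_radius_product
    by blast
  show "packing_density B' \<le> packing_density B" if "admissible_packing B'" for B'
    using packing_density_le[OF that] by (simp add: packing_density_arrangement_B1[OF B])
  show "\<bar>packing_density B - 0.71645\<bar> < 5 / 10 ^ 6"
    unfolding packing_density_arrangement_B1[OF B] by (rule optimal_density_approx)
qed
end
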